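(* Let $\alpha_1,\alpha_2\in(0,1)$, $c>0$, $n\ge1$, $p>1$, and assume that $s\mapsto\Psi(s)^{-1}=s^{(\alpha_2c+\alpha_1s)/(c+s)}$ is a Bernstein function on $(0,\infty)$. Let $0\le u_0\in L^1(\mathbb R^n)\cap L^\infty(\mathbb R^n)$, and let $u$ be the nonnegative maximal mild solution, with maximal existence time $T_{\max}$. Fix $\beta>\max\{\alpha_1,\alpha_2\}$ and let $c_\beta\in(0,1]$ be a constant such that $K(s)\ge c_\beta(s/t)^\beta K(t)$ for all $0<s\le t<\infty$. If for some $R>0$ $$F_{R,0}^{\,p-1}\ge\frac n{R^2},\qquad F_{R,0}=\int_{\mathbb R^n}u_0(x)\xi_R(x)\,dx,$$ then $T_{\max}<\infty$ and $$K(T_{\max})\,F_{R,0}^{\,p-1}\le\frac{2^{1+\beta p/(p-1)}}{c_\beta}.$$ Equivalently, $$T_{\max}\le K^{-1}\!\left(C_{p,\beta}F_{R,0}^{1-p}\right),\qquad C_{p,\beta}=\frac{2^{1+\beta p/(p-1)}}{c_\beta}.$$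
   Context: A Bernstein function is a $C^\infty$ function $F:(0,\infty)\to[0,\infty)$ with $(-1)^{m-1}F^{(m)}\ge0$ for all $m\ge1$. $\Psi(z)=z^{-B(z)}$ with $B(z)=\frac{\alpha_2c+\alpha_1z}{c+z}$ (principal branch), $\psi\in L^1_{\rm loc}(0,\infty)$ is the continuous function on $(0,\infty)$ of exponential order whose Laplace transform is $\Psi$, and $K(t)=\int_0^t\psi(s)\,ds$, which under the Bernstein condition is a strictly increasing continuous bijection of $[0,\infty)$ with inverse $K^{-1}$. A constant $c_\beta$ as required exists for every $\beta>\max\{\alpha_1,\alpha_2\}$. $\xi_R(x)=(4\pi R^2)^{-n/2}\exp(-|x|^2/(4R^2))$. The families are $S_{\mathcal A}(t)g=Z(t)*g$, $P_{\mathcal A}(t)g=Y(t)*g$, where, under the Bernstein condition, $Z(t)$ ($t>0$, weakly continuous in $t$) are probability measures and $Y(t)$ (a.e. $t>0$, measurable in $t$) are finite positive measures on $\mathbb R^n$ determined by $$\int_0^\infty e^{-zt}\int_{\mathbb R^n}e^{-ix\cdot\xi}Z(t,dx)\,dt=\frac{\Psi(z)^{-1}}{z(\Psi(z)^{-1}+|\xi|^2)},\qquad\int_0^\infty e^{-zt}\int_{\mathbb R^n}e^{-ix\cdot\xi}Y(t,dx)\,dt=\frac1{\Psi(z)^{-1}+|\xi|^2}\quad(z>0);$$ $S_{\mathcal A}(0)=I$. A mild solution on $[0,T]$ is a function in $C([0,T];L^1(\mathbb R^n))\cap L^\infty((0,T);L^\infty(\mathbb R^n))$ satisfying $$u(t)=S_{\mathcal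 A}(t)u_0+\int_0^tP_{\mathcal A}(t-s)(u(s)_+)^p\,ds$$ in $L^1$ for every $t\in[0,T]$ and in $L^\infty$ for a.e. $t>0$. For each $0\le u_0\in L^1\cap L^\infty$ there is a unique nonnegative maximal mild solution $u$ on $[0,T_{\max})$, $0<T_{\max}\le\infty$, i.e. one that is a mild solution on $[0,T]$ for all $T<T_{\max}$ and cannot be extended to a mild solution on a strictly larger interval. *)

theory Defs
  imports "HOL-Probability.Probability"
begin

section \<open>The symbol, its inverse Laplace transform, and Bernstein functions\<close>

text \<open>\<^term>\<open>(deriv ^^ m) F s\<close> at \<open>s > 0\<close> only depends on \<open>F\<close> on the open half-line, and the first
  clause says that \<open>F\<close> is smooth there; values of \<open>F\<close> outside are irrelevant.\<close>

definition Bernstein_function :: "(real \<Rightarrow> real) \<Rightarrow> bool" where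
  "Bernstein_function F \<longleftrightarrow>
     (\<forall>m. \<forall>s>0. (deriv ^^ m) F field_differentiable (at s)) \<and>
     (\<forall>s>0. 0 \<le> F s) \<and>
     (\<forall>m\<ge>1. \<forall>s>0. 0 \<le> (-1) ^ (m - 1) * (deriv ^^ m) F s)"

text \<open>Both functions are polymorphic, so that the same \<open>\<Psi>\<close> can be used at real positive arguments
  and, with the principal branch of the logarithm, at complex ones.\<close>

definition B_fun :: "real \<Rightarrow> real \<Rightarrow> real \<Rightarrow> 'a::{real_normed_field, ln} \<Rightarrow> 'a" where
  "B_fun \<alpha>1 \<alpha>2 c z = (of_real (\<alpha>2 * c) + of_real \<alpha>1 * z) / (of_real c + z)"

definition \<Psi> :: "real \<Rightarrow> real \<Rightarrow> real \<Rightarrow> 'a::{real_normed_field, ln} \<Rightarrow> 'a" where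
  "\<Psi> \<alpha>1 \<alpha>2 c z = z powr (- B_fun \<alpha>1 \<alpha>2 c z)"

text \<open>The function \<open>\<psi>\<close> on \<open>(0,\<infinity>)\<close>. It may be unbounded at \<open>0\<close>, so the exponential bound is imposed
  away from \<open>0\<close> and local integrability is required up to \<open>0\<close>.\<close>

definition inverse_Laplace_of_\<Psi> :: "real \<Rightarrow> real \<Rightarrow> real \<Rightarrow> (real \<Rightarrow> real) \<Rightarrow> bool" where
  "inverse_Laplace_of_\<Psi> \<alpha>1 \<alpha>2 c \<psi> \<longleftrightarrow>
     continuous_on {0<..} \<psi> \<and>
     (\<forall>T>0. set_integrable lborel {0<..T} \<psi>) \<and>
     (\<exists>M \<omega>. (\<forall>t\<ge>1. \<bar>\<psi> t\<bar> \<le> M * exp (\<omega> * t)) \<and>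
       (\<forall>z::complex. Re z > max 0 \<omega> \<longrightarrow>
          (LINT t:{0<..}|lborel. exp (- z * of_real t) * of_real (\<psi> t)) = \<Psi> \<alpha>1 \<alpha>2 c z))"

definition K :: "(real \<Rightarrow> real) \<Rightarrow> real \<Rightarrow> real" where
  "K \<psi> t = (LINT s:{0<..t}|lborel. \<psi> s)"

definition K_inv :: "(real \<Rightarrow> real) \<Rightarrow> real \<Rightarrow> real" where
  "K_inv \<psi> = the_inv_into {0..} (K \<psi>)"

section \<open>The resolvent families\<close>

definition Fourier_measure :: "(real^'n) measure \<Rightarrow> real^'n \<Rightarrow> complex" where
  "Fourier_measure \<mu> \<xi> = (LINT x|\<mu>. exp (- (\<i> * of_real (x \<bullet> \<xi>))))"

text \<open>In the two transform identities the right-hand side is never \<open>0\<close>, so they also express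
  absolute convergence of the Laplace integral (a divergent integral has value \<open>0\<close>).
  The families are indexed by \<open>t > 0\<close>; values at other \<open>t\<close> are irrelevant.\<close>

definition Z_family :: "real \<Rightarrow> real \<Rightarrow> real \<Rightarrow> (real \<Rightarrow> (real^'n) measure) \<Rightarrow> bool" where
  "Z_family \<alpha>1 \<alpha>2 c Z \<longleftrightarrow>
     (\<forall>t>0. prob_space (Z t) \<and> sets (Z t) = sets borel) \<and>
     (\<forall>f :: real^'n \<Rightarrow> real. continuous_on UNIV f \<and> bounded (range f) \<longrightarrow>
        continuous_on {0<..} (\<lambda>t. LINT x|Z t. f x)) \<and>
     (\<forall>z>0. \<forall>\<xi>.
        (LINT t:{0<..}|lebesgue. of_real (exp (- z * t)) * Fourier_measure (Z t) \<xi>) =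
        of_real (inverse (\<Psi> \<alpha>1 \<alpha>2 c z) / (z * (inverse (\<Psi> \<alpha>1 \<alpha>2 c z) + (norm \<xi>)\<^sup>2))))"

definition Y_family :: "real \<Rightarrow> real \<Rightarrow> real \<Rightarrow> (real \<Rightarrow> (real^'n) measure) \<Rightarrow> bool" where
  "Y_family \<alpha>1 \<alpha>2 c Y \<longleftrightarrow>
     (AE t in lebesgue_on {0<..}. finite_measure (Y t) \<and> sets (Y t) = sets borel) \<and>
     (\<forall>A\<in>sets borel. (\<lambda>t. measure (Y t) A) \<in> borel_measurable (lebesgue_on {0<..})) \<and>
     (\<forall>z>0. \<forall>\<xi>.
        (LINT t:{0<..}|lebesgue. of_real (exp (- z * t)) * Fourier_measure (Y t) \<xi>) =
        of_real (1 / (inverse (\<Psi> \<alpha>1 \<alpha>2 c z) + (norm \<xi>)\<^sup>2)))"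

definition measure_conv :: "(real^'n) measure \<Rightarrow> (real^'n \<Rightarrow> real) \<Rightarrow> real^'n \<Rightarrow> real" where
  "measure_conv \<mu> g x = (LINT y|\<mu>. g (x - y))"

definition S_op :: "(real \<Rightarrow> (real^'n) measure) \<Rightarrow> real \<Rightarrow> (real^'n \<Rightarrow> real) \<Rightarrow> real^'n \<Rightarrow> real" where
  "S_op Z t g = (if t = 0 then g else measure_conv (Z t) g)"

definition P_op :: "(real \<Rightarrow> (real^'n) measure) \<Rightarrow> real \<Rightarrow> (real^'n \<Rightarrow> real) \<Rightarrow> real^'n \<Rightarrow> real" where
  "P_op Y t g = measure_conv (Y t) g"

section \<open>Functions of time with values in \<open>L\<^sup>1\<close> or \<open>L\<^sup>\<infinity>\<close>\<close>

text \<open>An element of \<open>L\<^sup>1\<close> or \<open>L\<^sup>\<infinity>\<close> is given by a Borel representative. The norms below are extended: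
  the space is the set of \<open>f\<close> with finite norm (non-measurable \<open>f\<close> have norm \<open>\<infinity>\<close>), and equality in
  the space is \<open>norm (f - g) = 0\<close>.\<close>

definition L1_norm :: "(real^'n \<Rightarrow> real) \<Rightarrow> ennreal" where
  "L1_norm f = (if f \<in> borel_measurable lborel
                then (\<integral>\<^sup>+x. ennreal \<bar>f x\<bar> \<partial>lborel) else \<infinity>)"

definition Linf_norm :: "(real^'n \<Rightarrow> real) \<Rightarrow> ennreal" where
  "Linf_norm f = (if f \<in> borel_measurable lborel
                  then esssup lborel (\<lambda>x. ennreal \<bar>f x\<bar>) else \<infinity>)"

text \<open>Strong measurability and the Bochner integral over a time set \<open>I\<close> of finite measure, for
  functions with values in the space of an extended norm \<open>N\<close>. The library's Bochner integral
  needs a second countable Banach type, which \<open>L\<^sup>\<infinity>\<close> is not; the definition has the same shape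
  (approximation by simple functions).\<close>

definition simple_into ::
  "(('x \<Rightarrow> real) \<Rightarrow> ennreal) \<Rightarrow> real set \<Rightarrow> (real \<Rightarrow> 'x \<Rightarrow> real) \<Rightarrow> bool" where
  "simple_into N I \<sigma> \<longleftrightarrow>
     finite (\<sigma> ` I) \<and> (\<forall>g\<in>\<sigma> ` I. N g < \<infinity> \<and> {s\<in>I. \<sigma> s = g} \<in> sets lebesgue)"

definition simple_integral_into :: "real set \<Rightarrow> (real \<Rightarrow> 'x \<Rightarrow> real) \<Rightarrow> 'x \<Rightarrow> real" where
  "simple_integral_into I \<sigma> x = (\<Sum>g\<in>\<sigma> ` I. measure lebesgue {s\<in>I. \<sigma> s = g} * g x)"

definition strongly_measurable_into ::
  "(('x \<Rightarrow> real) \<Rightarrow> ennreal) \<Rightarrow> real set \<Rightarrow> (real \<Rightarrow> 'x \<Rightarrow> real) \<Rightarrow> bool" where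
  "strongly_measurable_into N I w \<longleftrightarrow>
     (\<exists>\<sigma>. (\<forall>k::nat. simple_into N I (\<sigma> k)) \<and>
          (AE s in lebesgue_on I. (\<lambda>k. N (\<lambda>x. w s x - \<sigma> k s x)) \<longlonglongrightarrow> 0))"

definition has_Bochner_integral_into ::
  "(('x \<Rightarrow> real) \<Rightarrow> ennreal) \<Rightarrow> real set \<Rightarrow> (real \<Rightarrow> 'x \<Rightarrow> real) \<Rightarrow> ('x \<Rightarrow> real) \<Rightarrow> bool" where
  "has_Bochner_integral_into N I w h \<longleftrightarrow>
     strongly_measurable_into N I w \<and> N h < \<infinity> \<and>
     (\<exists>\<sigma>. (\<forall>k::nat. simple_into N I (\<sigma> k)) \<and>
          (\<lambda>k. \<integral>\<^sup>+s. N (\<lambda>x. w s x - \<sigma> k s x) \<partial>lebesgue_on I) \<longlonglongrightarrow> 0 \<and>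
          (\<lambda>k. N (\<lambda>x. h x - simple_integral_into I (\<sigma> k) x)) \<longlonglongrightarrow> 0)"

section \<open>Mild solutions\<close>

text \<open>The integral equation at time \<open>t\<close>, as an identity in the space with norm \<open>N\<close>.\<close>

definition mild_equation_at ::
  "((real^'n \<Rightarrow> real) \<Rightarrow> ennreal) \<Rightarrow> (real \<Rightarrow> (real^'n) measure) \<Rightarrow> (real \<Rightarrow> (real^'n) measure) \<Rightarrow>
   real \<Rightarrow> (real^'n \<Rightarrow> real) \<Rightarrow> (real \<Rightarrow> real^'n \<Rightarrow> real) \<Rightarrow> real \<Rightarrow> bool" where
  "mild_equation_at N Z Y p u0 u t \<longleftrightarrow>
     N (u t) < \<infinity> \<and> N (S_op Z t u0) < \<infinity> \<and>
     (\<exists>h. has_Bochner_integral_into N {0<..<t}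
            (\<lambda>s. P_op Y (t - s) (\<lambda>x. max 0 (u s x) powr p)) h \<and>
          N (\<lambda>x. u t x - (S_op Z t u0 x + h x)) = 0)"

definition mild_solution ::
  "(real \<Rightarrow> (real^'n) measure) \<Rightarrow> (real \<Rightarrow> (real^'n) measure) \<Rightarrow>
   real \<Rightarrow> (real^'n \<Rightarrow> real) \<Rightarrow> real \<Rightarrow> (real \<Rightarrow> real^'n \<Rightarrow> real) \<Rightarrow> bool" where
  "mild_solution Z Y p u0 T u \<longleftrightarrow>
     (\<forall>t\<in>{0..T}. L1_norm (u t) < \<infinity> \<and>
        ((\<lambda>s. L1_norm (\<lambda>x. u s x - u t x)) \<longlongrightarrow> 0) (at t within {0..T})) \<and>
     strongly_measurable_into Linf_norm {0<..<T} u \<and>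
     (\<exists>M::real. AE t in lebesgue_on {0<..<T}. Linf_norm (u t) \<le> ennreal M) \<and>
     (\<forall>t\<in>{0..T}. mild_equation_at L1_norm Z Y p u0 u t) \<and>
     (AE t in lebesgue_on {0<..<T}. mild_equation_at Linf_norm Z Y p u0 u t)"

text \<open>\<open>Tmax\<close> ranges over \<open>(0,\<infinity>]\<close>. An extension to a strictly larger interval contains, by
  restriction, a mild solution on some \<open>[0,T]\<close> with \<open>T \<ge> Tmax\<close>.\<close>

definition maximal_mild_solution ::
  "(real \<Rightarrow> (real^'n) measure) \<Rightarrow> (real \<Rightarrow> (real^'n) measure) \<Rightarrow>
   real \<Rightarrow> (real^'n \<Rightarrow> real) \<Rightarrow> ereal \<Rightarrow> (real \<Rightarrow> real^'n \<Rightarrow> real) \<Rightarrow> bool" where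
  "maximal_mild_solution Z Y p u0 Tmax u \<longleftrightarrow>
     0 < Tmax \<and>
     (\<forall>T>0. ereal T < Tmax \<longrightarrow> mild_solution Z Y p u0 T u) \<and>
     \<not> (\<exists>T v. Tmax \<le> ereal T \<and> mild_solution Z Y p u0 T v \<and>
          (\<forall>t\<ge>0. ereal t < Tmax \<longrightarrow> (AE x in lborel. v t x = u t x)))"

definition \<xi>_fun :: "real \<Rightarrow> real^'n \<Rightarrow> real" where
  "\<xi>_fun R x = (4 * pi * R\<^sup>2) powr (- (real CARD('n) / 2)) * exp (- ((norm x)\<^sup>2 / (4 * R\<^sup>2)))"

definition F_init :: "(real^'n \<Rightarrow> real) \<Rightarrow> real \<Rightarrow> real" where
  "F_init u0 R = (LINT x|lborel. u0 x * \<xi>_fun R x)"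

end

theory Submission
  imports Defs
begin

text \<open>
  Fourier transform in space turns the mild equation, for each frequency \<open>\<eta>\<close>, into
  \<open>u = u0 Zhat + Yhat * u\<^sub>+\<^sup>p\<close> (convolution in time), and by uniqueness of Laplace transforms this is
  \<open>u + |\<eta>|\<^sup>2 \<psi> * u = u0 + \<psi> * u\<^sub>+\<^sup>p\<close>. Integrating against the Gaussian whose Fourier transform is the
  weight \<open>\<xi>\<^sub>R\<close>, and using \<open>\<Delta>\<xi>\<^sub>R \<ge> - n / (2 R\<^sup>2) \<xi>\<^sub>R\<close> and Jensen's inequality, the mean \<open>F\<close> of \<open>u\<close> satisfies
  \<open>F \<ge> F(0) + \<psi> * (F\<^sup>p - n / (2 R\<^sup>2) F)\<close>. The size condition on \<open>F(0)\<close> gives first \<open>F \<ge> F(0)\<close> and then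
  \<open>F \<ge> \<psi> * F\<^sup>p / 2\<close>, and iterating this over \<open>t\<^sub>k = T (1 - 2\<^sup>-\<^sup>k)\<close> bounds \<open>K(T) F(0)\<^sup>p\<^sup>-\<^sup>1\<close>.

  Nonnegativity of \<open>\<psi>\<close> comes from \<open>\<psi>(t)\<close> being the total mass of \<open>Y(t)\<close>. That \<open>K\<close> is strictly
  increasing comes from \<open>|Yhat(t, \<eta>)| \<le> \<psi>(t)\<close>: on a gap of \<open>\<psi>\<close> the equation
  \<open>Yhat + |\<eta>|\<^sup>2 \<psi> * Yhat = \<psi>\<close> forces \<open>\<psi> * \<psi> = 0\<close> there as \<open>\<eta> \<rightarrow> 0\<close>, while \<open>\<psi> * \<psi> > 0\<close> just after any point
  of the support.
\<close>

section \<open>Laplace transforms and convolution on the half-line\<close>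

text \<open>The families are given by transforms in time and space, so the scalar identities come
  out for almost every \<open>t\<close> only, and continuity in time has to restore the exceptional
  times. Pointwise calculus in \<open>x\<close> is avoided as well: the Laplacian occurs only as the
  factor |\<eta>|^2 on the frequency side. On the constant: n / R^2 is twice the coefficient n / (2
  R^2) of the linear term, so at least half of F^p survives, which is the 1 in the exponent of 2. An
  interval of length T 2^(-j) costs a factor 2^(-\<beta> j) by the lower bound on \<open>K\<close>;
  relative to the starting value the later powers discount the j-th loss by p^(-j), and (p - 1)
  times the sum of \<beta> j p^(-j) over j >= 1 is \<beta> p / (p - 1). It contradicts the
  unboundedness of \<open>K\<close> if \<open>Tmax\<close> is infinite and passes to the limit
  otherwise.\<close>

lemma exp_minus_integral_poly_eq_0:
  fixes g :: "real \<Rightarrow> real"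
  assumes g: "integrable lborel g" "\<And>t. t \<le> 0 \<Longrightarrow> g t = 0"
    and moments: "\<And>k::nat. (LINT t|lborel. exp (- t) ^ k * g t) = 0"
    and h: "continuous_on {0..1} h"
  shows "(LINT t|lborel. h (exp (- t)) * g t) = 0"
proof (cases "integrable lborel (\<lambda>t. h (exp (- t)) * g t)")
  \<comment> \<open>The integral of a non-integrable function is 0 by default, so measurability of
    \<open>h (exp (- t))\<close>, with \<open>h\<close> continuous on [0,1] only, never has to be
    shown.\<close>
  case False
  then show ?thesis by (rule not_integrable_integral_eq)
next
  case True
  have int: "integrable lborel (\<lambda>t. exp (- t) ^ k * g t)" for k :: nat
  proof (rule Bochner_Integration.integrable_bound[OF g(1)])
    have "norm (exp (- t) ^ k * g t) \<le> norm (g t)" for t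
    proof (cases "t \<le> 0")
      case False
      then have "exp (- t) ^ k \<le> 1" by (intro power_le_one) auto
      then show ?thesis by (simp add: abs_mult mult_left_le_one_le)
    qed (simp add: g(2))
    then show "AE t in lborel. norm (exp (- t) ^ k * g t) \<le> norm (g t)" by simp
  qed (use g(1) in auto)
  have poly: "integrable lborel (\<lambda>t. (\<Sum>i\<le>d. a i * exp (- t) ^ i) * g t)"
    "(LINT t|lborel. (\<Sum>i\<le>d. a i * exp (- t) ^ i) * g t) = 0" for a :: "nat \<Rightarrow> real" and d
  proof -
    have "(\<lambda>t. (\<Sum>i\<le>d. a i * exp (- t) ^ i) * g t) = (\<lambda>t. \<Sum>i\<le>d. a i * (exp (- t) ^ i * g t))"
      by (simp add: sum_distrib_right mult.assoc)
    then show "integrable lborel (\<lambda>t. (\<Sum>i\<le>d. a i * exp (- t) ^ i) * g t)"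
      "(LINT t|lborel. (\<Sum>i\<le>d. a i * exp (- t) ^ i) * g t) = 0"
      using int moments by (auto simp: Bochner_Integration.integral_sum)
  qed
  have "\<bar>LINT t|lborel. h (exp (- t)) * g t\<bar> \<le> e * (LINT t|lborel. \<bar>g t\<bar>)" if e: "e > 0" for e
  proof -
    \<comment> \<open>With x = exp (- t) all moments of a finite signed measure on (0,1) vanish;
      Weierstrass approximation replaces \<open>h\<close> by a polynomial at the cost of e times its
      total variation.\<close>
    obtain q where q: "real_polynomial_function q" and hq: "\<And>x. x \<in> {0..1} \<Longrightarrow> \<bar>h x - q x\<bar> < e"
      using Stone_Weierstrass_real_polynomial_function[OF _ h e] by auto
    obtain a d where qa: "q = (\<lambda>x. \<Sum>i\<le>d. a i * x ^ i)"
      using q unfolding real_polynomial_function_iff_sum by auto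
    have "(LINT t|lborel. h (exp (- t)) * g t)
        = (LINT t|lborel. h (exp (- t)) * g t - q (exp (- t)) * g t)"
      using True poly[where a=a and d=d] by (simp add: qa)
    also have "\<bar>\<dots>\<bar> \<le> (LINT t|lborel. \<bar>h (exp (- t)) * g t - q (exp (- t)) * g t\<bar>)"
      by simp
    also have "\<dots> \<le> (LINT t|lborel. e * \<bar>g t\<bar>)"
    proof (rule integral_mono)
      show "integrable lborel (\<lambda>t. \<bar>h (exp (- t)) * g t - q (exp (- t)) * g t\<bar>)"
        using True poly[where a=a and d=d] by (simp add: qa)
      show "integrable lborel (\<lambda>t. e * \<bar>g t\<bar>)" using g by simp
      show "\<bar>h (exp (- t)) * g t - q (exp (- t)) * g t\<bar> \<le> e * \<bar>g t\<bar>" for t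
      proof (cases "t \<le> 0")
        case True then show ?thesis by (simp add: g(2))
      next
        case False
        then have "\<bar>h (exp (- t)) - q (exp (- t))\<bar> \<le> e"
          using hq[of "exp (- t)"] by auto
        then show ?thesis
          by (simp flip: left_diff_distrib add: abs_mult mult_right_mono)
      qed
    qed
    finally show ?thesis by simp
  qed
  then have "eventually (\<lambda>e. \<bar>LINT t|lborel. h (exp (- t)) * g t\<bar> \<le> e * (LINT t|lborel. \<bar>g t\<bar>)) (at_right 0)"
    by (auto simp: eventually_at_filter)
  moreover have "((\<lambda>e. e * (LINT t|lborel. \<bar>g t\<bar>)) \<longlongrightarrow> 0 * (LINT t|lborel. \<bar>g t\<bar>)) (at_right 0)"
    by (intro tendsto_intros)
  ultimately have "\<bar>LINT t|lborel. h (exp (- t)) * g t\<bar> \<le> 0 * (LINT t|lborel. \<bar>g t\<bar>)"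
    by (intro tendsto_lowerbound[of _ _ "at_right 0"]) auto
  then show ?thesis by simp
qed

text \<open>The positive and the negative part of \<open>g\<close> are densities of two finite
  measures that agree on all open half-lines. \<open>ennreal\<close> cuts off negative values, so
  equality of the two densities forces both parts to be 0.\<close>

lemma AE_zero_if_tail_integrals_zero:
  fixes g :: "real \<Rightarrow> real"
  assumes g: "integrable lborel g"
    and tails: "\<And>a. (LINT t|lborel. indicator {a<..} t * g t) = 0"
  shows "AE t in lborel. g t = 0"
proof -
  have [measurable]: "g \<in> borel_measurable borel" using g by auto
  have ig: "integrable lborel (\<lambda>t. indicator {a<..} t * g t)" for a
    using g by (intro integrable_real_mult_indicator[unfolded mult.commute[of _ "indicator _ _"]]) auto
  have "density lborel (\<lambda>t. ennreal (g t)) = density lborel (\<lambda>t. ennreal (- g t))"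
  proof (rule measure_eqI_lessThan)
    fix a
    have e1: "emeasure (density lborel (\<lambda>t. ennreal (g t))) {a<..}
        = (\<integral>\<^sup>+t. ennreal (indicator {a<..} t * g t) \<partial>lborel)"
      by (subst emeasure_density) (auto intro!: nn_integral_cong split: split_indicator)
    have e2: "emeasure (density lborel (\<lambda>t. ennreal (- g t))) {a<..}
        = (\<integral>\<^sup>+t. ennreal (- (indicator {a<..} t * g t)) \<partial>lborel)"
      by (subst emeasure_density) (auto intro!: nn_integral_cong split: split_indicator)
    have f1: "(\<integral>\<^sup>+t. ennreal (indicator {a<..} t * g t) \<partial>lborel) < \<infinity>"
      and f2: "(\<integral>\<^sup>+t. ennreal (- (indicator {a<..} t * g t)) \<partial>lborel) < \<infinity>"
      using ig[of a] unfolding real_integrable_def by (auto simp: less_top)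
    have "0 = enn2real (\<integral>\<^sup>+t. ennreal (indicator {a<..} t * g t) \<partial>lborel)
       - enn2real (\<integral>\<^sup>+t. ennreal (- (indicator {a<..} t * g t)) \<partial>lborel)"
      using real_lebesgue_integral_def[OF ig[of a]] tails[of a] by simp
    then have "(\<integral>\<^sup>+t. ennreal (indicator {a<..} t * g t) \<partial>lborel)
      = (\<integral>\<^sup>+t. ennreal (- (indicator {a<..} t * g t)) \<partial>lborel)"
      using f1 f2 by (metis cancel_comm_monoid_add_class.diff_cancel eq_iff_diff_eq_0 ennreal_enn2real infinity_ennreal_def)
    then show "emeasure (density lborel (\<lambda>t. ennreal (g t))) {a<..} =
      emeasure (density lborel (\<lambda>t. ennreal (- g t))) {a<..}"
      by (simp add: e1 e2)
    show "emeasure (density lborel (\<lambda>t. ennreal (g t))) {a<..} < \<infinity>"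
      using f1 by (simp add: e1)
  qed auto
  then have "AE t in lborel. ennreal (g t) = ennreal (- g t)"
    by (intro sigma_finite_measure.density_unique[OF sigma_finite_lborel]) auto
  then show ?thesis
    by eventually_elim (metis add.inverse_inverse dual_order.antisym ennreal_eq_0_iff linorder_linear neg_0_equal_iff_equal neg_le_0_iff_le)
qed

text \<open>The transform at w + 1 + k is the k-th moment in exp (- t) of the integrable function
  exp (- (w + 1) t) f(t), so the problem becomes a moment problem on (0,1).\<close>

lemma Laplace_real_unique:
  fixes f :: "real \<Rightarrow> real"
  assumes [measurable]: "f \<in> borel_measurable borel" and f0: "\<And>t. t \<le> 0 \<Longrightarrow> f t = 0"
    and int: "\<And>z. z > w \<Longrightarrow> integrable lborel (\<lambda>t. exp (- z * t) * f t)"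
    and L0: "\<And>z. z > w \<Longrightarrow> (LINT t|lborel. exp (- z * t) * f t) = 0"
  shows "AE t in lborel. f t = 0"
proof -
  define g where "g t = exp (- (w + 1) * t) * f t" for t
  have g: "integrable lborel g" "\<And>t. t \<le> 0 \<Longrightarrow> g t = 0"
    using int[of "w + 1"] by (auto simp: g_def[abs_def] f0)
  have [measurable]: "g \<in> borel_measurable borel" using g by auto
  have "(LINT t|lborel. exp (- t) ^ k * g t) = 0" for k :: nat
  proof -
    have "exp (- t) ^ k * g t = exp (- (w + 1 + k) * t) * f t" for t
      by (simp add: g_def exp_of_nat_mult[symmetric] exp_add[symmetric] algebra_simps flip: exp_add mult.assoc)
    then show ?thesis using L0[of "w + 1 + k"] by simp
  qed
  note W = exp_minus_integral_poly_eq_0[OF g this]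
  have "(LINT t|lborel. indicator {a<..} t * g t) = 0" for a
  proof -
    \<comment> \<open>Continuous ramps in x = exp (- t), tending to the indicator of x < exp (- a),
      that is, of t > a.\<close>
    define h where "h m x = max 0 (min 1 (real m * (exp (- a) - x)))" for m :: nat and x
    have "(\<lambda>m. LINT t|lborel. h m (exp (- t)) * g t) \<longlonglongrightarrow> (LINT t|lborel. indicator {a<..} t * g t)"
    proof (rule integral_dominated_convergence)
      show "integrable lborel (\<lambda>t. \<bar>g t\<bar>)" using g by simp
      show "(\<lambda>t. indicator {a<..} t * g t) \<in> borel_measurable lborel" by measurable
      show "(\<lambda>t. h m (exp (- t)) * g t) \<in> borel_measurable lborel" for m
        unfolding h_def by measurable
      show "AE t in lborel. norm (h m (exp (- t)) * g t) \<le> \<bar>g t\<bar>" for m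
        by (auto simp: h_def abs_mult intro!: mult_left_le_one_le)
      show "AE t in lborel. (\<lambda>m. h m (exp (- t)) * g t) \<longlonglongrightarrow> indicator {a<..} t * g t"
      proof (intro AE_I2 tendsto_mult tendsto_const)
        fix t
        show "(\<lambda>m. h m (exp (- t))) \<longlonglongrightarrow> indicator {a<..} t"
        proof (cases "t > a")
          case True
          then have d: "exp (- a) - exp (- t) > 0" by simp
          have "eventually (\<lambda>m. real m \<ge> 1 / (exp (- a) - exp (- t))) sequentially"
            using filterlim_real_sequentially unfolding filterlim_at_top by blast
          then have "eventually (\<lambda>m. h m (exp (- t)) = 1) sequentially"
            by eventually_elim (use d in \<open>auto simp: h_def field_simps\<close>)
          then show ?thesis using True by (simp add: tendsto_eventually)
        next
          case False
          then have d: "exp (- a) - exp (- t) \<le> 0" by simp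
          have "h m (exp (- t)) = 0" for m
            unfolding h_def using mult_nonneg_nonpos[OF _ d, of "real m"] by (simp add: max_def min_def)
          then show ?thesis using False by simp
        qed
      qed
    qed
    moreover have "(LINT t|lborel. h m (exp (- t)) * g t) = 0" for m
      by (rule W) (auto simp: h_def intro!: continuous_intros)
    ultimately show ?thesis by (simp add: LIMSEQ_const_iff)
  qed
  from AE_zero_if_tail_integrals_zero[OF g(1) this]
  show ?thesis by eventually_elim (simp add: g_def)
qed

lemma Laplace_unique:
  fixes f :: "real \<Rightarrow> complex"
  assumes [measurable]: "f \<in> borel_measurable borel" and f0: "\<And>t. t \<le> 0 \<Longrightarrow> f t = 0"
    and int: "\<And>z. z > w \<Longrightarrow> integrable lborel (\<lambda>t. exp (- z * t) *\<^sub>R f t)"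
    and L0: "\<And>z. z > w \<Longrightarrow> (LINT t|lborel. exp (- z * t) *\<^sub>R f t) = 0"
  shows "AE t in lborel. f t = 0"
proof -
  have "AE t in lborel. Re (f t) = 0"
  proof (rule Laplace_real_unique[where w=w])
    fix z assume "z > w"
    then show "integrable lborel (\<lambda>t. exp (- z * t) * Re (f t))"
      "(LINT t|lborel. exp (- z * t) * Re (f t)) = 0"
      using integrable_Re[OF int, of z] integral_Re[OF int, of z] L0[of z] by simp_all
  qed (auto simp: f0)
  moreover have "AE t in lborel. Im (f t) = 0"
  proof (rule Laplace_real_unique[where w=w])
    fix z assume "z > w"
    then show "integrable lborel (\<lambda>t. exp (- z * t) * Im (f t))"
      "(LINT t|lborel. exp (- z * t) * Im (f t)) = 0"
      using integrable_Im[OF int, of z] integral_Im[OF int, of z] L0[of z] by simp_all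
  qed (auto simp: f0)
  ultimately show ?thesis by eventually_elim (simp add: complex_eq_iff)
qed

section \<open>Convolution and the one-sided Laplace transform\<close>

definition conv :: "(real \<Rightarrow> complex) \<Rightarrow> (real \<Rightarrow> complex) \<Rightarrow> real \<Rightarrow> complex" where
  "conv f g t = (LINT s|lborel. f (t - s) * g s)"

lemma borel_measurable_conv [measurable]:
  assumes [measurable]: "f \<in> borel_measurable borel" "g \<in> borel_measurable borel"
  shows "conv f g \<in> borel_measurable borel"
  unfolding conv_def[abs_def] by measurable

lemma
  assumes f: "integrable lborel f" and g: "integrable lborel g"
  shows integrable_conv: "integrable lborel (conv f g)"
    and integral_conv: "(LINT t|lborel. conv f g t) = (LINT t|lborel. f t) * (LINT t|lborel. g t)"
    and AE_integrable_conv: "AE t in lborel. integrable lborel (\<lambda>s. f (t - s) * g s)"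
proof -
  have [measurable]: "f \<in> borel_measurable borel" "g \<in> borel_measurable borel" using f g by auto
  have f_shift: "integrable lborel (\<lambda>t. f (t - s))" "(LINT t|lborel. f (t - s)) = (LINT t|lborel. f t)"
    "(LINT t|lborel. norm (f (t - s))) = (LINT t|lborel. norm (f t))" for s
    using lborel_integrable_real_affine[OF f, of 1 "-s"] lborel_integral_real_affine[of 1 f "-s"]
      lborel_integral_real_affine[of 1 "\<lambda>t. norm (f t)" "-s"] by simp_all
  have *: "integrable (lborel \<Otimes>\<^sub>M lborel) (\<lambda>(s, t). f (t - s) * g s)"
  proof (rule lborel_pair.Fubini_integrable)
    show "integrable lborel (\<lambda>s. LINT t|lborel. norm (case (s, t) of (s, t) \<Rightarrow> f (t - s) * g s))"
      using g by (simp add: norm_mult f_shift)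
    show "AE s in lborel. integrable lborel (\<lambda>t. case (s, t) of (s, t) \<Rightarrow> f (t - s) * g s)"
      using f_shift by simp
  qed measurable
  then have sw: "integrable (lborel \<Otimes>\<^sub>M lborel) (\<lambda>(t, s). f (t - s) * g s)"
    using lborel_pair.integrable_product_swap[OF *] by (simp add: case_prod_beta')
  show "integrable lborel (conv f g)"
    using lborel_pair.integrable_fst'[OF sw] by (simp add: conv_def[abs_def])
  show "AE t in lborel. integrable lborel (\<lambda>s. f (t - s) * g s)"
    using lborel_pair.AE_integrable_fst'[OF sw] by simp
  have "(LINT t|lborel. conv f g t) = (LINT s|lborel. LINT t|lborel. f (t - s) * g s)"
    unfolding conv_def using lborel_pair.Fubini_integral[OF *] by simp
  also have "\<dots> = (LINT t|lborel. f t) * (LINT t|lborel. g t)"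
    by (simp add: f_shift)
  finally show "(LINT t|lborel. conv f g t) = (LINT t|lborel. f t) * (LINT t|lborel. g t)" .
qed

text \<open>Vanishing on the nonpositive axis is built in: it makes the integral over the line the
  one-sided transform and turns \<open>conv\<close> into the convolution over (0,t).\<close>

definition Laplace_ok :: "real \<Rightarrow> (real \<Rightarrow> complex) \<Rightarrow> bool" where
  "Laplace_ok z f \<longleftrightarrow> f \<in> borel_measurable borel \<and> (\<forall>t\<le>0. f t = 0) \<and>
     integrable lborel (\<lambda>t. exp (- z * t) *\<^sub>R f t)"

definition Laplace :: "(real \<Rightarrow> complex) \<Rightarrow> real \<Rightarrow> complex" where
  "Laplace f z = (LINT t|lborel. exp (- z * t) *\<^sub>R f t)"

text \<open>Exponential weights are multiplicative, so Laplace transforms of convolutions reduce to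
  integrals of convolutions of integrable functions.\<close>

lemma exp_conv: "exp (- z * t) *\<^sub>R conv f g t
    = conv (\<lambda>t. exp (- z * t) *\<^sub>R f t) (\<lambda>t. exp (- z * t) *\<^sub>R g t) t"
proof -
  have "exp (- z * t) *\<^sub>R (f (t - s) * g s) = exp (- z * (t - s)) *\<^sub>R f (t - s) * exp (- z * s) *\<^sub>R g s" for s
  proof -
    have "exp (- z * t) = exp (- z * (t - s)) * exp (- z * s)"
      by (simp flip: exp_add add: algebra_simps)
    then show ?thesis by simp
  qed
  then show ?thesis
    unfolding conv_def integral_scaleR_right[symmetric] by (intro Bochner_Integration.integral_cong refl)
qed

lemma
  assumes f: "Laplace_ok z f" and g: "Laplace_ok z g"
  shows Laplace_ok_conv: "Laplace_ok z (conv f g)"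
    and Laplace_conv: "Laplace (conv f g) z = Laplace f z * Laplace g z"
    and AE_integrable_conv_Laplace: "AE t in lborel. integrable lborel (\<lambda>s. f (t - s) * g s)"
proof -
  have [measurable]: "f \<in> borel_measurable borel" "g \<in> borel_measurable borel"
    using f g by (auto simp: Laplace_ok_def)
  have f': "integrable lborel (\<lambda>t. exp (- z * t) *\<^sub>R f t)" and g': "integrable lborel (\<lambda>t. exp (- z * t) *\<^sub>R g t)"
    using f g by (auto simp: Laplace_ok_def)
  have *: "f (t - s) * g s = 0" if "t \<le> 0" for t s
    using that f g by (cases "s \<le> 0") (auto simp: Laplace_ok_def)
  have "conv f g t = 0" if "t \<le> 0" for t unfolding conv_def *[OF that] by simp
  then show "Laplace_ok z (conv f g)"
    using integrable_conv[OF f' g'] unfolding Laplace_ok_def exp_conv by auto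
  show "Laplace (conv f g) z = Laplace f z * Laplace g z"
    unfolding Laplace_def exp_conv by (rule integral_conv[OF f' g'])
  from AE_integrable_conv[OF f' g']
  show "AE t in lborel. integrable lborel (\<lambda>s. f (t - s) * g s)"
  proof eventually_elim
    fix t assume "integrable lborel (\<lambda>s. exp (- z * (t - s)) *\<^sub>R f (t - s) * exp (- z * s) *\<^sub>R g s)"
    moreover have "exp (- z * (t - s)) *\<^sub>R f (t - s) * exp (- z * s) *\<^sub>R g s
        = exp (- z * t) *\<^sub>R (f (t - s) * g s)" for s
    proof -
      have "exp (- z * t) = exp (- z * (t - s)) * exp (- z * s)"
        by (simp flip: exp_add add: algebra_simps)
      then show ?thesis by simp
    qed
    ultimately have "integrable lborel (\<lambda>s. exp (- z * t) *\<^sub>R (f (t - s) * g s))" by (simp only:)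
    from integrable_scaleR_right[OF this, of "exp (z * t)"]
    show "integrable lborel (\<lambda>s. f (t - s) * g s)"
      by (simp flip: exp_add add: mult_exp_exp)
  qed
qed

lemma Laplace_ok_add: "Laplace_ok z f \<Longrightarrow> Laplace_ok z g \<Longrightarrow> Laplace_ok z (\<lambda>t. f t + g t)"
  and Laplace_ok_diff: "Laplace_ok z f \<Longrightarrow> Laplace_ok z g \<Longrightarrow> Laplace_ok z (\<lambda>t. f t - g t)"
  and Laplace_ok_cmult: "Laplace_ok z f \<Longrightarrow> Laplace_ok z (\<lambda>t. a * f t)"
  by (auto simp: Laplace_ok_def scaleR_right_distrib scaleR_right_diff_distrib
      simp flip: mult_scaleR_right)

lemma Laplace_add: "Laplace_ok z f \<Longrightarrow> Laplace_ok z g \<Longrightarrow>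
    Laplace (\<lambda>t. f t + g t) z = Laplace f z + Laplace g z"
  and Laplace_diff: "Laplace_ok z f \<Longrightarrow> Laplace_ok z g \<Longrightarrow>
    Laplace (\<lambda>t. f t - g t) z = Laplace f z - Laplace g z"
  by (auto simp: Laplace_def Laplace_ok_def scaleR_right_distrib scaleR_right_diff_distrib)

lemma Laplace_cmult: "Laplace (\<lambda>t. a * f t) z = a * Laplace f z"
  by (simp add: Laplace_def flip: mult_scaleR_right)

lemma Laplace_eqD:
  assumes "\<And>z. z > w \<Longrightarrow> Laplace_ok z f" "\<And>z. z > w \<Longrightarrow> Laplace_ok z g"
    and "\<And>z. z > w \<Longrightarrow> Laplace f z = Laplace g z"
  shows "AE t in lborel. f t = g t"
proof -
  have "AE t in lborel. f t - g t = 0"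
  proof (rule Laplace_unique[where w=w])
    show "(\<lambda>t. f t - g t) \<in> borel_measurable borel" "\<And>t. t \<le> 0 \<Longrightarrow> f t - g t = 0"
      using assms(1,2)[of "w + 1"] by (auto simp: Laplace_ok_def)
    fix z assume z: "z > w"
    show "integrable lborel (\<lambda>t. exp (- z * t) *\<^sub>R (f t - g t))"
      using Laplace_ok_diff[OF assms(1,2)[OF z]] by (simp add: Laplace_ok_def)
    show "(LINT t|lborel. exp (- z * t) *\<^sub>R (f t - g t)) = 0"
      using Laplace_diff[OF assms(1,2)[OF z]] assms(3)[OF z] by (simp add: Laplace_def)
  qed
  then show ?thesis by simp
qed

section \<open>Gaussian integrals\<close>

text \<open>Both parts come from the standard normal density and its characteristic function by the
  substitution of sqrt (2 a) y.\<close>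

lemma
  fixes a x :: real
  assumes a: "0 < a"
  shows integrable_gaussian: "integrable lborel (\<lambda>y. exp (- a * y\<^sup>2))"
    and Fourier_gaussian: "(LINT y|lborel. of_real (exp (- a * y\<^sup>2)) * exp (- (\<i> * of_real (x * y))))
      = complex_of_real (sqrt (pi / a) * exp (- x\<^sup>2 / (4 * a)))"
proof -
  let ?c = "sqrt (2 * a)"
  have c: "?c > 0" "?c\<^sup>2 = 2 * a" using a by auto
  have dens: "std_normal_density (?c * y) = exp (- a * y\<^sup>2) / sqrt (2 * pi)" for y
    using a by (simp add: std_normal_density_def power_mult_distrib)
  have i: "integrable lborel (\<lambda>y. std_normal_density (0 + ?c * y))"
    by (rule lborel_integrable_real_affine) (use c in \<open>auto intro: integrable_normal_moment[of 1 0 0, simplified]\<close>)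
  then have "integrable lborel (\<lambda>y. exp (- a * y\<^sup>2) / sqrt (2 * pi))"
    unfolding add_0 dens .
  from integrable_mult_left[OF this, of "sqrt (2 * pi)"]
  show "integrable lborel (\<lambda>y. exp (- a * y\<^sup>2))" by simp
  have "(LINT y|lborel. std_normal_density y *\<^sub>R iexp (- x / ?c * y)) = complex_of_real (exp (- ((- x / ?c)\<^sup>2) / 2))"
    using fun_cong[OF char_std_normal_distribution, of "- x / ?c"] unfolding char_def
    by (subst (asm) integral_density) auto
  moreover have "(LINT y|lborel. std_normal_density y *\<^sub>R iexp (- x / ?c * y))
     = ?c *\<^sub>R (LINT y|lborel. std_normal_density (0 + ?c * y) *\<^sub>R iexp (- x / ?c * (0 + ?c * y)))"
    using c by (subst lborel_integral_real_affine[of "?c" _ 0]) auto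
  moreover have "std_normal_density (0 + ?c * y) *\<^sub>R iexp (- x / ?c * (0 + ?c * y))
     = of_real (1 / sqrt (2 * pi)) * (of_real (exp (- a * y\<^sup>2)) * exp (- (\<i> * of_real (x * y))))" for y
    unfolding add_0 dens using c a by (simp add: scaleR_conv_of_real)
  ultimately have "of_real (?c / sqrt (2 * pi)) * (LINT y|lborel. of_real (exp (- a * y\<^sup>2)) * exp (- (\<i> * of_real (x * y))))
    = complex_of_real (exp (- ((- x / ?c)\<^sup>2) / 2))" (is "_ * ?J = _") by (simp add: scaleR_conv_of_real)
  moreover have "- ((- x / ?c)\<^sup>2) / 2 = - x\<^sup>2 / (4 * a)" using c by (simp add: power_divide)
  moreover have "?c / sqrt (2 * pi) = inverse (sqrt (pi / a))"
    using a by (simp add: real_sqrt_mult real_sqrt_divide field_simps)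
  ultimately have *: "of_real (inverse (sqrt (pi / a))) * ?J = complex_of_real (exp (- x\<^sup>2 / (4 * a)))"
    by (simp only:)
  have "?J = of_real (sqrt (pi / a)) * (of_real (inverse (sqrt (pi / a))) * ?J)"
    using a by simp
  then show "?J = complex_of_real (sqrt (pi / a) * exp (- x\<^sup>2 / (4 * a)))"
    unfolding * by simp
qed

lemma integral_lborel_prod:
  fixes f :: "'a::euclidean_space \<Rightarrow> real \<Rightarrow> 'b::{real_normed_field,banach,second_countable_topology}"
  assumes f: "\<And>b. b \<in> Basis \<Longrightarrow> integrable lborel (f b)"
  shows "integrable lborel (\<lambda>x. \<Prod>b\<in>Basis. f b (x \<bullet> b))"
    and "(LINT x|lborel. (\<Prod>b\<in>Basis. f b (x \<bullet> b))) = (\<Prod>b\<in>Basis. (LINT y|lborel. f b y))"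
proof -
  interpret product_sigma_finite "\<lambda>b::'a. lborel :: real measure" ..
  have [measurable]: "\<And>b. b \<in> Basis \<Longrightarrow> f b \<in> borel_measurable borel" using f by auto
  have eq: "(\<Prod>b\<in>Basis. f b ((\<Sum>b\<in>Basis. y b *\<^sub>R b) \<bullet> b)) = (\<Prod>b\<in>Basis. f b (y b))" for y :: "'a \<Rightarrow> real"
    by (intro prod.cong refl) simp
  show "integrable lborel (\<lambda>x. \<Prod>b\<in>Basis. f b (x \<bullet> b))"
    unfolding lborel_eq[where 'a='a] by (subst integrable_distr_eq) (auto simp: eq intro!: product_integrable_prod f)
  show "(LINT x|lborel. (\<Prod>b\<in>Basis. f b (x \<bullet> b))) = (\<Prod>b\<in>Basis. (LINT y|lborel. f b y))"
    unfolding lborel_eq[where 'a='a] by (subst integral_distr) (auto simp: eq intro!: product_integral_prod f)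
qed

lemma
  fixes x :: "'a::euclidean_space"
  assumes a: "0 < a"
  shows integrable_gaussian_euclidean: "integrable lborel (\<lambda>y::'a. exp (- a * (norm y)\<^sup>2))"
    and Fourier_gaussian_euclidean:
      "(LINT y|lborel. of_real (exp (- a * (norm y)\<^sup>2)) * exp (- (\<i> * of_real (x \<bullet> y))))
      = complex_of_real ((pi / a) powr (real DIM('a) / 2) * exp (- (norm x)\<^sup>2 / (4 * a)))"
proof -
  have n2: "(norm y)\<^sup>2 = (\<Sum>b\<in>Basis. (y \<bullet> b)\<^sup>2)" for y :: 'a
    unfolding power2_norm_eq_inner by (subst euclidean_inner) (simp add: power2_eq_square)
  have e1: "exp (- a * (norm y)\<^sup>2) = (\<Prod>b\<in>Basis. exp (- a * (y \<bullet> b)\<^sup>2))" for y :: 'a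
    unfolding n2 sum_distrib_left by (simp add: exp_sum)
  have e2: "of_real (exp (- a * (norm y)\<^sup>2)) * exp (- (\<i> * of_real (x \<bullet> y)))
     = (\<Prod>b\<in>Basis. of_real (exp (- a * (y \<bullet> b)\<^sup>2)) * exp (- (\<i> * of_real ((x \<bullet> b) * (y \<bullet> b)))))" for y :: 'a
  proof -
    have "exp (- (\<i> * of_real (x \<bullet> y))) = (\<Prod>b\<in>Basis. exp (- (\<i> * complex_of_real ((x \<bullet> b) * (y \<bullet> b)))))"
      by (subst euclidean_inner) (simp add: sum_distrib_left flip: exp_sum sum_negf)
    then show ?thesis unfolding e1 of_real_prod prod.distrib by simp
  qed
  show "integrable lborel (\<lambda>y::'a. exp (- a * (norm y)\<^sup>2))"
    unfolding e1 by (rule integral_lborel_prod) (rule integrable_gaussian[OF a])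
  have "integrable lborel (\<lambda>y. of_real (exp (- a * y\<^sup>2)) * exp (- (\<i> * complex_of_real ((x \<bullet> b) * y))))" for b
    by (rule Bochner_Integration.integrable_bound[OF integrable_gaussian[OF a]]) (auto simp: norm_mult)
  then have "(LINT y|lborel. of_real (exp (- a * (norm y)\<^sup>2)) * exp (- (\<i> * of_real (x \<bullet> y))))
    = (\<Prod>b\<in>Basis. complex_of_real (sqrt (pi / a) * exp (- (x \<bullet> b)\<^sup>2 / (4 * a))))"
    unfolding e2 by (subst integral_lborel_prod(2)) (simp_all only: Fourier_gaussian[OF a])
  also have "\<dots> = complex_of_real ((pi / a) powr (real DIM('a) / 2) * exp (- (norm x)\<^sup>2 / (4 * a)))"
  proof -
    have "(\<Prod>b\<in>(Basis::'a set). sqrt (pi / a)) = (pi / a) powr (real DIM('a) / 2)"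
      using a by (simp add: powr_half_sqrt[symmetric] powr_realpow[symmetric] powr_powr del: powr_half_sqrt)
    moreover have "(\<Prod>b\<in>Basis. exp (- (x \<bullet> b)\<^sup>2 / (4 * a))) = exp (- (norm x)\<^sup>2 / (4 * a))"
      unfolding n2 by (simp add: sum_divide_distrib flip: exp_sum sum_negf)
    ultimately show ?thesis
      by (simp only: prod.distrib of_real_prod[symmetric])
  qed
  finally show "(LINT y|lborel. of_real (exp (- a * (norm y)\<^sup>2)) * exp (- (\<i> * of_real (x \<bullet> y))))
      = complex_of_real ((pi / a) powr (real DIM('a) / 2) * exp (- (norm x)\<^sup>2 / (4 * a)))" .
qed

lemma integrable_norm2_gaussian:
  assumes a: "0 < a"
  shows "integrable lborel (\<lambda>y::'a::euclidean_space. (norm y)\<^sup>2 * exp (- a * (norm y)\<^sup>2))"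
proof (rule Bochner_Integration.integrable_bound)
  show "integrable lborel (\<lambda>y::'a. 2 / a * exp (- (a / 2) * (norm y)\<^sup>2))"
    using integrable_gaussian_euclidean[of "a / 2"] a by (intro integrable_mult_right) auto
  \<comment> \<open>Half of the decay rate is spent on absorbing the factor
    \<open>q\<close>.\<close>
  have "q * exp (- a * q) \<le> 2 / a * exp (- (a / 2) * q)" for q :: real
  proof -
    have "a / 2 * q \<le> exp (a / 2 * q)" using exp_ge_add_one_self[of "a / 2 * q"] by linarith
    then have "a / 2 * q * exp (- a * q) \<le> exp (a / 2 * q) * exp (- a * q)" by (intro mult_right_mono) auto
    also have "\<dots> = exp (- (a / 2) * q)" by (simp flip: exp_add add: field_simps)
    finally show ?thesis using a by (simp add: field_simps)
  qed
  then show "AE y::'a in lborel. norm ((norm y)\<^sup>2 * exp (- a * (norm y)\<^sup>2))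
      \<le> norm (2 / a * exp (- (a / 2) * (norm y)\<^sup>2))"
    using a by (auto simp: abs_mult)
qed simp

text \<open>The left-hand side is \<open>- \<Delta>\<close> of the Gaussian on the right. Replacing \<open>|y|\<^sup>2\<close> by the difference
  quotient \<open>(1 - exp (- h |y|\<^sup>2)) / h\<close> makes it a difference of two Gaussians.\<close>

lemma Fourier_norm2_gaussian_le:
  fixes x :: "'a::euclidean_space"
  assumes a: "0 < a"
  shows "Re (LINT y|lborel. of_real ((norm y)\<^sup>2 * exp (- a * (norm y)\<^sup>2)) * exp (- (\<i> * of_real (x \<bullet> y))))
     \<le> real DIM('a) / (2 * a) * ((pi / a) powr (real DIM('a) / 2) * exp (- (norm x)\<^sup>2 / (4 * a)))"
proof -
  let ?d = "real DIM('a)"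
  define I where "I a = (pi / a) powr (?d / 2) * exp (- (norm x)\<^sup>2 / (4 * a))" for a
  define e :: "'a \<Rightarrow> complex" where "e y = exp (- (\<i> * of_real (x \<bullet> y)))" for y
  have [measurable]: "e \<in> borel_measurable borel" by (simp add: e_def[abs_def])
  have ne: "norm (e y) = 1" for y by (simp add: e_def)
  have int: "integrable lborel (\<lambda>y. of_real (exp (- b * (norm y)\<^sup>2)) * e y)" if "0 < b" for b
    by (rule Bochner_Integration.integrable_bound[OF integrable_gaussian_euclidean[OF that]]) (auto simp: norm_mult ne)
  define q where "q k y = (1 - exp (- (norm y)\<^sup>2 / Suc k)) * Suc k" for k :: nat and y :: 'a
  have q: "of_real (q k y * exp (- a * (norm y)\<^sup>2)) * e y
      = (of_real (exp (- a * (norm y)\<^sup>2)) * e y - of_real (exp (- (a + 1 / Suc k) * (norm y)\<^sup>2)) * e y) * of_real (Suc k)" for k y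
  proof -
    have "exp (- (a + 1 / Suc k) * (norm y)\<^sup>2) = exp (- (norm y)\<^sup>2 / Suc k) * exp (- a * (norm y)\<^sup>2)"
      by (simp flip: exp_add add: algebra_simps)
    then show ?thesis by (simp add: q_def algebra_simps)
  qed
  have qI: "(LINT y|lborel. of_real (q k y * exp (- a * (norm y)\<^sup>2)) * e y) = of_real ((I a - I (a + 1 / Suc k)) * Suc k)" for k
  proof -
    have p: "0 < a + 1 / Suc k" using a by (auto intro!: add_pos_pos)
    show ?thesis
      unfolding q using int[OF a] int[OF p] Fourier_gaussian_euclidean[OF a, of x] Fourier_gaussian_euclidean[OF p, of x]
      by (simp add: e_def I_def del: of_nat_Suc)
  qed
  have "(\<lambda>k. LINT y|lborel. of_real (q k y * exp (- a * (norm y)\<^sup>2)) * e y)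
     \<longlonglongrightarrow> (LINT y|lborel. of_real ((norm y)\<^sup>2 * exp (- a * (norm y)\<^sup>2)) * e y)"
  proof (rule integral_dominated_convergence[where w="\<lambda>y. (norm y)\<^sup>2 * exp (- a * (norm y)\<^sup>2)"])
    show "integrable lborel (\<lambda>y::'a. (norm y)\<^sup>2 * exp (- a * (norm y)\<^sup>2))" by (rule integrable_norm2_gaussian[OF a])
    have "\<bar>q k y\<bar> \<le> (norm y)\<^sup>2" for k y
    proof -
      have "1 - exp (- (norm y)\<^sup>2 / Suc k) \<le> (norm y)\<^sup>2 / Suc k"
        using exp_ge_add_one_self[of "- (norm y)\<^sup>2 / Suc k"] by linarith
      then have "q k y \<le> (norm y)\<^sup>2 / Suc k * Suc k" unfolding q_def by (intro mult_right_mono) auto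
      moreover have "q k y \<ge> 0" by (simp add: q_def)
      ultimately show ?thesis by simp
    qed
    then show "AE y in lborel. norm (of_real (q k y * exp (- a * (norm y)\<^sup>2)) * e y)
        \<le> (norm y)\<^sup>2 * exp (- a * (norm y)\<^sup>2)" for k
      by (auto simp: norm_mult ne abs_mult intro!: mult_right_mono simp del: of_real_mult)
    have "(\<lambda>k. q k y) \<longlonglongrightarrow> (norm y)\<^sup>2" for y
    proof -
      have "((\<lambda>h. - exp (- (norm y)\<^sup>2 * h)) has_real_derivative (norm y)\<^sup>2) (at 0)"
        by (auto intro!: derivative_eq_intros)
      then have "((\<lambda>h. (1 - exp (- (norm y)\<^sup>2 * h)) / h) \<longlongrightarrow> (norm y)\<^sup>2) (at 0)"
        by (simp add: DERIV_def)
      moreover have "filterlim (\<lambda>k. inverse (real (Suc k))) (at 0) sequentially"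
        using LIMSEQ_inverse_real_of_nat by (auto simp: filterlim_at simp del: of_nat_Suc)
      ultimately have "((\<lambda>k. (1 - exp (- (norm y)\<^sup>2 * inverse (real (Suc k)))) / inverse (real (Suc k))) \<longlongrightarrow> (norm y)\<^sup>2) sequentially"
        by (rule filterlim_compose)
      then show ?thesis by (simp add: q_def divide_inverse del: of_nat_Suc)
    qed
    then show "AE y in lborel. (\<lambda>k. of_real (q k y * exp (- a * (norm y)\<^sup>2)) * e y)
       \<longlonglongrightarrow> of_real ((norm y)\<^sup>2 * exp (- a * (norm y)\<^sup>2)) * e y"
      by (intro AE_I2 tendsto_intros)
  qed (auto simp: q_def)
  from tendsto_Re[OF this]
  have lim: "(\<lambda>k. (I a - I (a + 1 / Suc k)) * Suc k)
     \<longlonglongrightarrow> Re (LINT y|lborel. of_real ((norm y)\<^sup>2 * exp (- a * (norm y)\<^sup>2)) * e y)"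
    unfolding qI by (simp del: of_nat_Suc)
  \<comment> \<open>Passing from a to a + h increases the exponential in \<open>x\<close>, which may
    be dropped; the prefactor shrinks by (1 + h/a)^(-d/2), and this is at least 1 - d h / (2
    a).\<close>
  have "(I a - I (a + h)) / h \<le> ?d / (2 * a) * I a" if h: "h > 0" for h
  proof -
    have "1 + h / a > 0" using a h by (auto intro!: add_pos_pos)
    have "1 - ?d / 2 * (h / a) \<le> exp (- (?d / 2) * (h / a))"
      using exp_ge_add_one_self[of "- (?d / 2) * (h / a)"] by simp
    also have "\<dots> \<le> exp (- (?d / 2) * ln (1 + h / a))"
      using ln_add_one_self_le_self[of "h / a"] a h
      by (intro exp_le_cancel_iff[THEN iffD2] mult_left_mono_neg) auto
    also have "\<dots> = (1 + h / a) powr (- (?d / 2))" using \<open>1 + h / a > 0\<close> by (simp add: powr_def)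
    finally have 1: "1 - ?d / 2 * (h / a) \<le> (1 + h / a) powr (- (?d / 2))" .
    have I0: "I a \<ge> 0" using a by (simp add: I_def)
    have "pi / (a + h) = pi / a * inverse (1 + h / a)" using a h by (simp add: field_simps)
    then have "(pi / (a + h)) powr (?d / 2) = (pi / a) powr (?d / 2) * (1 + h / a) powr (- (?d / 2))"
      using \<open>1 + h / a > 0\<close> a by (simp only: powr_mult[of "pi / a" "inverse (1 + h / a)"] powr_minus inverse_powr)
    moreover have "exp (- (norm x)\<^sup>2 / (4 * (a + h))) \<ge> exp (- (norm x)\<^sup>2 / (4 * a))"
      using a h by (simp add: field_simps mult_left_mono)
    ultimately have "I (a + h) \<ge> (1 + h / a) powr (- (?d / 2)) * I a"
      unfolding I_def by (simp add: mult_ac mult_left_mono)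
    moreover have "(1 + h / a) powr (- (?d / 2)) * I a \<ge> (1 - ?d / 2 * (h / a)) * I a"
      using 1 I0 by (rule mult_right_mono)
    ultimately have "I a - I (a + h) \<le> ?d / (2 * a) * I a * h" by (simp add: field_simps)
    then show ?thesis using h by (simp add: divide_le_eq)
  qed
  from this[of "1 / Suc k" for k]
  have "(I a - I (a + 1 / Suc k)) * Suc k \<le> ?d / (2 * a) * I a" for k by (simp del: of_nat_Suc)
  then show ?thesis using LIMSEQ_le_const2[OF lim] unfolding I_def e_def by blast
qed

section \<open>Fourier transforms of integrable functions and of Bochner integrals\<close>

lemma L1_norm_finite_iff:
  "L1_norm f < \<infinity> \<longleftrightarrow> integrable lborel f" "L1_norm f < top \<longleftrightarrow> integrable lborel f"
  by (auto simp: L1_norm_def integrable_iff_bounded)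

lemma L1_norm_integrable: "integrable lborel f \<Longrightarrow> L1_norm f = ennreal (LINT x|lborel. \<bar>f x\<bar>)"
  unfolding L1_norm_def by (simp add: nn_integral_eq_integral)

text \<open>Complex bounded test functions cover the exponentials, the Gaussian weight and its
  Laplacian by the same estimates.\<close>

definition pairing :: "(real^'n \<Rightarrow> real) \<Rightarrow> (real^'n \<Rightarrow> complex) \<Rightarrow> complex" where
  "pairing f \<phi> = (LINT x|lborel. of_real (f x) * \<phi> x)"

lemma integrable_pairing:
  assumes f: "integrable lborel f" and [measurable]: "\<phi> \<in> borel_measurable borel"
    and b: "\<And>x. norm (\<phi> x) \<le> C"
  shows "integrable lborel (\<lambda>x. complex_of_real (f x) * \<phi> x)"
proof (rule Bochner_Integration.integrable_bound)
  show "integrable lborel (\<lambda>x. C * f x)" using f by simp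
  have [measurable]: "f \<in> borel_measurable borel" using f by auto
  show "(\<lambda>x. complex_of_real (f x) * \<phi> x) \<in> borel_measurable lborel" by measurable
  have "0 \<le> C" using b norm_ge_zero order_trans by blast
  then show "AE x in lborel. norm (complex_of_real (f x) * \<phi> x) \<le> norm (C * f x)"
    using b by (auto simp: norm_mult abs_mult mult.commute[of C] intro!: mult_left_mono)
qed

lemma norm_pairing_le:
  assumes [measurable]: "\<phi> \<in> borel_measurable borel" and b: "\<And>x. norm (\<phi> x) \<le> 1"
  shows "ennreal (norm (pairing f \<phi>)) \<le> L1_norm f"
proof (cases "L1_norm f < \<infinity>")
  case True
  then have f: "integrable lborel f" by (simp add: L1_norm_finite_iff)
  have [measurable]: "f \<in> borel_measurable borel" using f by auto
  have "ennreal (norm (pairing f \<phi>)) \<le> (\<integral>\<^sup>+x. norm (complex_of_real (f x) * \<phi> x) \<partial>lborel)"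
    unfolding pairing_def by (rule integral_norm_bound_ennreal[OF integrable_pairing[OF f _ b]]) simp
  also have "\<dots> \<le> (\<integral>\<^sup>+x. \<bar>f x\<bar> \<partial>lborel)"
    using b by (intro nn_integral_mono) (auto simp: norm_mult intro!: mult_left_le)
  also have "\<dots> = L1_norm f" by (simp add: L1_norm_def)
  finally show ?thesis .
qed (simp add: not_less top_unique)

lemma pairing_diff:
  assumes "integrable lborel f" "integrable lborel g" "\<phi> \<in> borel_measurable borel" "\<And>x. norm (\<phi> x) \<le> C"
  shows "pairing (\<lambda>x. f x - g x) \<phi> = pairing f \<phi> - pairing g \<phi>"
  using integrable_pairing[OF assms(1,3,4)] integrable_pairing[OF assms(2,3,4)]
  by (simp add: pairing_def left_diff_distrib)

text \<open>Integrability of \<open>f\<close> is not presupposed: a finite norm of the difference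
  implies it, and otherwise the right-hand side is infinite. This allows limits along curves whose
  values are only controlled near the limit.\<close>

lemma norm_pairing_diff_le:
  assumes g: "L1_norm g < \<infinity>" and \<phi>: "\<phi> \<in> borel_measurable borel" "\<And>x. norm (\<phi> x) \<le> 1"
  shows "ennreal (norm (pairing f \<phi> - pairing g \<phi>)) \<le> L1_norm (\<lambda>x. f x - g x)"
proof (cases "L1_norm (\<lambda>x. f x - g x) < \<infinity>")
  case True
  then have "integrable lborel (\<lambda>x. (f x - g x) + g x)"
    using g unfolding L1_norm_finite_iff by (rule Bochner_Integration.integrable_add)
  then have f: "integrable lborel f" by simp
  show ?thesis
    using norm_pairing_le[OF \<phi>, of "\<lambda>x. f x - g x"] pairing_diff[OF f _ \<phi>] g by (simp add: L1_norm_finite_iff)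
qed (simp add: not_less top_unique)

lemma tendsto_zero_if_ennreal_le:
  fixes f :: "'b \<Rightarrow> 'c::real_normed_vector"
  assumes "\<And>x. ennreal (norm (f x)) \<le> g x" "(g \<longlongrightarrow> 0) F"
  shows "(f \<longlongrightarrow> 0) F"
proof -
  have "((\<lambda>x. ennreal (norm (f x))) \<longlongrightarrow> 0) F"
    by (rule tendsto_sandwich[OF _ _ tendsto_const assms(2)]) (use assms(1) in auto)
  then have "((\<lambda>x. ennreal (norm (f x))) \<longlongrightarrow> ennreal 0) F" by simp
  then have "((\<lambda>x. norm (f x)) \<longlongrightarrow> 0) F"
    by (subst (asm) tendsto_ennreal_iff) auto
  then show ?thesis by (rule tendsto_norm_zero_cancel)
qed

text \<open>A bounded functional commutes with the Bochner integral, since both sides are limits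
  along the same simple functions. The Borel function \<open>g\<close> stands in for the pairing of
  \<open>w s\<close>, whose values are prescribed only up to a null set of times.\<close>

lemma Bochner_integral_into_pairing:
  fixes g :: "real \<Rightarrow> complex"
  assumes \<phi>: "\<phi> \<in> borel_measurable borel" "\<And>x. norm (\<phi> x) \<le> 1"
    and I[measurable]: "I \<in> sets borel" and fin: "emeasure lborel I < \<infinity>"
    and B: "has_Bochner_integral_into L1_norm I w h"
    and g[measurable]: "g \<in> borel_measurable borel"
    and wg: "AE s in lebesgue_on I. pairing (w s) \<phi> = g s"
  shows "integrable lborel (\<lambda>s. indicator I s *\<^sub>R g s)"
    and "(LINT s|lborel. indicator I s *\<^sub>R g s) = pairing h \<phi>"
proof -
  let ?M = "lebesgue_on I"
  have I': "I \<in> sets lebesgue" using I by (simp add: sets_completionI_sets)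
  interpret finite_measure ?M
    by (rule finite_measureI) (use fin I in \<open>simp add: emeasure_restrict_space\<close>)
  from B obtain \<sigma> where \<sigma>: "\<And>k::nat. simple_into L1_norm I (\<sigma> k)"
    and lim_w: "(\<lambda>k. \<integral>\<^sup>+s. L1_norm (\<lambda>x. w s x - \<sigma> k s x) \<partial>?M) \<longlonglongrightarrow> 0"
    and lim_h: "(\<lambda>k. L1_norm (\<lambda>x. h x - simple_integral_into I (\<sigma> k) x)) \<longlonglongrightarrow> 0"
    by (auto simp: has_Bochner_integral_into_def)
  have fin_im: "finite (\<sigma> k ` I)" for k using \<sigma>[of k] by (simp add: simple_into_def)
  have int\<sigma>: "integrable lborel f" if "f \<in> \<sigma> k ` I" for f k
    using \<sigma>[of k] that unfolding simple_into_def L1_norm_finite_iff by blast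
  have lev: "{s\<in>I. \<sigma> k s = f} \<in> sets ?M" if "f \<in> \<sigma> k ` I" for f k
    using \<sigma>[of k] that I' by (auto simp: simple_into_def sets_restrict_space_iff)
  have sum_eq: "pairing (\<sigma> k s) \<phi> = (\<Sum>f\<in>\<sigma> k ` I. indicator {s\<in>I. \<sigma> k s = f} s *\<^sub>R pairing f \<phi>)"
    if "s \<in> I" for k s
  proof -
    have "(\<Sum>f\<in>\<sigma> k ` I. indicator {s\<in>I. \<sigma> k s = f} s *\<^sub>R pairing f \<phi>)
      = (\<Sum>f\<in>\<sigma> k ` I. if f = \<sigma> k s then pairing f \<phi> else 0)"
      using that by (intro sum.cong) auto
    then show ?thesis using that fin_im by simp
  qed
  let ?S = "\<lambda>k s. \<Sum>f\<in>\<sigma> k ` I. indicator {s\<in>I. \<sigma> k s = f} s *\<^sub>R pairing f \<phi>"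
  have intS': "integrable ?M (?S k)" for k
    using lev by (intro Bochner_Integration.integrable_sum integrable_scaleR_left)
      (auto simp: integrable_indicator_iff less_top[symmetric])
  have intS: "integrable ?M (\<lambda>s. pairing (\<sigma> k s) \<phi>)" for k
    using intS'[of k] by (subst Bochner_Integration.integrable_cong[OF refl sum_eq]) auto
  have simpI: "(LINT s|?M. pairing (\<sigma> k s) \<phi>) = pairing (simple_integral_into I (\<sigma> k)) \<phi>" for k
  proof -
    have "(LINT s|?M. pairing (\<sigma> k s) \<phi>) = (LINT s|?M. ?S k s)"
      by (rule Bochner_Integration.integral_cong) (auto simp: sum_eq)
    also have "\<dots> = (\<Sum>f\<in>\<sigma> k ` I. measure ?M {s\<in>I. \<sigma> k s = f} *\<^sub>R pairing f \<phi>)"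
    proof (subst Bochner_Integration.integral_sum)
      show "integrable ?M (\<lambda>s. indicator {s\<in>I. \<sigma> k s = f} s *\<^sub>R pairing f \<phi>)" if "f \<in> \<sigma> k ` I" for f
        using lev[OF that] by (intro integrable_scaleR_left) (auto simp: integrable_indicator_iff less_top[symmetric])
      have "(LINT s|?M. indicator {s\<in>I. \<sigma> k s = f} s *\<^sub>R pairing f \<phi>) = measure ?M {s\<in>I. \<sigma> k s = f} *\<^sub>R pairing f \<phi>"
        if "f \<in> \<sigma> k ` I" for f
        using lev[OF that] by (subst integral_scaleR_left)
          (auto simp: integrable_indicator_iff less_top[symmetric] intro!: arg_cong[where f="measure ?M"])
      then show "(\<Sum>f\<in>\<sigma> k ` I. LINT s|?M. indicator {s\<in>I. \<sigma> k s = f} s *\<^sub>R pairing f \<phi>)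
        = (\<Sum>f\<in>\<sigma> k ` I. measure ?M {s\<in>I. \<sigma> k s = f} *\<^sub>R pairing f \<phi>)" by (rule sum.cong[OF refl])
    qed
    also have "\<dots> = (\<Sum>f\<in>\<sigma> k ` I. measure lebesgue {s\<in>I. \<sigma> k s = f} *\<^sub>R pairing f \<phi>)"
      using I' by (intro sum.cong refl arg_cong2[where f=scaleR] measure_restrict_space) auto
    also have "\<dots> = pairing (simple_integral_into I (\<sigma> k)) \<phi>"
    proof -
      have "integrable lborel (\<lambda>x. complex_of_real (measure lebesgue {s\<in>I. \<sigma> k s = f}) * (of_real (f x) * \<phi> x))"
        if "f \<in> \<sigma> k ` I" for f
        using integrable_pairing[OF int\<sigma>[OF that] \<phi>] by simp
      then have "(LINT x|lborel. (\<Sum>f\<in>\<sigma> k ` I. complex_of_real (measure lebesgue {s\<in>I. \<sigma> k s = f}) * (of_real (f x) * \<phi> x)))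
        = (\<Sum>f\<in>\<sigma> k ` I. complex_of_real (measure lebesgue {s\<in>I. \<sigma> k s = f}) * pairing f \<phi>)"
        by (subst Bochner_Integration.integral_sum) (auto simp: pairing_def)
      then show ?thesis
        by (simp add: pairing_def simple_integral_into_def sum_distrib_right scaleR_conv_of_real mult.assoc)
    qed
    finally show ?thesis .
  qed
  have int_simp: "L1_norm (simple_integral_into I (\<sigma> k)) < \<infinity>" for k
    unfolding L1_norm_finite_iff simple_integral_into_def
    using int\<sigma> by (intro Bochner_Integration.integrable_sum integrable_mult_right) auto
  have gM[measurable]: "g \<in> borel_measurable ?M"
    by (intro measurable_restrict_space1 measurable_completion) simp
  have bound: "(\<integral>\<^sup>+s. norm (g s - pairing (\<sigma> k s) \<phi>) \<partial>?M) \<le> (\<integral>\<^sup>+s. L1_norm (\<lambda>x. w s x - \<sigma> k s x) \<partial>?M)" for k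
  proof (rule nn_integral_mono_AE)
    have "AE s in ?M. s \<in> I" by (rule AE_I2) simp
    with wg show "AE s in ?M. ennreal (norm (g s - pairing (\<sigma> k s) \<phi>)) \<le> L1_norm (\<lambda>x. w s x - \<sigma> k s x)"
    proof eventually_elim
      case (elim s)
      then have "L1_norm (\<sigma> k s) < \<infinity>" using int\<sigma>[of "\<sigma> k s" k] by (simp add: L1_norm_finite_iff)
      from norm_pairing_diff_le[OF this \<phi>, of "w s"] elim show ?case by simp
    qed
  qed
  \<comment> \<open>One approximant at finite distance suffices for integrability of
    \<open>g\<close>, because the pairing of a simple function is integrable.\<close>
  obtain k0 where "(\<integral>\<^sup>+s. L1_norm (\<lambda>x. w s x - \<sigma> k0 s x) \<partial>?M) < 1"
    using order_tendstoD(2)[OF lim_w, of 1] by (auto simp: eventually_sequentially)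
  with bound[of k0] have "(\<integral>\<^sup>+s. norm (g s - pairing (\<sigma> k0 s) \<phi>) \<partial>?M) < \<infinity>"
    by (auto intro: le_less_trans order_less_trans[of _ 1] simp: ennreal_one_less_top)
  then have "integrable ?M (\<lambda>s. g s - pairing (\<sigma> k0 s) \<phi>)"
    using intS[of k0] by (auto simp: integrable_iff_bounded)
  from Bochner_Integration.integrable_add[OF this intS[of k0]]
  have gint: "integrable ?M g" by simp
  have l1: "(\<lambda>k. (LINT s|?M. g s) - pairing (simple_integral_into I (\<sigma> k)) \<phi>) \<longlonglongrightarrow> 0"
  proof (rule tendsto_zero_if_ennreal_le[OF _ lim_w])
    fix k
    have "(LINT s|?M. g s) - pairing (simple_integral_into I (\<sigma> k)) \<phi> = (LINT s|?M. g s - pairing (\<sigma> k s) \<phi>)"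
      using gint intS[of k] by (simp add: simpI)
    also have "ennreal (norm \<dots>) \<le> (\<integral>\<^sup>+s. norm (g s - pairing (\<sigma> k s) \<phi>) \<partial>?M)"
      using gint intS[of k] by (intro integral_norm_bound_ennreal) auto
    finally show "ennreal (norm ((LINT s|?M. g s) - pairing (simple_integral_into I (\<sigma> k)) \<phi>))
       \<le> (\<integral>\<^sup>+s. L1_norm (\<lambda>x. w s x - \<sigma> k s x) \<partial>?M)" using bound[of k] by (rule order_trans)
  qed
  have l2: "(\<lambda>k. pairing h \<phi> - pairing (simple_integral_into I (\<sigma> k)) \<phi>) \<longlonglongrightarrow> 0"
    by (rule tendsto_zero_if_ennreal_le[OF _ lim_h]) (rule norm_pairing_diff_le[OF int_simp \<phi>])
  from tendsto_diff[OF l1 l2] have eq: "(LINT s|?M. g s) = pairing h \<phi>"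
    by (simp add: LIMSEQ_const_iff)
  \<comment> \<open>The Bochner integral lives on \<open>lebesgue\<close>; as the integrand is
    Borel, its integral may be taken against \<open>lborel\<close>.\<close>
  have mI: "(\<lambda>s. indicator I s *\<^sub>R g s) \<in> borel_measurable lborel" by measurable
  have "integrable lebesgue (\<lambda>s. indicator I s *\<^sub>R g s)"
    using gint I' by (simp add: integrable_restrict_space)
  then show "integrable lborel (\<lambda>s. indicator I s *\<^sub>R g s)"
    using integrable_completion[OF mI] by simp
  have "(LINT s|?M. g s) = (LINT s|lebesgue. indicator I s *\<^sub>R g s)"
    using I' by (intro integral_restrict_space) auto
  then show "(LINT s|lborel. indicator I s *\<^sub>R g s) = pairing h \<phi>"
    using integral_completion[OF mI] eq by simp
qed

section \<open>Fourier transforms of functions and of convolutions with measures\<close>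

definition expi :: "real^'n \<Rightarrow> real^'n \<Rightarrow> complex" where
  "expi \<eta> x = exp (- (\<i> * of_real (x \<bullet> \<eta>)))"

lemma norm_expi [simp]: "norm (expi \<eta> x) = 1"
  by (simp add: expi_def)

lemma borel_measurable_expi [measurable (raw)]:
  assumes [measurable]: "f \<in> borel_measurable M" "g \<in> borel_measurable M"
  shows "(\<lambda>z. expi (f z) (g z)) \<in> borel_measurable M"
  unfolding expi_def by measurable

abbreviation fourier :: "(real^'n \<Rightarrow> real) \<Rightarrow> real^'n \<Rightarrow> complex" where
  "fourier f \<eta> \<equiv> pairing f (expi \<eta>)"

lemma lborel_translation:
  fixes f :: "'a::euclidean_space \<Rightarrow> 'b::{banach, second_countable_topology}"
  assumes f: "integrable lborel f"
  shows "integrable lborel (\<lambda>x. f (x - y))" "(LINT x|lborel. f (x - y)) = (LINT x|lborel. f x)"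
proof -
  have [measurable]: "f \<in> borel_measurable borel" using f by auto
  have e: "integrable (distr lborel borel ((+) (- y))) f" using f by (simp add: lborel_distr_plus)
  then show "integrable lborel (\<lambda>x. f (x - y))"
    by (subst (asm) integrable_distr_eq) auto
  have "(LINT x|lborel. f x) = (LINT x|distr lborel borel ((+) (- y)). f x)" by (simp add: lborel_distr_plus)
  also have "\<dots> = (LINT x|lborel. f (x - y))" by (subst integral_distr) auto
  finally show "(LINT x|lborel. f (x - y)) = (LINT x|lborel. f x)" by simp
qed

lemma fourier_measure_conv:
  assumes \<mu>: "finite_measure \<mu>" "sets \<mu> = sets borel" and g: "integrable lborel g"
  shows "fourier (measure_conv \<mu> g) \<eta> = Fourier_measure \<mu> \<eta> * fourier g \<eta>"
proof -
  interpret \<mu>: finite_measure \<mu> by fact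
  interpret P: pair_sigma_finite \<mu> lborel ..
  note [measurable_cong] = \<mu>(2)
  have [measurable]: "g \<in> borel_measurable borel" using g by auto
  have *: "integrable (\<mu> \<Otimes>\<^sub>M lborel) (\<lambda>(y, x). complex_of_real (g (x - y)) * expi \<eta> x)"
  proof (rule P.Fubini_integrable)
    have "(LINT x|lborel. \<bar>g (x - y)\<bar>) = (LINT x|lborel. \<bar>g x\<bar>)" for y
      using lborel_translation(2)[of "\<lambda>x. \<bar>g x\<bar>" y] g by simp
    then show "integrable \<mu> (\<lambda>y. LINT x|lborel. norm (case (y, x) of (y, x) \<Rightarrow> complex_of_real (g (x - y)) * expi \<eta> x))"
      by (simp add: norm_mult)
    show "AE y in \<mu>. integrable lborel (\<lambda>x. case (y, x) of (y, x) \<Rightarrow> complex_of_real (g (x - y)) * expi \<eta> x)"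
      using integrable_pairing[of _ "expi \<eta>" 1] lborel_translation(1)[OF g] by simp
  qed measurable
  have "fourier (measure_conv \<mu> g) \<eta> = (LINT x|lborel. LINT y|\<mu>. complex_of_real (g (x - y)) * expi \<eta> x)"
    by (simp add: pairing_def measure_conv_def)
  also have "\<dots> = (LINT y|\<mu>. LINT x|lborel. complex_of_real (g (x - y)) * expi \<eta> x)"
    using P.Fubini_integral[OF *] by simp
  also have "\<dots> = (LINT y|\<mu>. expi \<eta> y * fourier g \<eta>)"
  proof (rule Bochner_Integration.integral_cong[OF refl])
    fix y
    have split: "expi \<eta> x = expi \<eta> y * expi \<eta> (x - y)" for x
      unfolding expi_def exp_add[symmetric] by (simp add: inner_diff_left right_diff_distrib)
    have "(LINT x|lborel. complex_of_real (g (x - y)) * expi \<eta> x)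
      = (LINT x|lborel. expi \<eta> y * (complex_of_real (g (x - y)) * expi \<eta> (x - y)))"
      by (intro Bochner_Integration.integral_cong refl) (subst split, simp only: mult_ac)
    also have "\<dots> = expi \<eta> y * (LINT x|lborel. complex_of_real (g (x - y)) * expi \<eta> (x - y))"
      by (rule integral_mult_right_zero)
    also have "(LINT x|lborel. complex_of_real (g (x - y)) * expi \<eta> (x - y)) = fourier g \<eta>"
      using lborel_translation(2)[OF integrable_pairing[OF g, of "expi \<eta>" 1], of y] by (simp add: pairing_def)
    finally show "(LINT x|lborel. complex_of_real (g (x - y)) * expi \<eta> x) = expi \<eta> y * fourier g \<eta>" .
  qed
  also have "\<dots> = Fourier_measure \<mu> \<eta> * fourier g \<eta>"
    by (simp add: Fourier_measure_def expi_def)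
  finally show ?thesis .
qed

section \<open>Continuous curves in L^1 and the power nonlinearity\<close>

text \<open>The continuity clause of \<open>mild_solution\<close>, isolated so that it can be used
  for the solution and for its nonlinearity alike.\<close>

definition L1_curve :: "real \<Rightarrow> (real \<Rightarrow> real^'n \<Rightarrow> real) \<Rightarrow> bool" where
  "L1_curve T w \<longleftrightarrow> (\<forall>t\<in>{0..T}. L1_norm (w t) < \<infinity> \<and>
     ((\<lambda>s. L1_norm (\<lambda>x. w s x - w t x)) \<longlongrightarrow> 0) (at t within {0..T}))"

lemma L1_curve_integrable: "L1_curve T w \<Longrightarrow> t \<in> {0..T} \<Longrightarrow> integrable lborel (w t)"
  by (simp add: L1_curve_def L1_norm_finite_iff)

lemma continuous_on_pairing_L1_curve:
  assumes w: "L1_curve T w" and \<phi>: "\<phi> \<in> borel_measurable borel" "\<And>x. norm (\<phi> x) \<le> 1"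
  shows "continuous_on {0..T} (\<lambda>t. pairing (w t) \<phi>)"
  unfolding continuous_on_def
proof
  fix t assume t: "t \<in> {0..T}"
  have "((\<lambda>s. pairing (w s) \<phi> - pairing (w t) \<phi>) \<longlongrightarrow> 0) (at t within {0..T})"
    by (rule tendsto_zero_if_ennreal_le[where g="\<lambda>s. L1_norm (\<lambda>x. w s x - w t x)"])
      (use w t in \<open>auto simp: L1_curve_def intro!: norm_pairing_diff_le \<phi>\<close>)
  then show "((\<lambda>s. pairing (w s) \<phi>) \<longlongrightarrow> pairing (w t) \<phi>) (at t within {0..T})"
    by (rule Lim_null[THEN iffD2])
qed

lemma L1_curve_bounded:
  assumes w: "L1_curve T w"
  obtains C where "\<And>t. t \<in> {0..T} \<Longrightarrow> (LINT x|lborel. \<bar>w t x\<bar>) \<le> C"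
proof -
  have "continuous_on {0..T} (\<lambda>t. LINT x|lborel. \<bar>w t x\<bar>)"
    unfolding continuous_on_def
  proof
    fix t assume t: "t \<in> {0..T}"
    \<comment> \<open>The reverse triangle inequality needs \<open>w s\<close> integrable, which is
      known on [0,T] only; the conditional makes the norm bound true for all
      \<open>s\<close>.\<close>
    have "((\<lambda>s. if s \<in> {0..T} then (LINT x|lborel. \<bar>w s x\<bar>) - (LINT x|lborel. \<bar>w t x\<bar>) else 0) \<longlongrightarrow> 0) (at t within {0..T})"
    proof (rule tendsto_zero_if_ennreal_le[where g="\<lambda>s. L1_norm (\<lambda>x. w s x - w t x)"])
      fix s
      show "ennreal (norm (if s \<in> {0..T} then (LINT x|lborel. \<bar>w s x\<bar>) - (LINT x|lborel. \<bar>w t x\<bar>) else 0))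
        \<le> L1_norm (\<lambda>x. w s x - w t x)"
      proof (cases "s \<in> {0..T}")
        case True
        note i = L1_curve_integrable[OF w True] L1_curve_integrable[OF w t]
        have "\<bar>(LINT x|lborel. \<bar>w s x\<bar>) - (LINT x|lborel. \<bar>w t x\<bar>)\<bar> = \<bar>LINT x|lborel. \<bar>w s x\<bar> - \<bar>w t x\<bar>\<bar>"
          using i by simp
        also have "\<dots> \<le> (LINT x|lborel. \<bar>\<bar>w s x\<bar> - \<bar>w t x\<bar>\<bar>)" by simp
        also have "\<dots> \<le> (LINT x|lborel. \<bar>w s x - w t x\<bar>)" using i by (intro integral_mono) auto
        finally show ?thesis using i True by (simp add: L1_norm_integrable ennreal_leI)
      next
        case False
        show ?thesis by (subst if_not_P[OF False]) simp
      qed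
    qed (use w t in \<open>auto simp: L1_curve_def\<close>)
    then have "((\<lambda>s. (LINT x|lborel. \<bar>w s x\<bar>) - (LINT x|lborel. \<bar>w t x\<bar>)) \<longlongrightarrow> 0) (at t within {0..T})"
      by (rule Lim_transform_eventually) (auto simp: eventually_at_filter)
    then show "((\<lambda>s. LINT x|lborel. \<bar>w s x\<bar>) \<longlongrightarrow> (LINT x|lborel. \<bar>w t x\<bar>)) (at t within {0..T})"
      by (rule Lim_null[THEN iffD2])
  qed
  then have "bounded ((\<lambda>t. LINT x|lborel. \<bar>w t x\<bar>) ` {0..T})"
    by (intro compact_imp_bounded compact_continuous_image) auto
  then obtain C where "\<forall>y\<in>(\<lambda>t. LINT x|lborel. \<bar>w t x\<bar>) ` {0..T}. norm y \<le> C"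
    by (auto simp: bounded_iff)
  then show ?thesis by (intro that[of C]) force
qed

lemma norm_fourier_le: "integrable lborel f \<Longrightarrow> norm (fourier f \<eta>) \<le> (LINT x|lborel. \<bar>f x\<bar>)"
  using norm_pairing_le[of "expi \<eta>" f] by (simp add: L1_norm_integrable)

lemma isCont_fourier:
  assumes f: "integrable lborel f"
  shows "isCont (fourier f) \<eta>"
  unfolding continuous_at_sequentially pairing_def comp_def
proof (intro allI impI)
  fix X assume X: "X \<longlonglongrightarrow> \<eta>"
  have [measurable]: "f \<in> borel_measurable borel" using f by auto
  show "(\<lambda>k. LINT x|lborel. complex_of_real (f x) * expi (X k) x) \<longlonglongrightarrow> (LINT x|lborel. complex_of_real (f x) * expi \<eta> x)"
  proof (rule integral_dominated_convergence[where w="\<lambda>x. \<bar>f x\<bar>"])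
    show "AE x in lborel. (\<lambda>k. complex_of_real (f x) * expi (X k) x) \<longlonglongrightarrow> complex_of_real (f x) * expi \<eta> x"
      unfolding expi_def by (intro AE_I2 tendsto_intros X)
  qed (use f in \<open>auto simp: norm_mult\<close>)
qed

text \<open>The limit in \<open>L1_curve\<close> is punctured; since the norm vanishes at s = t,
  sequences that hit \<open>t\<close> are admissible too.\<close>

lemma L1_curve_sequentially:
  assumes w: "L1_curve T w" and t: "t \<in> {0..T}" and X: "\<And>k. X k \<in> {0..T}" "X \<longlonglongrightarrow> t"
  shows "(\<lambda>k. L1_norm (\<lambda>x. w (X k) x - w t x)) \<longlonglongrightarrow> 0"
proof -
  have 0: "L1_norm (\<lambda>x. w t x - w t x) = 0" by (simp add: L1_norm_def)
  have "continuous (at t within {0..T}) (\<lambda>s. L1_norm (\<lambda>x. w s x - w t x))"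
    using w t unfolding continuous_within 0 by (simp add: L1_curve_def)
  then show ?thesis
    unfolding continuous_within_sequentially 0 using X by (auto simp: comp_def)
qed

text \<open>Unimodular exponentials make convergence in time uniform in the frequency, hence the
  continuity is joint. It supplies the joint measurability for Fubini in
  \<open>integral_Volterra_fourier\<close>.\<close>

lemma continuous_on_fourier_L1_curve:
  fixes w :: "real \<Rightarrow> real^'n \<Rightarrow> real"
  assumes w: "L1_curve T w"
  shows "continuous_on ({0..T} \<times> UNIV) (\<lambda>(t, \<eta>). fourier (w t) \<eta>)"
  unfolding continuous_on_sequentially
proof safe
  fix X and t \<eta>
  assume X: "\<forall>k. X k \<in> {0..T} \<times> (UNIV :: (real^'n) set)" "X \<longlonglongrightarrow> (t, \<eta>)" and t: "t \<in> {0..T}"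
  have lim: "(\<lambda>k. fst (X k)) \<longlonglongrightarrow> t" "(\<lambda>k. snd (X k)) \<longlonglongrightarrow> \<eta>"
    using tendsto_fst[OF X(2)] tendsto_snd[OF X(2)] by simp_all
  have inT: "fst (X k) \<in> {0..T}" for k using X(1)[rule_format, of k] by (auto simp: mem_Times_iff)
  have "(\<lambda>k. L1_norm (\<lambda>x. w (fst (X k)) x - w t x)) \<longlonglongrightarrow> 0"
    by (rule L1_curve_sequentially[OF w t inT lim(1)])
  then have "(\<lambda>k. fourier (w (fst (X k))) (snd (X k)) - fourier (w t) (snd (X k))) \<longlonglongrightarrow> 0"
    by (rule tendsto_zero_if_ennreal_le[rotated])
       (use w t in \<open>auto simp: L1_curve_def intro!: norm_pairing_diff_le\<close>)
  moreover have "(\<lambda>k. fourier (w t) (snd (X k))) \<longlonglongrightarrow> fourier (w t) \<eta>"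
    using isCont_fourier[OF L1_curve_integrable[OF w t], of \<eta>] lim(2) by (rule isCont_tendsto_compose)
  ultimately have "(\<lambda>k. fourier (w (fst (X k))) (snd (X k)) - fourier (w t) (snd (X k)) + fourier (w t) (snd (X k)))
     \<longlonglongrightarrow> 0 + fourier (w t) \<eta>"
    by (rule tendsto_add)
  then show "((\<lambda>(t, \<eta>). fourier (w t) \<eta>) \<circ> X) \<longlonglongrightarrow> fourier (w t) \<eta>"
    by (simp add: case_prod_beta' comp_def)
qed

lemma Linf_norm_le_AE:
  assumes "Linf_norm f \<le> ennreal M" "0 \<le> M"
  shows "AE x in lborel. \<bar>f x\<bar> \<le> M"
proof -
  have m: "f \<in> borel_measurable lborel"
    using assms by (auto simp: Linf_norm_def top_unique split: if_splits)
  then have "esssup lborel (\<lambda>x. ennreal \<bar>f x\<bar>) \<le> ennreal M" using assms by (simp add: Linf_norm_def)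
  moreover have "AE x in lborel. ennreal \<bar>f x\<bar> \<le> esssup lborel (\<lambda>x. ennreal \<bar>f x\<bar>)"
    using m by (intro esssup_AE)
  ultimately have "AE x in lborel. ennreal \<bar>f x\<bar> \<le> ennreal M"
    by (auto elim!: eventually_mono)
  then show ?thesis using assms by simp
qed

text \<open>The essential bound holds at almost all times, and these good times accumulate at
  \<open>t\<close>. The excess of |w t| over M has integral at most the L^1 distance from
  \<open>w t\<close> to any good \<open>w s\<close>, so it is 0.\<close>

lemma L1_curve_AE_bound:
  assumes w: "L1_curve T w" and T: "0 < T"
    and M: "AE t in lebesgue_on {0<..<T}. Linf_norm (w t) \<le> ennreal M" "0 \<le> M"
    and t: "t \<in> {0..T}"
  shows "AE x in lborel. \<bar>w t x\<bar> \<le> M"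
proof -
  have good: "\<exists>s\<in>{0<..<T}. \<bar>s - t\<bar> < \<delta> \<and> Linf_norm (w s) \<le> ennreal M" if \<delta>: "\<delta> > 0" for \<delta>
  proof (rule ccontr)
    assume no: "\<not> ?thesis"
    define J where "J = {max 0 (t - \<delta>) <..< min T (t + \<delta>)}"
    have "AE s in lebesgue. s \<in> {0<..<T} \<longrightarrow> Linf_norm (w s) \<le> ennreal M"
      using M(1) by (subst (asm) AE_restrict_space_iff) auto
    then have "AE s in lebesgue. s \<notin> J"
      by eventually_elim (use no in \<open>auto simp: J_def abs_less_iff\<close>)
    then have "J \<in> null_sets lebesgue"
      by (subst (asm) AE_iff_null_sets[symmetric]) (auto simp: J_def)
    then have "emeasure lborel J = 0" by (simp add: J_def null_sets_def)
    moreover have "emeasure lborel J = ennreal (min T (t + \<delta>) - max 0 (t - \<delta>))"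
      unfolding J_def by (rule emeasure_lborel_Ioo) (use t T \<delta> in auto)
    moreover have "min T (t + \<delta>) - max 0 (t - \<delta>) > 0" using t T \<delta> by auto
    ultimately show False by (metis ennreal_eq_0_iff not_less)
  qed
  have [measurable]: "w t \<in> borel_measurable borel" using L1_curve_integrable[OF w t] by auto
  \<comment> \<open>\<open>ennreal\<close> truncates at 0, so the left-hand side is the integral of
    the positive part of the excess.\<close>
  have le: "(\<integral>\<^sup>+x. ennreal (\<bar>w t x\<bar> - M) \<partial>lborel) \<le> L1_norm (\<lambda>x. w s x - w t x)"
    if s: "s \<in> {0<..<T}" "Linf_norm (w s) \<le> ennreal M" for s
  proof -
    have [measurable]: "w s \<in> borel_measurable borel" using L1_curve_integrable[OF w, of s] s by auto
    have "(\<integral>\<^sup>+x. ennreal (\<bar>w t x\<bar> - M) \<partial>lborel) \<le> (\<integral>\<^sup>+x. ennreal \<bar>w s x - w t x\<bar> \<partial>lborel)"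
      using Linf_norm_le_AE[OF s(2) M(2)] by (intro nn_integral_mono_AE) (auto elim!: eventually_mono intro!: ennreal_leI)
    then show ?thesis by (simp add: L1_norm_def)
  qed
  have "(\<integral>\<^sup>+x. ennreal (\<bar>w t x\<bar> - M) \<partial>lborel) \<le> 0"
  \<comment> \<open>The limit used below is punctured: a good time \<open>t\<close> is compared with
    itself, and otherwise every good \<open>s\<close> differs from \<open>t\<close>.\<close>
  proof (cases "t \<in> {0<..<T} \<and> Linf_norm (w t) \<le> ennreal M")
    case True
    then show ?thesis using le[of t] by (simp add: L1_norm_def)
  next
    case False
    have lim: "((\<lambda>s. L1_norm (\<lambda>x. w s x - w t x)) \<longlongrightarrow> 0) (at t within {0..T})"
      using w t by (simp add: L1_curve_def)
    show ?thesis
    proof (rule ccontr)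
      assume "\<not> ?thesis"
      then have "eventually (\<lambda>s. L1_norm (\<lambda>x. w s x - w t x) < (\<integral>\<^sup>+x. ennreal (\<bar>w t x\<bar> - M) \<partial>lborel)) (at t within {0..T})"
        by (intro order_tendstoD(2)[OF lim]) (simp add: not_le zero_less_iff_neq_zero)
      then obtain \<delta> where "\<delta> > 0" and \<delta>: "\<And>s. s \<in> {0..T} \<Longrightarrow> s \<noteq> t \<Longrightarrow> dist s t < \<delta> \<Longrightarrow>
          L1_norm (\<lambda>x. w s x - w t x) < (\<integral>\<^sup>+x. ennreal (\<bar>w t x\<bar> - M) \<partial>lborel)"
        unfolding eventually_at by auto
      obtain s where s: "s \<in> {0<..<T}" "\<bar>s - t\<bar> < \<delta>" "Linf_norm (w s) \<le> ennreal M"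
        using good[OF \<open>\<delta> > 0\<close>] by auto
      moreover have "s \<noteq> t" using s False by auto
      ultimately show False using \<delta>[of s] leD[OF le[of s]] by (auto simp: dist_real_def)
    qed
  qed
  then have "AE x in lborel. ennreal (\<bar>w t x\<bar> - M) = 0"
    by (subst (asm) le_zero_eq, subst (asm) nn_integral_0_iff_AE) auto
  then show ?thesis by eventually_elim (auto simp: ennreal_eq_0_iff)
qed

lemma powr_pos_part_Lipschitz:
  fixes a b M p :: real
  assumes p: "1 < p" and ab: "\<bar>a\<bar> \<le> M" "\<bar>b\<bar> \<le> M"
  shows "\<bar>max 0 a powr p - max 0 b powr p\<bar> \<le> p * M powr (p - 1) * \<bar>a - b\<bar>"
proof -
  have *: "\<bar>y powr p - x powr p\<bar> \<le> p * M powr (p - 1) * \<bar>y - x\<bar>" if xy: "0 \<le> x" "x < y" "y \<le> M" for x y :: real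
  proof -
    have "continuous_on {x..y} (\<lambda>x. x powr p)"
      using xy p by (intro continuous_on_powr' continuous_intros) auto
    moreover have "((\<lambda>x. x powr p) has_derivative (\<lambda>h. p * z powr (p - 1) * h)) (at z)" if "x < z" "z < y" for z
      using xy that by (auto intro!: derivative_eq_intros simp flip: has_field_derivative_def)
    ultimately obtain z where z: "x < z" "z < y" "y powr p - x powr p = p * z powr (p - 1) * (y - x)"
      using mvt[OF xy(2), of "\<lambda>x. x powr p" "\<lambda>z h. p * z powr (p - 1) * h"] by blast
    moreover have "z powr (p - 1) \<le> M powr (p - 1)" using z xy p by (intro powr_mono2) auto
    ultimately show ?thesis using p xy by (auto simp: abs_mult intro!: mult_right_mono mult_left_mono)
  qed
  show ?thesis
  proof (cases "max 0 a" "max 0 b" rule: linorder_cases)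
    case less
    then have "\<bar>max 0 b powr p - max 0 a powr p\<bar> \<le> p * M powr (p - 1) * \<bar>max 0 b - max 0 a\<bar>"
      using ab by (intro *) auto
    also have "\<dots> \<le> p * M powr (p - 1) * \<bar>a - b\<bar>" using p by (intro mult_left_mono) auto
    finally show ?thesis by (simp add: abs_minus_commute)
  next
    case greater
    then have "\<bar>max 0 a powr p - max 0 b powr p\<bar> \<le> p * M powr (p - 1) * \<bar>max 0 a - max 0 b\<bar>"
      using ab by (intro *) auto
    also have "\<dots> \<le> p * M powr (p - 1) * \<bar>a - b\<bar>" using p by (intro mult_left_mono) auto
    finally show ?thesis .
  qed (use p in auto)
qed

text \<open>On the range bounded by M the nonlinearity is Lipschitz, so L^1 distances grow by a
  constant factor only; comparison with 0 gives integrability.\<close>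

lemma L1_curve_powr_pos_part:
  assumes w: "L1_curve T w" and p: "1 < p"
    and M: "\<And>t. t \<in> {0..T} \<Longrightarrow> AE x in lborel. \<bar>w t x\<bar> \<le> M"
  shows "L1_curve T (\<lambda>t x. max 0 (w t x) powr p)"
proof -
  let ?C = "p * M powr (p - 1)"
  have [measurable]: "w t \<in> borel_measurable borel" if "t \<in> {0..T}" for t
    using L1_curve_integrable[OF w that] by auto
  have lip: "L1_norm (\<lambda>x. max 0 (w s x) powr p - max 0 (w t x) powr p) \<le> ennreal ?C * L1_norm (\<lambda>x. w s x - w t x)"
    if s: "s \<in> {0..T}" and t: "t \<in> {0..T}" for s t
  proof -
    have [measurable]: "w t \<in> borel_measurable borel" "w s \<in> borel_measurable borel" using s t by auto
    have "(\<integral>\<^sup>+x. ennreal \<bar>max 0 (w s x) powr p - max 0 (w t x) powr p\<bar> \<partial>lborel)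
      \<le> (\<integral>\<^sup>+x. ennreal (?C * \<bar>w s x - w t x\<bar>) \<partial>lborel)"
    proof (rule nn_integral_mono_AE)
      show "AE x in lborel. ennreal \<bar>max 0 (w s x) powr p - max 0 (w t x) powr p\<bar> \<le> ennreal (?C * \<bar>w s x - w t x\<bar>)"
        using M[OF s] M[OF t] by eventually_elim (intro ennreal_leI powr_pos_part_Lipschitz p)
    qed
    also have "\<dots> = ennreal ?C * (\<integral>\<^sup>+x. ennreal \<bar>w s x - w t x\<bar> \<partial>lborel)"
      using p by (subst nn_integral_cmult[symmetric]) (auto simp: ennreal_mult)
    finally show ?thesis by (simp add: L1_norm_def)
  qed
  show ?thesis
    unfolding L1_curve_def
  proof (intro ballI conjI)
    fix t assume t: "t \<in> {0..T}"
    then have [measurable]: "w t \<in> borel_measurable borel" by simp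
    have "integrable lborel (\<lambda>x. max 0 (w t x) powr p)"
    proof (rule Bochner_Integration.integrable_bound)
      show "integrable lborel (\<lambda>x. ?C * w t x)" using L1_curve_integrable[OF w t] by simp
      show "AE x in lborel. norm (max 0 (w t x) powr p) \<le> norm (?C * w t x)"
        using M[OF t]
      proof eventually_elim
        fix x assume "\<bar>w t x\<bar> \<le> M"
        from powr_pos_part_Lipschitz[OF p this, of 0] this p
        show "norm (max 0 (w t x) powr p) \<le> norm (?C * w t x)" by (simp add: abs_mult)
      qed
    qed simp
    then show "L1_norm (\<lambda>x. max 0 (w t x) powr p) < \<infinity>" by (simp add: L1_norm_finite_iff)
    have lim: "((\<lambda>s. ennreal ?C * L1_norm (\<lambda>x. w s x - w t x)) \<longlongrightarrow> ennreal ?C * 0) (at t within {0..T})"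
      by (rule ennreal_tendsto_cmult) (use w t in \<open>simp_all add: L1_curve_def\<close>)
    show "((\<lambda>s. L1_norm (\<lambda>x. max 0 (w s x) powr p - max 0 (w t x) powr p)) \<longlongrightarrow> 0) (at t within {0..T})"
    proof (rule tendsto_sandwich[OF _ _ tendsto_const])
      show "((\<lambda>s. ennreal ?C * L1_norm (\<lambda>x. w s x - w t x)) \<longlongrightarrow> 0) (at t within {0..T})"
        using lim unfolding mult_zero_right .
      show "\<forall>\<^sub>F s in at t within {0..T}. L1_norm (\<lambda>x. max 0 (w s x) powr p - max 0 (w t x) powr p)
          \<le> ennreal ?C * L1_norm (\<lambda>x. w s x - w t x)"
        unfolding eventually_at_filter by (intro always_eventually allI impI lip t)
    qed (rule always_eventually, simp)
  qed
qed

section \<open>A nonlinear Volterra inequality\<close>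

lemma K_alt: "K \<psi> t = (LINT s|lborel. indicator {0<..t} s * \<psi> s)"
  by (simp add: K_def set_lebesgue_integral_def)

lemma AE_indicator_open_interval:
  "AE s in lborel. indicator {a<..<b::real} s * (f s::real) = indicator {a<..b} s * f s"
  using AE_lborel_singleton[of b] by eventually_elim (auto simp: indicator_def)

lemma
  fixes \<psi> :: "real \<Rightarrow> real"
  assumes i: "set_integrable lborel {0<..t - r} \<psi>"
  shows integrable_reflected: "integrable lborel (\<lambda>s. indicator {r<..<t} s * \<psi> (t - s))"
    and integral_reflected: "(LINT s|lborel. indicator {r<..<t} s * \<psi> (t - s)) = K \<psi> (t - r)"
proof -
  have i': "integrable lborel (\<lambda>s. indicator {0<..t - r} s * \<psi> s)"
    using i by (simp add: set_integrable_def)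
  let ?f = "\<lambda>s. indicator {0<..<t - r} s * \<psi> s"
  have "?f = (\<lambda>s. indicator {0<..<t - r} s * (indicator {0<..t - r} s * \<psi> s))"
    by (auto simp: indicator_def)
  then have f: "integrable lborel ?f"
    using integrable_real_mult_indicator[of "{0<..<t - r}" lborel, OF _ i'] by (simp add: mult_ac)
  have eq: "?f (t + (-1) * s) = indicator {r<..<t} s * \<psi> (t - s)" for s
    by (auto simp: indicator_def)
  show "integrable lborel (\<lambda>s. indicator {r<..<t} s * \<psi> (t - s))"
    using lborel_integrable_real_affine[OF f, of "-1" t] unfolding eq by simp
  have "(LINT s|lborel. indicator {r<..<t} s * \<psi> (t - s)) = (LINT s|lborel. ?f s)"
    using lborel_integral_real_affine[of "-1" ?f t] unfolding eq by simp
  also have "\<dots> = K \<psi> (t - r)"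
    unfolding K_alt by (rule integral_cong_AE[OF _ _ AE_indicator_open_interval])
      (use f i' in \<open>auto dest: borel_measurable_integrable\<close>)
  finally show "(LINT s|lborel. indicator {r<..<t} s * \<psi> (t - s)) = K \<psi> (t - r)" .
qed

text \<open>In contrast to \<open>conv\<close> it sees \<open>g\<close> on (0,t) only, so
  \<open>g\<close> need not be extended. The value type is left open because both real means and
  complex Fourier transforms occur.\<close>

definition Volterra :: "(real \<Rightarrow> real) \<Rightarrow> (real \<Rightarrow> 'b::{banach, second_countable_topology}) \<Rightarrow> real \<Rightarrow> 'b" where
  "Volterra \<psi> g t = (LINT s|lborel. (indicator {0<..<t} s * \<psi> (t - s)) *\<^sub>R g s)"

text \<open>Constant extension past the end points turns data on [0,T] into a Borel function on the
  whole line.\<close>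

lemma continuous_on_clamp:
  fixes g :: "real \<Rightarrow> 'b::topological_space"
  assumes "continuous_on {0..T} g" "0 \<le> T"
  shows "continuous_on UNIV (\<lambda>t. g (max 0 (min T t)))"
  by (rule continuous_on_compose2[OF assms(1)]) (use assms(2) in \<open>auto intro!: continuous_intros\<close>)

lemma continuous_on_interval_bounded:
  fixes g :: "real \<Rightarrow> 'b::real_normed_vector"
  assumes "continuous_on {0..T} g"
  obtains C where "0 \<le> C" "\<And>t. t \<in> {0..T} \<Longrightarrow> norm (g t) \<le> C"
proof -
  have "bounded (g ` {0..T})" using assms by (intro compact_imp_bounded compact_continuous_image) auto
  then obtain B where "\<forall>y\<in>g ` {0..T}. norm y \<le> B" by (auto simp: bounded_iff)
  then show ?thesis by (intro that[of "max 0 B"]) (auto simp: le_max_iff_disj)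
qed

lemma kernel_integrable:
  fixes \<psi> :: "real \<Rightarrow> real"
  assumes "\<And>t. 0 < t \<Longrightarrow> set_integrable lborel {0<..t} \<psi>"
  shows "integrable lborel (\<lambda>s. indicator {0<..<t} s * \<psi> (t - s))"
  using integrable_reflected[of t 0 \<psi>] assms[of t] by (cases "0 < t") simp_all

lemma Volterra_integrable:
  fixes g :: "real \<Rightarrow> 'b::{banach, second_countable_topology}"
  assumes \<psi>: "\<And>t. 0 < t \<Longrightarrow> set_integrable lborel {0<..t} \<psi>"
    and g: "continuous_on {0..T} g" and t: "t \<in> {0..T}"
  shows "integrable lborel (\<lambda>s. (indicator {0<..<t} s * \<psi> (t - s)) *\<^sub>R g s)"
proof -
  obtain C where C: "0 \<le> C" "\<And>t. t \<in> {0..T} \<Longrightarrow> norm (g t) \<le> C"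
    using continuous_on_interval_bounded[OF g] by blast
  have k: "integrable lborel (\<lambda>s. indicator {0<..<t} s * \<psi> (t - s))" by (rule kernel_integrable[OF \<psi>])
  then have [measurable]: "(\<lambda>s. indicator {0<..<t} s * \<psi> (t - s)) \<in> borel_measurable borel" by auto
  have [measurable]: "(\<lambda>s. g (max 0 (min T s))) \<in> borel_measurable borel"
    using continuous_on_clamp[OF g] t by (intro borel_measurable_continuous_onI) auto
  have eq: "(indicator {0<..<t} s * \<psi> (t - s)) *\<^sub>R g s = (indicator {0<..<t} s * \<psi> (t - s)) *\<^sub>R g (max 0 (min T s))" for s
    using t by (auto simp: indicator_def min_def max_def)
  show ?thesis
  proof (rule Bochner_Integration.integrable_bound[OF integrable_mult_right[OF k, of C]])
    show "(\<lambda>s. (indicator {0<..<t} s * \<psi> (t - s)) *\<^sub>R g s) \<in> borel_measurable lborel"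
      unfolding eq by measurable
    show "AE s in lborel. norm ((indicator {0<..<t} s * \<psi> (t - s)) *\<^sub>R g s) \<le> norm (C * (indicator {0<..<t} s * \<psi> (t - s)))"
      using C t by (auto simp: indicator_def abs_mult mult.commute[of C] intro!: mult_left_mono)
  qed
qed

lemma Volterra_reflect:
  "Volterra \<psi> g t = (LINT r|lborel. (indicator {0<..<t} r * \<psi> r) *\<^sub>R g (t - r))"
proof -
  have "indicator {0<..<t} (t + - 1 * r) = (indicator {0<..<t} r :: real)" for r by (auto simp: indicator_def)
  then show ?thesis
    unfolding Volterra_def
    using lborel_integral_real_affine[of "- 1" "\<lambda>s. (indicator {0<..<t} s * \<psi> (t - s)) *\<^sub>R g s" t] by simp
qed

text \<open>The kernel may be singular at 0, so after reflection the variable \<open>t\<close> sits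
  in the bounded factor g(t - r) and in the range of integration, and |\<psi>| on (0,T] times a
  bound of \<open>g\<close> dominates.\<close>

lemma Volterra_continuous:
  fixes g :: "real \<Rightarrow> 'b::{banach, second_countable_topology}"
  assumes \<psi>: "\<And>t. 0 < t \<Longrightarrow> set_integrable lborel {0<..t} \<psi>"
    and g: "continuous_on {0..T} g" and T: "0 < T"
  shows "continuous_on {0..T} (Volterra \<psi> g)"
  unfolding continuous_on_sequentially comp_def
proof safe
  fix X and t :: real assume X: "\<forall>k. X k \<in> {0..T}" "X \<longlonglongrightarrow> t" and t: "t \<in> {0..T}"
  define h where "h x = g (max 0 (min T x))" for x
  have hc: "continuous_on UNIV h" using continuous_on_clamp[OF g] T by (simp add: h_def[abs_def])
  have [measurable]: "h \<in> borel_measurable borel" using hc by (rule borel_measurable_continuous_onI)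
  obtain C where C: "0 \<le> C" "\<And>t. t \<in> {0..T} \<Longrightarrow> norm (g t) \<le> C"
    using continuous_on_interval_bounded[OF g] by blast
  have hC: "norm (h x) \<le> C" for x using C(2)[of "max 0 (min T x)"] T by (auto simp: h_def)
  have k: "integrable lborel (\<lambda>r. indicator {0<..T} r * \<psi> r)"
    using \<psi>[OF T] by (simp add: set_integrable_def)
  then have [measurable]: "(\<lambda>r. indicator {0<..T} r * \<psi> r) \<in> borel_measurable borel" by auto
  have eq: "Volterra \<psi> g q = (LINT r|lborel. (indicator {0<..<q} r * (indicator {0<..T} r * \<psi> r)) *\<^sub>R h (q - r))"
    if "q \<in> {0..T}" for q
    unfolding Volterra_reflect using that
    by (intro Bochner_Integration.integral_cong) (auto simp: indicator_def h_def min_def max_def)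
  have "(\<lambda>k. LINT r|lborel. (indicator {0<..<X k} r * (indicator {0<..T} r * \<psi> r)) *\<^sub>R h (X k - r))
    \<longlonglongrightarrow> (LINT r|lborel. (indicator {0<..<t} r * (indicator {0<..T} r * \<psi> r)) *\<^sub>R h (t - r))"
  proof (rule integral_dominated_convergence[where w="\<lambda>r. \<bar>indicator {0<..T} r * \<psi> r\<bar> * C"])
    show "AE r in lborel. (\<lambda>k. (indicator {0<..<X k} r * (indicator {0<..T} r * \<psi> r)) *\<^sub>R h (X k - r))
      \<longlonglongrightarrow> (indicator {0<..<t} r * (indicator {0<..T} r * \<psi> r)) *\<^sub>R h (t - r)"
      using AE_lborel_singleton[of t]
    proof eventually_elim
      fix r assume "r \<noteq> t"
      have "eventually (\<lambda>k. indicator {0<..<X k} r = (indicator {0<..<t} r :: real)) sequentially"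
      proof (cases "r < t")
        case True
        from order_tendstoD(1)[OF X(2) True] show ?thesis
          by eventually_elim (use True in \<open>auto simp: indicator_def\<close>)
      next
        case False
        then have "t < r" using \<open>r \<noteq> t\<close> by simp
        from order_tendstoD(2)[OF X(2) this] show ?thesis
          by eventually_elim (use \<open>t < r\<close> in \<open>auto simp: indicator_def\<close>)
      qed
      then have "(\<lambda>k. indicator {0<..<X k} r :: real) \<longlonglongrightarrow> indicator {0<..<t} r" by (rule tendsto_eventually)
      moreover have "(\<lambda>k. h (X k - r)) \<longlonglongrightarrow> h (t - r)"
        using hc X(2) by (intro continuous_on_tendsto_compose[OF hc] tendsto_intros) auto
      ultimately show "(\<lambda>k. (indicator {0<..<X k} r * (indicator {0<..T} r * \<psi> r)) *\<^sub>R h (X k - r))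
        \<longlonglongrightarrow> (indicator {0<..<t} r * (indicator {0<..T} r * \<psi> r)) *\<^sub>R h (t - r)"
        by (intro tendsto_intros)
    qed
    show "AE r in lborel. norm ((indicator {0<..<X k} r * (indicator {0<..T} r * \<psi> r)) *\<^sub>R h (X k - r))
        \<le> \<bar>indicator {0<..T} r * \<psi> r\<bar> * C" for k
    proof (intro AE_I2)
      fix r
      have "norm ((indicator {0<..<X k} r * (indicator {0<..T} r * \<psi> r)) *\<^sub>R h (X k - r))
        = indicator {0<..<X k} r * \<bar>indicator {0<..T} r * \<psi> r\<bar> * norm (h (X k - r))"
        by (simp add: abs_mult)
      also have "\<dots> \<le> \<bar>indicator {0<..T} r * \<psi> r\<bar> * C"
        using hC C(1) by (intro mult_mono) (auto simp: indicator_def)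
      finally show "norm ((indicator {0<..<X k} r * (indicator {0<..T} r * \<psi> r)) *\<^sub>R h (X k - r))
        \<le> \<bar>indicator {0<..T} r * \<psi> r\<bar> * C" .
    qed
    show "integrable lborel (\<lambda>r. \<bar>indicator {0<..T} r * \<psi> r\<bar> * C)" using k by simp
  qed measurable
  then show "(\<lambda>k. Volterra \<psi> g (X k)) \<longlonglongrightarrow> Volterra \<psi> g t"
    using eq X(1) t by simp
qed

lemma K_mono:
  assumes "\<And>t. t > 0 \<Longrightarrow> 0 \<le> \<psi> t" "set_integrable lborel {0<..b} \<psi>" "a \<le> b"
  shows "K \<psi> a \<le> K \<psi> b"
proof -
  have i: "integrable lborel (\<lambda>s. indicator {0<..b} s * \<psi> s)"
    using assms by (simp add: set_integrable_def)
  have "(\<lambda>s. indicator {0<..a} s * \<psi> s) = (\<lambda>s. indicator {0<..a} s * (indicator {0<..b} s * \<psi> s))"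
    using assms(3) by (auto simp: indicator_def)
  then have "integrable lborel (\<lambda>s. indicator {0<..a} s * \<psi> s)"
    using integrable_real_mult_indicator[of "{0<..a}" lborel, OF _ i] by (simp add: mult_ac)
  then show ?thesis
    unfolding K_alt using i assms by (intro integral_mono) (auto simp: indicator_def)
qed

text \<open>The linear term is harmless as long as F does not fall below a level strictly under
  \<open>F0\<close>. Continuity shows that F never reaches that level, and from then on the source
  term keeps at least half of F^p.\<close>

lemma
  fixes \<psi> F :: "real \<Rightarrow> real"
  assumes \<psi>0: "\<And>t. t > 0 \<Longrightarrow> 0 \<le> \<psi> t"
    and \<psi>: "\<And>t. t > 0 \<Longrightarrow> set_integrable lborel {0<..t} \<psi>"
    and F: "continuous_on {0..T} F" and p: "1 < p" and F0: "0 < F0" and lam: "2 * lam \<le> F0 powr (p - 1)"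
    and ineq: "\<And>t. t \<in> {0..T} \<Longrightarrow>
        F0 + Volterra \<psi> (\<lambda>s. F s powr p - lam * F s) t \<le> F t"
  shows Volterra_ge_initial: "\<And>t. t \<in> {0..T} \<Longrightarrow> F0 \<le> F t"
    and Volterra_step: "\<And>r q t a. \<lbrakk>0 \<le> r; r < q; q \<le> t; t \<le> T; 0 \<le> a; \<And>s. s \<in> {r..T} \<Longrightarrow> a \<le> F s\<rbrakk>
      \<Longrightarrow> a powr p * K \<psi> (q - r) / 2 \<le> F t"
proof -
  \<comment> \<open>Chosen so that m^(p-1) is half of F0^(p-1): then x^p - lam x is nonnegative for
    x >= m, and m < F0 leaves room for a first-exit argument.\<close>
  define m where "m = F0 * 2 powr (- 1 / (p - 1))"
  have m: "0 < m" "m < F0" "m powr (p - 1) = F0 powr (p - 1) / 2"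
  proof -
    show "0 < m" using F0 by (simp add: m_def)
    have "2 powr (- 1 / (p - 1)) < (2::real) powr 0" using p by (intro powr_less_mono) (auto simp: divide_neg_pos)
    then show "m < F0" using F0 by (simp add: m_def)
    have "m powr (p - 1) = F0 powr (p - 1) * 2 powr (-1)"
      using F0 p by (simp add: m_def powr_mult powr_powr)
    then show "m powr (p - 1) = F0 powr (p - 1) / 2" by (simp add: powr_minus_divide)
  qed
  have pos: "0 \<le> x powr p - lam * x" if "m \<le> x" for x
  proof -
    have "lam \<le> m powr (p - 1)" using lam m by simp
    also have "\<dots> \<le> x powr (p - 1)" using m that p by (intro powr_mono2) auto
    finally have "lam * x \<le> x powr (p - 1) * x" using m that by (intro mult_right_mono) auto
    also have "\<dots> = x powr p" using m that by (simp add: powr_diff)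
    finally show ?thesis by simp
  qed
  have ge: "F0 \<le> F t" if t: "t \<in> {0..T}" and below: "\<And>s. 0 < s \<Longrightarrow> s < t \<Longrightarrow> m \<le> F s" for t
  proof -
    have "0 \<le> Volterra \<psi> (\<lambda>s. F s powr p - lam * F s) t"
      unfolding Volterra_def using \<psi>0 pos below by (intro integral_nonneg_AE AE_I2) (auto simp: indicator_def)
    then show ?thesis using ineq[OF t] by simp
  qed
  have gt_m: "m < F t" if t: "t \<in> {0..T}" for t
  proof (rule ccontr)
    assume "\<not> m < F t"
    then have B: "{0..T} \<inter> F -` {..m} \<noteq> {}" using t by auto
    have "closed ({0..T} \<inter> F -` {..m})"
      using F by (intro continuous_closed_preimage) auto
    moreover have "bdd_below ({0..T} \<inter> F -` {..m})" by (auto intro: bdd_belowI[of _ 0])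
    \<comment> \<open>The first time at which F is at most \<open>m\<close>. Up to it the integrand
      is nonnegative, so F there would still be at least F0 > m.\<close>
    ultimately have inf: "Inf ({0..T} \<inter> F -` {..m}) \<in> {0..T} \<inter> F -` {..m}" (is "?\<tau> \<in> _")
      using B by (intro closed_contains_Inf)
    have "m \<le> F s" if "0 < s" "s < ?\<tau>" for s
    proof (rule ccontr)
      assume "\<not> m \<le> F s"
      then have "s \<in> {0..T} \<inter> F -` {..m}" using that inf by auto
      then have "?\<tau> \<le> s" by (rule cInf_lower) (auto intro: bdd_belowI[of _ 0])
      then show False using that by simp
    qed
    then have "F0 \<le> F ?\<tau>" using inf by (intro ge) auto
    then show False using inf m by auto
  qed
  show ge0: "F0 \<le> F t" if t: "t \<in> {0..T}" for t
    by (rule ge[OF t]) (use gt_m t in \<open>force intro: less_imp_le\<close>)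
  fix r q t a assume *: "0 \<le> r" "r < q" "q \<le> t" "t \<le> T" "0 \<le> a" and a: "\<And>s. s \<in> {r..T} \<Longrightarrow> a \<le> F s"
  let ?G = "\<lambda>s. F s powr p - lam * F s"
  have "continuous_on {0..T} ?G"
    using F p by (intro continuous_intros continuous_on_powr') (use ge0 F0 in \<open>force+\<close>)
  then have i: "integrable lborel (\<lambda>s. (indicator {0<..<t} s * \<psi> (t - s)) *\<^sub>R ?G s)"
    using * by (intro Volterra_integrable \<psi>) auto
  \<comment> \<open>Only the part (r,t) of the history is kept; its kernel mass K(t - r) is at least
    K(q - r), a bound uniform in t >= q.\<close>
  have "a powr p * K \<psi> (q - r) / 2 \<le> a powr p / 2 * K \<psi> (t - r)"
    using K_mono[of \<psi> "t - r" "q - r"] \<psi>0 \<psi>[of "t - r"] * by (auto intro!: mult_left_mono)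
  also have "\<dots> = (LINT s|lborel. a powr p / 2 * (indicator {r<..<t} s * \<psi> (t - s)))"
    using * \<psi>[of "t - r"] by (simp add: integral_reflected)
  also have "\<dots> \<le> Volterra \<psi> ?G t"
    unfolding Volterra_def
  proof (rule integral_mono)
    show "integrable lborel (\<lambda>s. a powr p / 2 * (indicator {r<..<t} s * \<psi> (t - s)))"
      using * \<psi>[of "t - r"] integrable_reflected[of t r \<psi>] by simp
    fix s
    show "a powr p / 2 * (indicator {r<..<t} s * \<psi> (t - s)) \<le> (indicator {0<..<t} s * \<psi> (t - s)) *\<^sub>R ?G s"
    proof (cases "s \<in> {0<..<t}")
      case True
      then have sT: "s \<in> {0..T}" using * by auto
      have Fs: "F0 \<le> F s" by (rule ge0[OF sT])
      have "lam * F s \<le> F s powr (p - 1) / 2 * F s"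
      proof (rule mult_right_mono)
        have "F0 powr (p - 1) \<le> F s powr (p - 1)" using Fs F0 p by (intro powr_mono2) auto
        then show "lam \<le> F s powr (p - 1) / 2" using lam by simp
      qed (use Fs F0 in auto)
      also have "\<dots> = F s powr p / 2" using Fs F0 by (simp add: powr_diff)
      \<comment> \<open>This is where the factor 2 between \<open>lam\<close> and F0^(p-1) enters,
        and it is the origin of the division by 2 in the claim.\<close>
      finally have half: "F s powr p / 2 \<le> ?G s" by simp
      show ?thesis
      proof (cases "r < s")
        case r: True
        then have "a powr p \<le> F s powr p" using a[of s] * sT p by (intro powr_mono2) auto
        with half have "a powr p / 2 \<le> ?G s" by simp
        from mult_left_mono[OF this, of "\<psi> (t - s)"]
        show ?thesis using \<psi>0[of "t - s"] r True by (simp add: mult.commute)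
      next
        case False
        have "0 \<le> F s powr p / 2" by simp
        with half have "0 \<le> ?G s" by linarith
        then show ?thesis using \<psi>0[of "t - s"] True False by simp
      qed
    qed (use * in auto)
  qed (rule i)
  also have "\<dots> \<le> F t" using ineq[of t] F0 * by simp
  finally show "a powr p * K \<psi> (q - r) / 2 \<le> F t" .
qed

text \<open>Along \<open>t\<^sub>k = T (1 - 2\<^sup>-\<^sup>k)\<close> the step estimate gives \<open>F \<ge> F0 \<theta>\<^sup>k\<close> on \<open>[t\<^sub>k, T]\<close>; the threshold
  is exactly what makes \<open>\<theta> > 2 powr (\<beta> / (p - 1))\<close>, and this absorbs the loss \<open>2 powr (- \<beta> (k + 1))\<close>.\<close>

lemma Volterra_blowup_bound:
  fixes \<psi> F :: "real \<Rightarrow> real"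
  assumes \<psi>0: "\<And>t. t > 0 \<Longrightarrow> 0 \<le> \<psi> t"
    and \<psi>: "\<And>t. t > 0 \<Longrightarrow> set_integrable lborel {0<..t} \<psi>"
    and F: "continuous_on {0..T} F" and p: "1 < p" and F0: "0 < F0" and lam: "2 * lam \<le> F0 powr (p - 1)"
    and ineq: "\<And>t. t \<in> {0..T} \<Longrightarrow>
        F0 + Volterra \<psi> (\<lambda>s. F s powr p - lam * F s) t \<le> F t"
    and T: "0 < T" and \<beta>: "0 < \<beta>" and C: "0 < C"
    and K: "\<And>s. 0 < s \<Longrightarrow> s \<le> T \<Longrightarrow> K \<psi> s \<ge> C * (s / T) powr \<beta> * K \<psi> T"
  shows "K \<psi> T * F0 powr (p - 1) \<le> 2 powr (1 + \<beta> * p / (p - 1)) / C"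
proof (rule ccontr)
  note ge0 = Volterra_ge_initial[OF \<psi>0 \<psi> F p F0 lam ineq]
  note step = Volterra_step[OF \<psi>0 \<psi> F p F0 lam ineq]
  assume "\<not> ?thesis"
  then have big: "2 powr (1 + \<beta> * p / (p - 1)) < C * K \<psi> T * F0 powr (p - 1)"
    using C by (simp add: field_simps)
  \<comment> \<open>The ratio by which the claimed bound is supposed to fail; any excess over 1 must
    lead to geometric growth.\<close>
  define \<rho> where "\<rho> = C * K \<psi> T * F0 powr (p - 1) / 2 powr (1 + \<beta> * p / (p - 1))"
  have \<rho>: "1 < \<rho>" using big by (simp add: \<rho>_def)
  define \<theta> where "\<theta> = \<rho> * 2 powr (\<beta> / (p - 1))"
  have "1 \<le> (2::real) powr (\<beta> / (p - 1))" using \<beta> p by (intro ge_one_powr_ge_zero) auto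
  then have "\<rho> * 1 \<le> \<theta>" using \<rho> unfolding \<theta>_def by (intro mult_left_mono) auto
  then have \<theta>: "1 < \<theta>" using \<rho> by simp
  have main: "\<forall>t\<in>{T * (1 - 1 / 2 ^ k)..T}. F0 * \<theta> ^ k \<le> F t" for k
  proof (induction k)
    case 0
    then show ?case using ge0 by simp
  next
    case (Suc k)
    show ?case
    proof
      fix t assume t: "t \<in> {T * (1 - 1 / 2 ^ Suc k)..T}"
      let ?r = "T * (1 - 1 / 2 ^ k)" and ?q = "T * (1 - 1 / 2 ^ Suc k)"
      have qr: "?q - ?r = T / 2 ^ Suc k" by (simp add: field_simps)
      have "(F0 * \<theta> ^ k) powr p * K \<psi> (?q - ?r) / 2 \<le> F t"
      proof (rule step)
        show "0 \<le> ?r" using T by (simp add: field_simps)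
        show "?r < ?q" using qr T by (simp add: algebra_simps)
      qed (use Suc t F0 \<theta> in auto)
      moreover have "F0 * \<theta> ^ Suc k \<le> (F0 * \<theta> ^ k) powr p * K \<psi> (?q - ?r) / 2"
      proof -
        have "(T / 2 ^ Suc k) / T = 2 powr (- real (Suc k))"
          using T by (simp add: powr_minus powr_realpow[symmetric] divide_inverse del: power_Suc of_nat_Suc)
        then have pw: "((T / 2 ^ Suc k) / T) powr \<beta> = 2 powr (- \<beta> * Suc k)"
          by (simp add: powr_powr mult.commute del: of_nat_Suc)
        have "T / 2 ^ Suc k \<le> T" using T one_le_power[of "2::real" "Suc k"] by (simp add: field_simps)
        then have KK: "K \<psi> (?q - ?r) \<ge> C * 2 powr (- \<beta> * Suc k) * K \<psi> T"
          unfolding qr pw[symmetric] using T by (intro K) auto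
        have e: "F0 powr p = F0 powr (p - 1) * F0" using F0 by (simp add: powr_diff)
        have th: "(\<theta> ^ k) powr p = \<rho> powr (k * p) * 2 powr (\<beta> / (p - 1) * (k * p))"
          using \<theta> \<rho> by (simp add: powr_realpow[symmetric] powr_powr \<theta>_def powr_mult mult_ac)
        have th': "\<theta> ^ Suc k = \<rho> powr (Suc k) * 2 powr (\<beta> / (p - 1) * Suc k)"
          using \<theta> \<rho> by (simp add: powr_realpow[symmetric] powr_powr \<theta>_def powr_mult del: power_Suc of_nat_Suc)
        have CK: "C * K \<psi> T * F0 powr (p - 1) = \<rho> * (2 * 2 powr (\<beta> * p / (p - 1)))"
          by (simp add: \<rho>_def powr_add)
        \<comment> \<open>The powers of \<rho> do not balance exactly: p > 1 produces k p + 1 of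
          them where k + 1 suffice, and the surplus is discarded.\<close>
        have "\<rho> powr (Suc k) \<le> \<rho> powr (1 + k * p)"
          using \<rho> p mult_left_mono[of 1 p "real k"] by (intro powr_mono) auto
        also have "\<dots> = \<rho> * \<rho> powr (k * p)" using \<rho> by (simp add: powr_add)
        finally have rr: "\<rho> powr (Suc k) \<le> \<rho> * \<rho> powr (k * p)" .
        \<comment> \<open>The powers of 2 balance exactly; this identity determines both the
          exponent \<beta> / (p - 1) in \<theta> and the exponent \<beta> p / (p - 1) in the
          bound.\<close>
        have ex: "\<beta> * p / (p - 1) + \<beta> / (p - 1) * (k * p) + (- \<beta> * Suc k) = \<beta> / (p - 1) * Suc k"
        proof -
          have "p * inverse (p - 1) = 1 + inverse (p - 1)" using p by (simp add: field_simps)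
          then show ?thesis unfolding divide_inverse of_nat_Suc by algebra
        qed
        have "F0 * \<theta> ^ Suc k \<le> F0 * (\<rho> * \<rho> powr (k * p) * 2 powr (\<beta> / (p - 1) * Suc k))"
          unfolding th' using F0 rr by (intro mult_left_mono mult_right_mono) auto
        also have "\<dots> = F0 * (\<rho> * \<rho> powr (k * p) * (2 powr (\<beta> * p / (p - 1)) * 2 powr (\<beta> / (p - 1) * (k * p)) * 2 powr (- \<beta> * Suc k)))"
          unfolding powr_add[symmetric] ex ..
        also have "\<dots> = (C * K \<psi> T * F0 powr (p - 1)) * F0 * (\<rho> powr (k * p) * 2 powr (\<beta> / (p - 1) * (k * p))) * 2 powr (- \<beta> * Suc k) / 2"
          unfolding CK by (simp add: mult_ac)
        also have "\<dots> = (F0 * \<theta> ^ k) powr p * (C * 2 powr (- \<beta> * Suc k) * K \<psi> T) / 2"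
        proof -
          have pm: "(F0 * \<theta> ^ k) powr p = F0 powr p * (\<theta> ^ k) powr p" using F0 \<theta> by (simp add: powr_mult)
          show ?thesis unfolding pm e th by (simp only: mult_ac)
        qed
        also have "\<dots> \<le> (F0 * \<theta> ^ k) powr p * K \<psi> (?q - ?r) / 2"
          using KK by (intro divide_right_mono mult_left_mono) auto
        finally show ?thesis .
      qed
      ultimately show "F0 * \<theta> ^ Suc k \<le> F t" by linarith
    qed
  qed
  \<comment> \<open>The time T belongs to all the intervals [t_k, T], so the single number
    \<open>F T\<close> would exceed every term of a divergent geometric sequence.\<close>
  have "F0 * \<theta> ^ k \<le> F T" for k using main[of k] T by (auto simp: field_simps)
  moreover obtain k where "F T / F0 < \<theta> ^ k" using real_arch_pow[OF \<theta>] by blast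
  ultimately show False using F0 by (simp add: field_simps not_le[symmetric])
qed

section \<open>Continuity and monotonicity of \<open>K\<close>\<close>

lemma K_continuous:
  assumes \<psi>: "\<And>t. t > 0 \<Longrightarrow> set_integrable lborel {0<..t} \<psi>"
  shows "continuous_on {0..} (K \<psi>)"
  unfolding continuous_on_sequentially comp_def
proof safe
  fix X and t :: real assume X: "\<forall>k. X k \<in> {0..}" "X \<longlonglongrightarrow> t" and t: "0 \<le> t"
  obtain T where T: "T > 0" "\<And>k. X k \<le> T"
  proof -
    have "Bseq X" using X(2) by (intro convergent_imp_Bseq) (auto simp: convergent_def)
    then obtain B where "B > 0" "\<And>k. norm (X k) \<le> B" by (auto elim: BseqE)
    then show ?thesis by (intro that[of B]) (auto simp: abs_le_iff)
  qed
  have tT: "t \<le> T" using X(2) T(2) by (intro LIMSEQ_le_const2) auto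
  have i: "integrable lborel (\<lambda>s. indicator {0<..T} s * \<psi> s)"
    using \<psi>[OF T(1)] by (simp add: set_integrable_def)
  have m: "(\<lambda>s. indicator {0<..r} s * \<psi> s) \<in> borel_measurable lborel" if "r \<le> T" for r
  proof -
    have "(\<lambda>s. indicator {0<..r} s * \<psi> s) = (\<lambda>s. indicator {0<..r} s * (indicator {0<..T} s * \<psi> s))"
      using that by (auto simp: indicator_def)
    then show ?thesis using i by simp
  qed
  show "(\<lambda>k. K \<psi> (X k)) \<longlonglongrightarrow> K \<psi> t"
    unfolding K_alt
  proof (rule integral_dominated_convergence[where w="\<lambda>s. \<bar>indicator {0<..T} s * \<psi> s\<bar>"])
    show "AE s in lborel. (\<lambda>k. indicator {0<..X k} s * \<psi> s) \<longlonglongrightarrow> indicator {0<..t} s * \<psi> s"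
      using AE_lborel_singleton[of t]
    proof eventually_elim
      fix s assume "s \<noteq> t"
      have "eventually (\<lambda>k. indicator {0<..X k} s * \<psi> s = indicator {0<..t} s * \<psi> s) sequentially"
      proof (cases "s < t")
        case True
        from order_tendstoD(1)[OF X(2) True] show ?thesis
          by eventually_elim (use True in \<open>auto simp: indicator_def\<close>)
      next
        case False
        then have "t < s" using \<open>s \<noteq> t\<close> by simp
        from order_tendstoD(2)[OF X(2) this] show ?thesis
          by eventually_elim (use \<open>t < s\<close> in \<open>auto simp: indicator_def\<close>)
      qed
      then show "(\<lambda>k. indicator {0<..X k} s * \<psi> s) \<longlonglongrightarrow> indicator {0<..t} s * \<psi> s"
        by (rule tendsto_eventually)
    qed
    show "AE s in lborel. norm (indicator {0<..X k} s * \<psi> s) \<le> \<bar>indicator {0<..T} s * \<psi> s\<bar>" for k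
      using T(2)[of k] by (auto simp: indicator_def)
  qed (use i m tT T in auto)
qed

text \<open>One positive value inside the interval is enough: by continuity a rectangle of height
  \<psi>(s) / 2 fits under the graph just to the right of \<open>s\<close>.\<close>

lemma K_strict_mono:
  assumes \<psi>c: "continuous_on {0<..} \<psi>" and \<psi>0: "\<And>t. t > 0 \<Longrightarrow> 0 \<le> \<psi> t"
    and \<psi>: "\<And>t. t > 0 \<Longrightarrow> set_integrable lborel {0<..t} \<psi>"
    and ab: "0 \<le> a" "a < b" and s: "s \<in> {a<..<b}" "\<psi> s > 0"
  shows "K \<psi> a < K \<psi> b"
proof -
  have "isCont \<psi> s" using \<psi>c s ab by (auto simp: continuous_on_eq_continuous_at)
  then have "eventually (\<lambda>x. \<psi> x > \<psi> s / 2) (at s)"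
    using s by (intro order_tendstoD(1)[of _ "\<psi> s"]) (auto simp: isCont_def)
  then obtain d where d: "d > 0" "\<And>x. x \<noteq> s \<Longrightarrow> dist x s < d \<Longrightarrow> \<psi> x > \<psi> s / 2"
    unfolding eventually_at by auto
  define q where "q = min b (s + d)"
  have q: "s < q" "q \<le> b" using d s by (auto simp: q_def)
  have lower: "\<psi> s / 2 < \<psi> x" if "x \<in> {s<..<q}" for x
    using that d(2)[of x] by (auto simp: q_def dist_real_def)
  have i: "integrable lborel (\<lambda>x. indicator {0<..r} x * \<psi> x)" if "0 \<le> r" for r
    using \<psi>[of r] that by (cases "r = 0") (auto simp: set_integrable_def)
  have "K \<psi> a + \<psi> s / 2 * (q - s) = (LINT x|lborel. indicator {0<..a} x * \<psi> x + \<psi> s / 2 * indicator {s<..<q} x)"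
    unfolding K_alt using i[of a] ab q by (subst Bochner_Integration.integral_add) (auto simp: integrable_indicator_iff)
  also have "\<dots> \<le> (LINT x|lborel. indicator {0<..b} x * \<psi> x)"
  proof (rule integral_mono)
    show "integrable lborel (\<lambda>x. indicator {0<..a} x * \<psi> x + \<psi> s / 2 * indicator {s<..<q} x)"
      using i[of a] ab q by (intro Bochner_Integration.integrable_add integrable_mult_right) (auto simp: integrable_indicator_iff)
    show "integrable lborel (\<lambda>x. indicator {0<..b} x * \<psi> x)" using i[of b] ab by simp
    fix x
    show "indicator {0<..a} x * \<psi> x + \<psi> s / 2 * indicator {s<..<q} x \<le> indicator {0<..b} x * \<psi> x"
      using lower[of x] \<psi>0[of x] q s ab by (auto simp: indicator_def)
  qed
  finally have "K \<psi> a + \<psi> s / 2 * (q - s) \<le> K \<psi> b" by (simp add: K_alt)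
  moreover have "\<psi> s / 2 * (q - s) > 0" using s q by simp
  ultimately show ?thesis by linarith
qed

section \<open>The kernel and the resolvent families\<close>

lemma Laplace_ok_cong_AE:
  assumes f: "Laplace_ok z f" and [measurable]: "g \<in> borel_measurable borel" and "\<And>t. t \<le> 0 \<Longrightarrow> g t = 0"
    and eq: "AE t in lborel. f t = g t"
  shows "Laplace_ok z g" "Laplace g z = Laplace f z"
proof -
  have [measurable]: "f \<in> borel_measurable borel" using f by (simp add: Laplace_ok_def)
  have eq': "AE t in lborel. exp (- z * t) *\<^sub>R f t = exp (- z * t) *\<^sub>R g t"
    using eq by eventually_elim simp
  have "integrable lborel (\<lambda>t. exp (- z * t) *\<^sub>R g t)"
    by (rule integrable_cong_AE_imp[OF _ _ eq']) (use f in \<open>auto simp: Laplace_ok_def\<close>)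
  then show "Laplace_ok z g" using assms by (simp add: Laplace_ok_def)
  show "Laplace g z = Laplace f z"
    unfolding Laplace_def by (intro integral_cong_AE AE_symmetric[OF eq']) measurable
qed

lemma Borel_representative:
  fixes f :: "real \<Rightarrow> complex"
  assumes f: "f \<in> borel_measurable lebesgue"
  obtains g where "g \<in> borel_measurable borel" "AE t in lborel. f t = g t"
proof -
  have "(\<lambda>t. Re (f t)) \<in> borel_measurable lebesgue" "(\<lambda>t. Im (f t)) \<in> borel_measurable lebesgue"
    using f by measurable
  then obtain a b where ab[measurable]: "a \<in> borel_measurable lborel" "b \<in> borel_measurable lborel"
    and eq: "AE t in lborel. Re (f t) = a t" "AE t in lborel. Im (f t) = b t"
    using completion_ex_borel_measurable_real[of _ lborel] by metis
  show ?thesis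
  proof (rule that[of "\<lambda>t. Complex (a t) (b t)"])
    have "(\<lambda>t. Complex (a t) (b t)) = (\<lambda>t. of_real (a t) + \<i> * of_real (b t))"
      by (simp add: complex_eq_iff fun_eq_iff)
    then show "(\<lambda>t. Complex (a t) (b t)) \<in> borel_measurable borel" using ab by simp
    show "AE t in lborel. f t = Complex (a t) (b t)"
      using eq by eventually_elim (simp add: complex_eq_iff)
  qed
qed

lemma norm_Fourier_measure_le:
  assumes "finite_measure \<mu>"
  shows "norm (Fourier_measure \<mu> \<eta>) \<le> measure \<mu> (space \<mu>)"
proof -
  interpret finite_measure \<mu> by fact
  have "norm (Fourier_measure \<mu> \<eta>) \<le> (LINT x|\<mu>. norm (exp (- (\<i> * complex_of_real (x \<bullet> \<eta>)))))"
    unfolding Fourier_measure_def by (rule integral_norm_bound)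
  then show ?thesis by simp
qed

lemma Fourier_measure_0: "finite_measure \<mu> \<Longrightarrow> Fourier_measure \<mu> 0 = of_real (measure \<mu> (space \<mu>))"
  by (simp add: Fourier_measure_def scaleR_conv_of_real)

lemma isCont_Fourier_measure:
  assumes \<mu>: "finite_measure \<mu>" "sets \<mu> = sets borel"
  shows "isCont (Fourier_measure \<mu>) \<eta>"
  unfolding continuous_at_sequentially Fourier_measure_def comp_def
proof (intro allI impI)
  fix X assume X: "X \<longlonglongrightarrow> \<eta>"
  interpret finite_measure \<mu> by fact
  note [measurable_cong] = \<mu>(2)
  show "(\<lambda>k. LINT x|\<mu>. exp (- (\<i> * complex_of_real (x \<bullet> X k)))) \<longlonglongrightarrow> (LINT x|\<mu>. exp (- (\<i> * complex_of_real (x \<bullet> \<eta>))))"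
  proof (rule integral_dominated_convergence[where w="\<lambda>x. 1"])
    show "AE x in \<mu>. (\<lambda>k. exp (- (\<i> * complex_of_real (x \<bullet> X k)))) \<longlonglongrightarrow> exp (- (\<i> * complex_of_real (x \<bullet> \<eta>)))"
      by (intro AE_I2 tendsto_intros X)
  qed auto
qed

text \<open>Integrability is extracted from the value of the integral: a divergent one would be 0,
  whereas v is not. It then passes to the Borel representative \<open>f\<close> of
  \<open>g\<close>.\<close>

lemma Laplace_of_lebesgue_integral:
  fixes f :: "real \<Rightarrow> complex"
  assumes [measurable]: "f \<in> borel_measurable borel" and 0: "\<And>t. t \<le> 0 \<Longrightarrow> f t = 0"
    and eq: "AE t in lborel. 0 < t \<longrightarrow> g t = f t"
    and nz: "(LINT t:{0<..}|lebesgue. of_real (exp (- z * t)) * g t) = v" "v \<noteq> 0"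
  shows "Laplace_ok z f" "Laplace f z = v"
proof -
  have ae: "AE t in lebesgue. indicator {0<..} t *\<^sub>R (of_real (exp (- z * t)) * g t) = exp (- z * t) *\<^sub>R f t"
    using AE_completion[OF eq]
    by eventually_elim (auto simp: indicator_def 0 scaleR_conv_of_real)
  have m: "(\<lambda>t. exp (- z * t) *\<^sub>R f t) \<in> borel_measurable lborel" by measurable
  have int: "integrable lebesgue (\<lambda>t. indicator {0<..} t *\<^sub>R (of_real (exp (- z * t)) * g t))"
    using nz not_integrable_integral_eq unfolding set_lebesgue_integral_def by metis
  have "integrable lebesgue (\<lambda>t. exp (- z * t) *\<^sub>R f t)"
    by (rule integrable_cong_AE_imp[OF int measurable_completion[OF m] ae])
  then show "Laplace_ok z f"
    using integrable_completion[OF m] assms by (simp add: Laplace_ok_def)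
  have "v = (LINT t|lebesgue. exp (- z * t) *\<^sub>R f t)"
    using nz(1) unfolding set_lebesgue_integral_def
    using integral_cong_AE[OF _ _ ae] int measurable_completion[OF m] by simp
  then show "Laplace f z = v"
    using integral_completion[OF m] by (simp add: Laplace_def)
qed

lemma AE_lborel_ex_in_interval:
  assumes "AE x in lborel. P x" "a < (b::real)"
  shows "\<exists>x. a < x \<and> x < b \<and> P x"
proof (rule ccontr)
  assume "\<not> ?thesis"
  then have "AE x in lborel. x \<notin> {a<..<b}" using assms(1) by (auto elim!: eventually_mono)
  then have "{a<..<b} \<in> null_sets lborel" by (subst (asm) AE_iff_null_sets[symmetric]) auto
  then show False using assms(2) by (simp add: null_sets_def)
qed

locale resolvents =
  fixes \<alpha>1 \<alpha>2 c :: real and \<psi> :: "real \<Rightarrow> real" and Z Y :: "real \<Rightarrow> (real^'n) measure"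
  assumes pos: "0 < \<alpha>1" "0 < \<alpha>2" "0 < c"
    and inverse_Laplace: "inverse_Laplace_of_\<Psi> \<alpha>1 \<alpha>2 c \<psi>"
    and Z: "Z_family \<alpha>1 \<alpha>2 c Z" and Y: "Y_family \<alpha>1 \<alpha>2 c Y"
begin

abbreviation Psi :: "real \<Rightarrow> real" where "Psi \<equiv> \<Psi> \<alpha>1 \<alpha>2 c"

lemma Psi_pos: "0 < z \<Longrightarrow> 0 < Psi z"
  by (simp add: \<Psi>_def)

lemma \<Psi>_of_real: "0 < z \<Longrightarrow> \<Psi> \<alpha>1 \<alpha>2 c (complex_of_real z) = of_real (Psi z)"
  using powr_of_real[of z "- B_fun \<alpha>1 \<alpha>2 c z"] by (simp add: \<Psi>_def B_fun_def)

text \<open>The exponent \<open>B_fun\<close> is the mean of \<alpha>2 and \<alpha>1 with weights c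
  and z, hence at least their minimum. The resulting blow-up of \<open>Psi\<close> at 0 drives
  \<open>K_unbounded\<close>.\<close>

lemma Psi_ge:
  assumes "0 < z" "z \<le> 1"
  shows "z powr (- min \<alpha>1 \<alpha>2) \<le> Psi z"
proof -
  have "min \<alpha>1 \<alpha>2 * (c + z) \<le> \<alpha>2 * c + \<alpha>1 * z"
    using pos assms by (auto simp: distrib_left intro!: add_mono mult_right_mono)
  then have "min \<alpha>1 \<alpha>2 \<le> B_fun \<alpha>1 \<alpha>2 c z"
    using pos assms by (simp add: B_fun_def le_divide_eq)
  then show ?thesis
    using assms unfolding \<Psi>_def by (intro powr_mono') auto
qed

lemma \<psi>_continuous: "continuous_on {0<..} \<psi>"
  and \<psi>_integrable: "0 < t \<Longrightarrow> set_integrable lborel {0<..t} \<psi>"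
  using inverse_Laplace by (auto simp: inverse_Laplace_of_\<Psi>_def)

definition \<psi>c :: "real \<Rightarrow> complex" where "\<psi>c t = of_real (indicator {0<..} t * \<psi> t)"

lemma \<psi>c_nonpos: "t \<le> 0 \<Longrightarrow> \<psi>c t = 0"
  by (simp add: \<psi>c_def)

lemma \<psi>c_measurable [measurable]: "\<psi>c \<in> borel_measurable borel"
proof -
  have "(\<lambda>t. indicator {0<..} t *\<^sub>R \<psi> t) \<in> borel_measurable borel"
    by (intro borel_measurable_continuous_on_indicator \<psi>_continuous) simp
  then have "(\<lambda>t. complex_of_real (indicator {0<..} t *\<^sub>R \<psi> t)) \<in> borel_measurable borel"
    by measurable
  then show ?thesis by (simp add: \<psi>c_def[abs_def])
qed

text \<open>The growth rate of \<psi> limits this to large arguments; \<open>Laplace_\<psi>c\<close>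
  removes the threshold once \<psi> is known to be the mass of the measures.\<close>

lemma Laplace_\<psi>c_large: "\<exists>w\<ge>0. \<forall>z>w. Laplace_ok z \<psi>c \<and> Laplace \<psi>c z = of_real (Psi z)"
proof -
  obtain \<omega> where \<omega>: "\<And>z::complex. Re z > max 0 \<omega> \<Longrightarrow>
      (LINT t:{0<..}|lborel. exp (- z * of_real t) * of_real (\<psi> t)) = \<Psi> \<alpha>1 \<alpha>2 c z"
    using inverse_Laplace unfolding inverse_Laplace_of_\<Psi>_def by blast
  have "Laplace_ok z \<psi>c \<and> Laplace \<psi>c z = of_real (Psi z)" if z: "z > max 0 \<omega>" for z
  proof -
    have eq: "exp (- z * t) *\<^sub>R \<psi>c t = indicator {0<..} t *\<^sub>R (exp (- complex_of_real z * of_real t) * of_real (\<psi> t))" for t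
      by (simp add: \<psi>c_def indicator_def scaleR_conv_of_real exp_of_real[symmetric])
    have "(LINT t|lborel. exp (- z * t) *\<^sub>R \<psi>c t) = of_real (Psi z)"
      using \<omega>[of "of_real z"] z \<Psi>_of_real[of z] unfolding set_lebesgue_integral_def eq by simp
    moreover have "integrable lborel (\<lambda>t. exp (- z * t) *\<^sub>R \<psi>c t)"
      using calculation Psi_pos[of z] z not_integrable_integral_eq[of lborel "\<lambda>t. exp (- z * t) *\<^sub>R \<psi>c t"] by auto
    ultimately show ?thesis by (simp add: Laplace_ok_def Laplace_def \<psi>c_nonpos)
  qed
  then show ?thesis by (intro exI[of _ "max 0 \<omega>"]) auto
qed

text \<open>Measurability in time is read off the transform identity at z = 1: its value is nonzero,
  so the integrand is integrable and hence measurable, and multiplication by exp t undoes the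
  weight.\<close>

lemma yhat_exists: "\<exists>r. r \<in> borel_measurable borel \<and> (\<forall>t\<le>0. r t = 0) \<and>
    (AE t in lborel. 0 < t \<longrightarrow> Fourier_measure (Y t) \<eta> = r t)"
proof -
  let ?f = "\<lambda>t. indicator {0<..} t *\<^sub>R (of_real (exp (- 1 * t)) * Fourier_measure (Y t) \<eta>)"
  have "(LINT t|lebesgue. ?f t) \<noteq> 0"
  proof -
    have "(LINT t|lebesgue. ?f t) = of_real (1 / (inverse (Psi 1) + (norm \<eta>)\<^sup>2))"
      using Y unfolding Y_family_def set_lebesgue_integral_def by (meson zero_less_one)
    moreover have "1 / (inverse (Psi 1) + (norm \<eta>)\<^sup>2) \<noteq> 0"
      using Psi_pos[of 1] by (simp add: add_pos_nonneg less_imp_neq[symmetric])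
    ultimately show ?thesis using of_real_eq_0_iff by metis
  qed
  then have "integrable lebesgue ?f" using not_integrable_integral_eq by metis
  then have "?f \<in> borel_measurable lebesgue" by (rule borel_measurable_integrable)
  moreover have "(\<lambda>t::real. complex_of_real (exp t)) \<in> borel_measurable lebesgue"
    by (intro measurable_completion) simp
  ultimately have "(\<lambda>t. complex_of_real (exp t) * ?f t) \<in> borel_measurable lebesgue" by measurable
  then obtain g where g[measurable]: "g \<in> borel_measurable borel"
    and eq: "AE t in lborel. complex_of_real (exp t) * ?f t = g t"
    by (rule Borel_representative)
  show ?thesis
  proof (intro exI[of _ "\<lambda>t. indicator {0<..} t *\<^sub>R g t"] conjI)
    show "AE t in lborel. 0 < t \<longrightarrow> Fourier_measure (Y t) \<eta> = indicator {0<..} t *\<^sub>R g t"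
      using eq by eventually_elim (auto simp flip: of_real_mult mult.assoc exp_add)
  qed auto
qed

text \<open>The Fourier transform of \<open>Y t\<close> is only Lebesgue measurable in \<open>t\<close>; convolutions need a Borel
  representative.\<close>

definition yhat :: "real^'n \<Rightarrow> real \<Rightarrow> complex" where
  "yhat \<eta> = (SOME r. r \<in> borel_measurable borel \<and> (\<forall>t\<le>0. r t = 0) \<and>
    (AE t in lborel. 0 < t \<longrightarrow> Fourier_measure (Y t) \<eta> = r t))"

lemma yhat_measurable [measurable]: "yhat \<eta> \<in> borel_measurable borel"
  and yhat_nonpos: "t \<le> 0 \<Longrightarrow> yhat \<eta> t = 0"
  and AE_yhat: "AE t in lborel. 0 < t \<longrightarrow> Fourier_measure (Y t) \<eta> = yhat \<eta> t"
  using someI_ex[OF yhat_exists[of \<eta>]] by (auto simp: yhat_def)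

lemma
  assumes "0 < z"
  shows Laplace_ok_yhat: "Laplace_ok z (yhat \<eta>)"
    and Laplace_yhat: "Laplace (yhat \<eta>) z = of_real (1 / (inverse (Psi z) + (norm \<eta>)\<^sup>2))"
proof -
  have "(LINT t:{0<..}|lebesgue. of_real (exp (- z * t)) * Fourier_measure (Y t) \<eta>)
      = of_real (1 / (inverse (Psi z) + (norm \<eta>)\<^sup>2))"
    using Y assms by (auto simp: Y_family_def)
  moreover have "1 / (inverse (Psi z) + (norm \<eta>)\<^sup>2) \<noteq> 0"
    using Psi_pos[OF assms] by (simp add: add_pos_nonneg less_imp_neq[symmetric])
  ultimately show "Laplace_ok z (yhat \<eta>)" "Laplace (yhat \<eta>) z = of_real (1 / (inverse (Psi z) + (norm \<eta>)\<^sup>2))"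
    using Laplace_of_lebesgue_integral[OF yhat_measurable[of \<eta>] yhat_nonpos[of _ \<eta>] AE_yhat[of \<eta>]] of_real_eq_0_iff by blast+
qed

lemma Laplace_yhat_0: "0 < z \<Longrightarrow> Laplace (yhat 0) z = of_real (Psi z)"
  using Laplace_yhat[of z 0] by (simp add: field_simps)

lemma AE_Y_finite: "AE t in lborel. 0 < t \<longrightarrow> finite_measure (Y t) \<and> sets (Y t) = sets borel"
proof -
  have "AE t in lebesgue_on {0<..}. finite_measure (Y t) \<and> sets (Y t) = sets borel"
    using Y by (simp add: Y_family_def)
  then have "AE t in lebesgue. t \<in> {0<..} \<longrightarrow> finite_measure (Y t) \<and> sets (Y t) = sets borel"
    by (subst (asm) AE_restrict_space_iff) auto
  then show ?thesis by (simp add: AE_completion_iff)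
qed

text \<open>At frequency 0 the Fourier transform of a measure is its mass, and the prescribed
  Laplace transform is then \<open>Psi\<close>, the same as that of \<psi>; uniqueness is applied on
  the half-line where both are known.\<close>

lemma AE_\<psi>_eq_mass: "AE t in lborel. 0 < t \<longrightarrow> \<psi> t = measure (Y t) (space (Y t))"
proof -
  obtain w where w: "w \<ge> 0" "\<And>z. z > w \<Longrightarrow> Laplace_ok z \<psi>c" "\<And>z. z > w \<Longrightarrow> Laplace \<psi>c z = of_real (Psi z)"
    using Laplace_\<psi>c_large by auto
  have "AE t in lborel. \<psi>c t = yhat 0 t"
  proof (rule Laplace_eqD[of w])
    fix z assume "z > w"
    then show "Laplace_ok z \<psi>c" "Laplace_ok z (yhat 0)" "Laplace \<psi>c z = Laplace (yhat 0) z"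
      using w Laplace_ok_yhat[of z 0] Laplace_yhat_0[of z] by auto
  qed
  with AE_yhat[of 0] AE_Y_finite show ?thesis
  proof eventually_elim
    case (elim t)
    show ?case
    proof
      assume "0 < t"
      with elim have "complex_of_real (\<psi> t) = of_real (measure (Y t) (space (Y t)))"
        by (simp add: \<psi>c_def Fourier_measure_0)
      then show "\<psi> t = measure (Y t) (space (Y t))" unfolding of_real_eq_iff .
    qed
  qed
qed

text \<open>A negative value would persist on an interval by continuity, and every interval contains
  a time at which \<psi> is the mass of a measure.\<close>

lemma \<psi>_nonneg: assumes "0 < t" shows "0 \<le> \<psi> t"
proof (rule ccontr)
  assume neg: "\<not> 0 \<le> \<psi> t"
  have "isCont \<psi> t" using \<psi>_continuous assms by (auto simp: continuous_on_eq_continuous_at)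
  then have "eventually (\<lambda>x. \<psi> x < 0) (at t)"
    using neg by (intro order_tendstoD(2)[of _ "\<psi> t"]) (auto simp: isCont_def)
  then obtain d where d: "d > 0" "\<And>x. x \<noteq> t \<Longrightarrow> dist x t < d \<Longrightarrow> \<psi> x < 0"
    unfolding eventually_at by auto
  obtain x where "t < x" "x < t + d" "0 < x \<longrightarrow> \<psi> x = measure (Y x) (space (Y x))"
    using AE_lborel_ex_in_interval[OF AE_\<psi>_eq_mass, of t "t + d"] d(1) by auto
  then show False using d(2)[of x] assms measure_nonneg[of "Y x" "space (Y x)"] by (auto simp: dist_real_def)
qed

text \<open>The transform of \<open>yhat 0\<close> exists for every positive z by definition of the
  family, and \<psi> agrees with \<open>yhat 0\<close> almost everywhere.\<close>

lemma
  assumes z: "0 < z"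
  shows Laplace_ok_\<psi>c: "Laplace_ok z \<psi>c" and Laplace_\<psi>c: "Laplace \<psi>c z = of_real (Psi z)"
proof -
  have "AE t in lborel. yhat 0 t = \<psi>c t"
    using AE_yhat[of 0] AE_Y_finite AE_\<psi>_eq_mass
  proof eventually_elim
    case (elim t)
    show ?case
      by (cases "0 < t") (use elim in \<open>auto simp: \<psi>c_def yhat_nonpos Fourier_measure_0\<close>)
  qed
  from Laplace_ok_cong_AE[OF Laplace_ok_yhat[OF z] \<psi>c_measurable \<psi>c_nonpos this] Laplace_yhat_0[OF z]
  show "Laplace_ok z \<psi>c" "Laplace \<psi>c z = of_real (Psi z)" by simp_all
qed

lemma AE_norm_yhat_le: "AE t in lborel. 0 < t \<longrightarrow> norm (yhat \<eta> t) \<le> \<psi> t"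
  using AE_yhat[of \<eta>] AE_Y_finite AE_\<psi>_eq_mass
proof eventually_elim
  case (elim t)
  then show ?case using norm_Fourier_measure_le[of "Y t" \<eta>] by auto
qed

definition zhat :: "real^'n \<Rightarrow> real \<Rightarrow> complex" where
  "zhat \<eta> t = (if 0 < t then Fourier_measure (Z t) \<eta> else 0)"

lemma zhat_nonpos: "t \<le> 0 \<Longrightarrow> zhat \<eta> t = 0"
  by (simp add: zhat_def)

lemma Z_prob: "0 < t \<Longrightarrow> prob_space (Z t)" "0 < t \<Longrightarrow> sets (Z t) = sets borel"
  using Z by (auto simp: Z_family_def)

text \<open>Weak continuity concerns real bounded continuous functions, so the exponential is split
  into cosine and sine.\<close>

lemma zhat_measurable [measurable]: "zhat \<eta> \<in> borel_measurable borel"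
proof -
  have cont: "continuous_on {0<..} (\<lambda>t. LINT x|Z t. f x)" if "continuous_on UNIV f" "bounded (range f)" for f :: "real^'n \<Rightarrow> real"
    using Z that by (auto simp: Z_family_def)
  have [measurable]: "(\<lambda>t. indicator {0<..} t *\<^sub>R (LINT x|Z t. cos (x \<bullet> \<eta>))) \<in> borel_measurable borel"
    by (intro borel_measurable_continuous_on_indicator cont) (auto intro!: continuous_intros boundedI[of _ 1])
  have [measurable]: "(\<lambda>t. indicator {0<..} t *\<^sub>R (LINT x|Z t. sin (x \<bullet> \<eta>))) \<in> borel_measurable borel"
    by (intro borel_measurable_continuous_on_indicator cont) (auto intro!: continuous_intros boundedI[of _ 1])
  have "zhat \<eta> = (\<lambda>t. of_real (indicator {0<..} t *\<^sub>R (LINT x|Z t. cos (x \<bullet> \<eta>)))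
      - \<i> * of_real (indicator {0<..} t *\<^sub>R (LINT x|Z t. sin (x \<bullet> \<eta>))))"
  proof
    fix t
    show "zhat \<eta> t = of_real (indicator {0<..} t *\<^sub>R (LINT x|Z t. cos (x \<bullet> \<eta>)))
      - \<i> * of_real (indicator {0<..} t *\<^sub>R (LINT x|Z t. sin (x \<bullet> \<eta>)))"
    proof (cases "0 < t")
      case True
      interpret prob_space "Z t" by (rule Z_prob[OF True])
      note [measurable_cong] = Z_prob(2)[OF True]
      have e: "exp (- (\<i> * complex_of_real (x \<bullet> \<eta>))) = of_real (cos (x \<bullet> \<eta>)) - \<i> * of_real (sin (x \<bullet> \<eta>))" for x
        using cis_conv_exp[of "- (x \<bullet> \<eta>)"] by (simp add: complex_eq_iff Re_exp Im_exp)
      have "integrable (Z t) (\<lambda>x. complex_of_real (cos (x \<bullet> \<eta>)))" "integrable (Z t) (\<lambda>x. complex_of_real (sin (x \<bullet> \<eta>)))"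
        by (auto intro!: integrable_const_bound[where B=1])
      then have "Fourier_measure (Z t) \<eta> = of_real (LINT x|Z t. cos (x \<bullet> \<eta>)) - \<i> * of_real (LINT x|Z t. sin (x \<bullet> \<eta>))"
        unfolding Fourier_measure_def e by simp
      then show ?thesis using True by (simp add: zhat_def)
    qed (simp add: zhat_def)
  qed
  then show ?thesis by (simp only:) measurable
qed

lemma
  assumes "0 < z"
  shows Laplace_ok_zhat: "Laplace_ok z (zhat \<eta>)"
    and Laplace_zhat: "Laplace (zhat \<eta>) z = of_real (inverse (Psi z) / (z * (inverse (Psi z) + (norm \<eta>)\<^sup>2)))"
proof -
  have "(LINT t:{0<..}|lebesgue. of_real (exp (- z * t)) * Fourier_measure (Z t) \<eta>)
      = of_real (inverse (Psi z) / (z * (inverse (Psi z) + (norm \<eta>)\<^sup>2)))"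
    using Z assms by (auto simp: Z_family_def)
  moreover have "inverse (Psi z) / (z * (inverse (Psi z) + (norm \<eta>)\<^sup>2)) \<noteq> 0"
    using Psi_pos[OF assms] assms by (simp add: add_pos_nonneg less_imp_neq[symmetric])
  moreover have "AE t in lborel. 0 < t \<longrightarrow> Fourier_measure (Z t) \<eta> = zhat \<eta> t" by (simp add: zhat_def)
  ultimately show "Laplace_ok z (zhat \<eta>)"
    "Laplace (zhat \<eta>) z = of_real (inverse (Psi z) / (z * (inverse (Psi z) + (norm \<eta>)\<^sup>2)))"
    using Laplace_of_lebesgue_integral[OF zhat_measurable zhat_nonpos, of "\<lambda>t. Fourier_measure (Z t) \<eta>" \<eta>] of_real_eq_0_iff
    by blast+
qed

text \<open>On the Laplace side, with q = |\<eta>|^2 and P = Psi z, this is (1 + q P) / (1/P + q) =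
  P.\<close>

lemma AE_resolvent_equation: "AE t in lborel. yhat \<eta> t + of_real ((norm \<eta>)\<^sup>2) * conv \<psi>c (yhat \<eta>) t = \<psi>c t"
proof (rule Laplace_eqD[of 0])
  fix z :: real assume z: "0 < z"
  note ok = Laplace_ok_yhat[OF z, of \<eta>] Laplace_ok_\<psi>c[OF z]
  show "Laplace_ok z (\<lambda>t. yhat \<eta> t + of_real ((norm \<eta>)\<^sup>2) * conv \<psi>c (yhat \<eta>) t)"
    by (intro Laplace_ok_add Laplace_ok_cmult Laplace_ok_conv ok)
  show "Laplace_ok z \<psi>c" by (rule ok)
  have "Laplace (\<lambda>t. yhat \<eta> t + of_real ((norm \<eta>)\<^sup>2) * conv \<psi>c (yhat \<eta>) t) z
     = Laplace (yhat \<eta>) z + of_real ((norm \<eta>)\<^sup>2) * (Laplace \<psi>c z * Laplace (yhat \<eta>) z)"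
    by (simp only: Laplace_add Laplace_cmult Laplace_conv Laplace_ok_cmult Laplace_ok_conv ok)
  also have "\<dots> = of_real ((1 + (norm \<eta>)\<^sup>2 * Psi z) / (inverse (Psi z) + (norm \<eta>)\<^sup>2))"
    by (simp add: Laplace_yhat[OF z] Laplace_\<psi>c[OF z] add_divide_distrib mult.commute)
  also have "(1 + (norm \<eta>)\<^sup>2 * Psi z) / (inverse (Psi z) + (norm \<eta>)\<^sup>2) = Psi z"
  proof -
    have "inverse (Psi z) + (norm \<eta>)\<^sup>2 > 0" using Psi_pos[OF z] by (simp add: add_pos_nonneg)
    then show ?thesis using Psi_pos[OF z] by (simp add: field_simps)
  qed
  finally show "Laplace (\<lambda>t. yhat \<eta> t + of_real ((norm \<eta>)\<^sup>2) * conv \<psi>c (yhat \<eta>) t) z = Laplace \<psi>c z"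
    by (simp add: Laplace_\<psi>c[OF z])
qed

section \<open>Unboundedness and strict monotonicity of \<open>K\<close> for the kernel
  \<psi>\<close>

text \<open>Since exp (- z t) <= 1, a bound on \<open>K\<close> would bound \<open>Psi z\<close>
  uniformly in z > 0, contrary to its blow-up as z tends to 0.\<close>

lemma K_unbounded: "\<exists>t>0. C < K \<psi> t"
proof (rule ccontr)
  assume "\<not> ?thesis"
  then have KC: "K \<psi> t \<le> C" if "0 < t" for t using that by (meson not_less)
  have Psi_le: "Psi z \<le> C" if z: "0 < z" for z
  proof -
    let ?f = "\<lambda>t. exp (- z * t) * (indicator {0<..} t * \<psi> t)"
    have eq: "exp (- z * t) *\<^sub>R \<psi>c t = of_real (?f t)" for t
      by (simp add: \<psi>c_def scaleR_conv_of_real)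
    have f: "integrable lborel ?f" "(LINT t|lborel. ?f t) = Psi z"
      using Laplace_ok_\<psi>c[OF z] Laplace_\<psi>c[OF z] unfolding Laplace_ok_def Laplace_def eq complex_of_real_integrable_eq
      by (simp_all flip: of_real_mult)
    have [measurable]: "?f \<in> borel_measurable lborel" using f(1) by simp
    have "(\<lambda>k. LINT t|lborel. indicator {..real k} t * ?f t) \<longlonglongrightarrow> (LINT t|lborel. ?f t)"
    proof (rule integral_dominated_convergence[where w="\<lambda>t. \<bar>?f t\<bar>"])
      show "AE t in lborel. (\<lambda>k. indicator {..real k} t * ?f t) \<longlonglongrightarrow> ?f t"
      proof (intro AE_I2 tendsto_eventually)
        fix t
        have "eventually (\<lambda>k. t \<le> real k) sequentially"
          using filterlim_real_sequentially unfolding filterlim_at_top by blast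
        then show "eventually (\<lambda>k. indicator {..real k} t * ?f t = ?f t) sequentially"
          by eventually_elim simp
      qed
      show "AE t in lborel. norm (indicator {..real k} t * ?f t) \<le> \<bar>?f t\<bar>" for k
        by (auto simp: indicator_def)
    qed (use f in auto)
    moreover have "(LINT t|lborel. indicator {..real k} t * ?f t) \<le> C" if "0 < k" for k
    proof -
      have k: "0 < real k" using that by simp
      have "(LINT t|lborel. indicator {..real k} t * ?f t) \<le> K \<psi> (real k)"
        unfolding K_alt
      proof (rule integral_mono)
        show "integrable lborel (\<lambda>t. indicator {..real k} t * ?f t)"
          using integrable_real_mult_indicator[of "{..real k}" lborel ?f] f by (simp add: mult.commute)
        show "integrable lborel (\<lambda>t. indicator {0<..real k} t * \<psi> t)"
          using \<psi>_integrable[OF k] by (simp add: set_integrable_def)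
        show "indicator {..real k} t * ?f t \<le> indicator {0<..real k} t * \<psi> t" for t
          using \<psi>_nonneg[of t] z by (auto simp: indicator_def intro!: mult_left_le_one_le)
      qed
      then show ?thesis using KC[OF k] by simp
    qed
    ultimately have "(LINT t|lborel. ?f t) \<le> C"
      by (intro tendsto_upperbound) (auto intro: eventually_sequentiallyI[of 1])
    then show ?thesis using f by simp
  qed
  define a where "a = min \<alpha>1 \<alpha>2"
  have a: "a > 0" using pos by (simp add: a_def)
  \<comment> \<open>Solves z^(-a) = max 1 (C + 1), which exceeds C; the maximum with 1 keeps z <= 1,
    as \<open>Psi_ge\<close> demands.\<close>
  define z where "z = (max 1 (C + 1)) powr (- 1 / a)"
  have z: "0 < z" by (simp add: z_def)
  have "z \<le> max 1 (C + 1) powr 0" unfolding z_def using a by (intro powr_mono) auto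
  then have "z \<le> 1" by (simp split: if_splits)
  have "z powr (- a) = max 1 (C + 1)" using a by (simp add: z_def powr_powr)
  then show False using Psi_le[OF z] Psi_ge[OF z \<open>z \<le> 1\<close>] by (simp add: a_def)
qed

lemma \<psi>_pos_nbhd:
  assumes "0 < s" "0 < \<psi> s"
  obtains d where "0 < d" "\<And>x. \<bar>x - s\<bar> < d \<Longrightarrow> 0 < x \<and> 0 < \<psi> x"
proof -
  have "isCont \<psi> s" using \<psi>_continuous assms by (auto simp: continuous_on_eq_continuous_at)
  then have "eventually (\<lambda>x. 0 < \<psi> x) (at s)"
    using assms by (intro order_tendstoD(1)[of _ "\<psi> s"]) (auto simp: isCont_def)
  then obtain d where d: "d > 0" "\<And>x. x \<noteq> s \<Longrightarrow> dist x s < d \<Longrightarrow> 0 < \<psi> x"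
    unfolding eventually_at by auto
  show ?thesis
  proof (rule that[of "min d s"])
    fix x assume "\<bar>x - s\<bar> < min d s"
    then show "0 < x \<and> 0 < \<psi> x" using d(2)[of x] assms by (cases "x = s") (auto simp: dist_real_def)
  qed (use d assms in auto)
qed

text \<open>The exceptional null set of \<open>AE_yhat\<close> depends on the frequency, so only
  countably many frequencies can be treated at once.\<close>

lemma AE_yhat_tendsto:
  assumes "\<eta> \<longlonglongrightarrow> 0"
  shows "AE t in lborel. (\<lambda>k::nat. yhat (\<eta> k) t) \<longlonglongrightarrow> \<psi>c t"
proof -
  have "AE t in lborel. \<forall>k. 0 < t \<longrightarrow> Fourier_measure (Y t) (\<eta> k) = yhat (\<eta> k) t"
    unfolding AE_all_countable using AE_yhat by blast
  with AE_Y_finite AE_\<psi>_eq_mass show ?thesis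
  proof eventually_elim
    case (elim t)
    show ?case
    proof (cases "0 < t")
      case True
      have "isCont (Fourier_measure (Y t)) 0" using elim True by (intro isCont_Fourier_measure) auto
      then have "(\<lambda>k. Fourier_measure (Y t) (\<eta> k)) \<longlonglongrightarrow> Fourier_measure (Y t) 0"
        using assms by (rule isCont_tendsto_compose)
      then show ?thesis using elim True by (simp add: \<psi>c_def Fourier_measure_0)
    qed (simp add: \<psi>c_def yhat_nonpos)
  qed
qed

text \<open>On a gap of \<open>\<psi>\<close> the kernels \<open>yhat \<eta>\<close> vanish as well, being dominated by \<open>\<psi>\<close>; then the
  resolvent equation makes \<open>\<psi> * yhat \<eta>\<close> vanish there, and \<open>\<eta> \<rightarrow> 0\<close>.\<close>

lemma conv_\<psi>c_vanishes_on_gap: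
  assumes gap: "\<And>t. a < t \<Longrightarrow> t < b \<Longrightarrow> \<psi> t = 0" and a: "0 \<le> a"
  shows "AE t in lborel. a < t \<and> t < b \<longrightarrow> integrable lborel (\<lambda>s. \<psi>c (t - s) * \<psi>c s) \<and> conv \<psi>c \<psi>c t = 0"
proof -
  \<comment> \<open>Nonzero frequencies tending to 0 along an arbitrary coordinate axis; they must
    be nonzero because the resolvent equation is divided by |\<eta>|^2.\<close>
  define \<eta> :: "nat \<Rightarrow> real^'n" where "\<eta> k = inverse (real (Suc k)) *\<^sub>R axis undefined 1" for k
  have \<eta>0: "\<eta> k \<noteq> 0" for k by (simp add: \<eta>_def axis_eq_0_iff del: of_nat_Suc)
  have "\<eta> \<longlonglongrightarrow> 0 *\<^sub>R axis undefined 1"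
    unfolding \<eta>_def by (intro tendsto_scaleR LIMSEQ_inverse_real_of_nat tendsto_const)
  then have \<eta>lim: "\<eta> \<longlonglongrightarrow> 0" by simp
  have bound: "AE t in lborel. \<forall>k. norm (yhat (\<eta> k) t) \<le> norm (\<psi>c t)"
  proof -
    have "AE t in lborel. \<forall>k. 0 < t \<longrightarrow> norm (yhat (\<eta> k) t) \<le> \<psi> t"
      unfolding AE_all_countable using AE_norm_yhat_le by blast
    then show ?thesis
    proof eventually_elim
      case (elim t)
      then show ?case by (cases "0 < t") (auto simp: \<psi>c_def yhat_nonpos \<psi>_nonneg)
    qed
  qed
  have "AE t in lborel. \<forall>k. yhat (\<eta> k) t + of_real ((norm (\<eta> k))\<^sup>2) * conv \<psi>c (yhat (\<eta> k)) t = \<psi>c t"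
    unfolding AE_all_countable using AE_resolvent_equation by blast
  with bound AE_integrable_conv_Laplace[OF Laplace_ok_\<psi>c[OF zero_less_one] Laplace_ok_\<psi>c[OF zero_less_one]]
  show ?thesis
  proof eventually_elim
    case (elim t)
    show ?case
    proof
      assume t: "a < t \<and> t < b"
      then have "\<psi>c t = 0" using gap[of t] by (simp add: \<psi>c_def)
      then have 0: "conv \<psi>c (yhat (\<eta> k)) t = 0" for k
        using elim(1,3)[rule_format, of k] \<eta>0[of k] by simp
      have "(\<lambda>k. conv \<psi>c (yhat (\<eta> k)) t) \<longlonglongrightarrow> conv \<psi>c \<psi>c t"
        unfolding conv_def
      proof (rule integral_dominated_convergence[where w="\<lambda>s. norm (\<psi>c (t - s) * \<psi>c s)"])
        show "AE s in lborel. (\<lambda>k. \<psi>c (t - s) * yhat (\<eta> k) s) \<longlonglongrightarrow> \<psi>c (t - s) * \<psi>c s"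
          using AE_yhat_tendsto[OF \<eta>lim] by eventually_elim (intro tendsto_intros)
        show "AE s in lborel. norm (\<psi>c (t - s) * yhat (\<eta> k) s) \<le> norm (\<psi>c (t - s) * \<psi>c s)" for k
          using bound by eventually_elim (simp add: norm_mult mult_left_mono)
      qed (use elim(2) in auto)
      then have "conv \<psi>c \<psi>c t = 0" by (simp add: 0 LIMSEQ_const_iff)
      with elim(2) show "integrable lborel (\<lambda>s. \<psi>c (t - s) * \<psi>c s) \<and> conv \<psi>c \<psi>c t = 0" by simp
    qed
  qed
qed

lemma \<psi>_pos_ex:
  assumes Kpos: "\<And>t. 0 < t \<Longrightarrow> 0 < K \<psi> t" and b: "0 < b"
  shows "\<exists>s. 0 < s \<and> s < b \<and> 0 < \<psi> s"
proof (rule ccontr)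
  assume "\<not> ?thesis"
  then have "\<psi> s = 0" if "0 < s" "s < b" for s using that \<psi>_nonneg[of s] by force
  then have "(\<lambda>s. indicator {0<..b / 2} s * \<psi> s) = (\<lambda>_. 0)" using b by (auto simp: indicator_def)
  then have "K \<psi> (b / 2) = 0" by (simp add: K_alt)
  then show False using Kpos[of "b / 2"] b by simp
qed

text \<open>If (a,b) were a gap, let \<open>m\<close> be the supremum of the points below
  \<open>b\<close> at which \<psi> is positive. Positivity of \<open>K\<close> near 0 gives positive
  values of \<psi> at arbitrarily small s'; adding such an s' to a point s of positivity close below
  \<open>m\<close> lands in the gap (m,b), where \<psi> * \<psi> is known to vanish.\<close>

lemma \<psi>_pos_in_interval:
  assumes Kpos: "\<And>t. 0 < t \<Longrightarrow> 0 < K \<psi> t" and ab: "0 \<le> a" "a < b"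
  shows "\<exists>s\<in>{a<..<b}. 0 < \<psi> s"
proof (rule ccontr)
  assume no: "\<not> ?thesis"
  define P where "P = {x. 0 < x \<and> x < b \<and> 0 < \<psi> x}"
  define m where "m = Sup P"
  have P0: "P \<noteq> {}" using \<psi>_pos_ex[OF Kpos, of b] ab by (auto simp: P_def)
  have Pa: "x \<le> a" if "x \<in> P" for x using that no by (force simp: P_def)
  have bdd: "bdd_above P" using Pa by (rule bdd_aboveI)
  have "m \<le> a" unfolding m_def using P0 Pa by (rule cSup_least)
  have "0 < m" using P0 cSup_upper[OF _ bdd] unfolding m_def P_def by fastforce
  have gap: "\<psi> t = 0" if "m < t" "t < b" for t
    using cSup_upper[OF _ bdd, of t] that \<psi>_nonneg[of t] \<open>0 < m\<close> unfolding m_def P_def by force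
  obtain s' where s': "0 < s'" "s' < b - m" "0 < \<psi> s'"
    using \<psi>_pos_ex[OF Kpos, of "b - m"] ab \<open>m \<le> a\<close> by auto
  \<comment> \<open>Closer to \<open>m\<close> than s', so that s + s' > m; s <= m and s' < b - m
    give s + s' < b.\<close>
  obtain s where "s \<in> P" "m - s' < s"
    using less_cSup_iff[OF P0 bdd, of "m - s'"] s' by (auto simp: m_def)
  then have s: "0 < s" "0 < \<psi> s" "s \<le> m" "m < s + s'"
    using cSup_upper[OF _ bdd, of s] by (auto simp: P_def m_def)
  obtain d where d: "0 < d" "\<And>x. \<bar>x - s\<bar> < d \<Longrightarrow> 0 < x \<and> 0 < \<psi> x"
    using \<psi>_pos_nbhd s by blast
  obtain d' where d': "0 < d'" "\<And>x. \<bar>x - s'\<bar> < d' \<Longrightarrow> 0 < x \<and> 0 < \<psi> x"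
    using \<psi>_pos_nbhd s' by blast
  \<comment> \<open>If t is within e of s + s' and r within e of s, then t - r is within 2 e <= d'
    of s', so both factors of the convolution integrand are positive.\<close>
  define e where "e = min d (d' / 2)"
  have e: "0 < e" using d d' by (simp add: e_def)
  \<comment> \<open>The vanishing of \<psi> * \<psi> holds almost everywhere only, so
    \<open>t\<close> is picked from an interval around s + s' cut down to the gap.\<close>
  have "max m (s + s' - e) < min b (s + s' + e)" using s s' e by auto
  moreover have "AE t in lborel. m < t \<and> t < b \<longrightarrow> integrable lborel (\<lambda>r. \<psi>c (t - r) * \<psi>c r) \<and> conv \<psi>c \<psi>c t = 0"
    by (rule conv_\<psi>c_vanishes_on_gap) (use gap \<open>0 < m\<close> in auto)
  ultimately obtain t where "max m (s + s' - e) < t" "t < min b (s + s' + e)"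
    and conv_t: "m < t \<and> t < b \<longrightarrow> integrable lborel (\<lambda>r. \<psi>c (t - r) * \<psi>c r) \<and> conv \<psi>c \<psi>c t = 0"
    using AE_lborel_ex_in_interval by blast
  then have t: "m < t" "t < b" "\<bar>t - (s + s')\<bar> < e" by (auto simp: abs_less_iff)
  then have conv0: "integrable lborel (\<lambda>r. \<psi>c (t - r) * \<psi>c r)" "conv \<psi>c \<psi>c t = 0" using conv_t by auto
  let ?g = "\<lambda>r. indicator {0<..} (t - r) * \<psi> (t - r) * (indicator {0<..} r * \<psi> r)"
  have eq: "\<psi>c (t - r) * \<psi>c r = of_real (?g r)" for r by (simp add: \<psi>c_def)
  have g: "integrable lborel ?g" using conv0(1) unfolding eq complex_of_real_integrable_eq .
  have g_nonneg: "0 \<le> ?g r" for r using \<psi>_nonneg by (auto simp: indicator_def)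
  have "complex_of_real (LINT r|lborel. ?g r) = 0"
    using conv0(2) unfolding conv_def eq integral_complex_of_real .
  then have "(LINT r|lborel. ?g r) = 0" unfolding of_real_eq_0_iff .
  then have "AE r in lborel. ?g r = 0"
    by (subst (asm) integral_nonneg_eq_0_iff_AE[OF g]) (use g_nonneg in auto)
  then obtain r where r: "s - e < r" "r < s + e" "?g r = 0"
    using AE_lborel_ex_in_interval[of _ "s - e" "s + e"] e by auto
  have "0 < r \<and> 0 < \<psi> r" using r by (intro d) (auto simp: e_def)
  moreover have "0 < t - r \<and> 0 < \<psi> (t - r)"
  proof (rule d')
    have "e \<le> d' / 2" by (simp add: e_def)
    then show "\<bar>t - r - s'\<bar> < d'" using r(1,2) t(3) unfolding abs_less_iff by linarith
  qed
  ultimately show False using r(3) by simp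
qed

lemma K_strict_increasing:
  assumes Kpos: "\<And>t. 0 < t \<Longrightarrow> 0 < K \<psi> t" and ab: "0 \<le> a" "a < b"
  shows "K \<psi> a < K \<psi> b"
  using \<psi>_pos_in_interval[OF assms] K_strict_mono[OF \<psi>_continuous \<psi>_nonneg \<psi>_integrable ab] by blast

end

section \<open>The equation for a single frequency\<close>

lemma continuous_eq_if_AE_eq:
  fixes f g :: "real \<Rightarrow> 'b::t2_space"
  assumes f: "continuous_on {0..T} f" and g: "continuous_on {0..T} g" and T: "0 < T"
    and eq: "AE t in lborel. 0 < t \<and> t < T \<longrightarrow> f t = g t"
    and t: "t \<in> {0..T}"
  shows "f t = g t"
proof -
  have "\<exists>x. 0 < x \<and> x < T \<and> \<bar>x - t\<bar> < inverse (Suc k) \<and> f x = g x" for k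
  proof -
    have "max 0 (t - e) < min T (t + e)" if "0 < e" for e using t T that by auto
    from this[of "inverse (Suc k)"]
    have "max 0 (t - inverse (Suc k)) < min T (t + inverse (Suc k))" by (simp del: of_nat_Suc max_less_iff_conj min_less_iff_conj)
    from AE_lborel_ex_in_interval[OF eq this] show ?thesis by (auto simp: abs_less_iff)
  qed
  then obtain X where X: "\<And>k. 0 < X k \<and> X k < T \<and> \<bar>X k - t\<bar> < inverse (Suc k) \<and> f (X k) = g (X k)" by metis
  have "(\<lambda>k. X k - t) \<longlonglongrightarrow> 0"
  proof (rule Lim_null_comparison[OF always_eventually LIMSEQ_inverse_real_of_nat])
    show "\<forall>k. norm (X k - t) \<le> inverse (real (Suc k))"
    proof
      fix k show "norm (X k - t) \<le> inverse (real (Suc k))" using X[of k] by simp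
    qed
  qed
  then have lim: "X \<longlonglongrightarrow> t" by (rule Lim_null[THEN iffD2])
  have inT: "X k \<in> {0..T}" for k using X[of k] by auto
  have "(\<lambda>k. f (X k)) \<longlonglongrightarrow> f t" "(\<lambda>k. g (X k)) \<longlonglongrightarrow> g t"
    using continuous_on_tendsto_compose[OF f lim t] continuous_on_tendsto_compose[OF g lim t] inT by auto
  moreover have "(\<lambda>k. f (X k)) = (\<lambda>k. g (X k))" using X by simp
  ultimately show ?thesis using LIMSEQ_unique by metis
qed

lemma AE_lborel_reflect:
  assumes "AE x in lborel. P x"
  shows "AE s in lborel. P (t - s :: real)"
proof -
  obtain N where N: "{x \<in> space lborel. \<not> P x} \<subseteq> N" "emeasure lborel N = 0" "N \<in> sets lborel"
    using assms by (rule AE_E)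
  have "AE x in lborel. x \<notin> N"
    by (rule AE_not_in) (use N in auto)
  then have "AE s in lborel. t + (- 1) * s \<notin> N"
    using N(3) by (intro AE_borel_affine) auto
  then show ?thesis
    by eventually_elim (use N in auto)
qed

context resolvents
begin

text \<open>The function \<open>V\<close> in the proof extends \<open>v\<close> beyond \<open>T\<close> so that it has a Laplace transform;
  \<open>zhat 0\<close> serves as the Heaviside function.\<close>

lemma scalar_equation:
  fixes v g :: "real \<Rightarrow> complex"
  assumes v: "continuous_on {0..T} v" and g: "continuous_on {0..T} g" and T: "0 < T"
    and eq: "\<And>t. 0 < t \<Longrightarrow> t < T \<Longrightarrow>
      v t = a * zhat \<eta> t + (LINT s|lborel. indicator {0<..<t} s *\<^sub>R (yhat \<eta> (t - s) * g s))"
    and t: "t \<in> {0..T}"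
  shows "v t + of_real ((norm \<eta>)\<^sup>2) * Volterra \<psi> v t = a + Volterra \<psi> g t"
proof -
  \<comment> \<open>The cutoff makes the source bounded with bounded support, so its transform
    exists for every z > 0; by causality the convolution is unchanged before T.\<close>
  define gT where "gT s = indicator {0<..<T} s *\<^sub>R g s" for s
  have gT_meas[measurable]: "gT \<in> borel_measurable borel"
    unfolding gT_def[abs_def]
    by (intro borel_measurable_continuous_on_indicator continuous_on_subset[OF g]) auto
  obtain C where C: "0 \<le> C" "\<And>t. t \<in> {0..T} \<Longrightarrow> norm (g t) \<le> C"
    using continuous_on_interval_bounded[OF g] by blast
  have gT_ok: "Laplace_ok z gT" if z: "0 < z" for z
    unfolding Laplace_ok_def
  proof (intro conjI allI impI gT_meas)
    show "gT s = 0" if "s \<le> 0" for s using that by (simp add: gT_def)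
    show "integrable lborel (\<lambda>s. exp (- z * s) *\<^sub>R gT s)"
    proof (rule Bochner_Integration.integrable_bound)
      show "integrable lborel (\<lambda>s. C * indicator {0<..<T} s)" using T by (simp add: integrable_indicator_iff)
      show "AE s in lborel. norm (exp (- z * s) *\<^sub>R gT s) \<le> norm (C * indicator {0<..<T} s)"
        using C z by (auto simp: gT_def indicator_def intro!: mult_le_one order_trans[OF mult_left_le_one_le])
    qed measurable
  qed
  have one: "zhat 0 s = 1" if "0 < s" for s
    using that prob_space.prob_space[OF Z_prob(1)[OF that]]
    by (simp add: zhat_def Fourier_measure_0 prob_space.finite_measure[OF Z_prob(1)[OF that]])
  have L_one: "Laplace (zhat 0) z = of_real (1 / z)" if "0 < z" for z
    unfolding Laplace_zhat[OF that] using Psi_pos[OF that] by (simp add: field_simps)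
  define V where "V s = a * zhat \<eta> s + conv (yhat \<eta>) gT s" for s
  have V_ok: "Laplace_ok z V" if z: "0 < z" for z
    unfolding V_def by (intro Laplace_ok_add Laplace_ok_cmult Laplace_ok_conv Laplace_ok_zhat Laplace_ok_yhat gT_ok z)
  have V0: "V s = 0" if "s \<le> 0" for s using V_ok[of 1] that by (simp add: Laplace_ok_def)
  have V_eq: "V s = v s" if s: "0 < s" "s < T" for s
  proof -
    have "yhat \<eta> (s - r) * gT r = indicator {0<..<s} r *\<^sub>R (yhat \<eta> (s - r) * g r)" for r
      using s by (auto simp: gT_def indicator_def yhat_nonpos)
    then show ?thesis using eq[OF s] by (simp add: V_def conv_def)
  qed
  have "AE s in lborel. V s + of_real ((norm \<eta>)\<^sup>2) * conv \<psi>c V s = a * zhat 0 s + conv \<psi>c gT s"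
  proof (rule Laplace_eqD[of 0])
    fix z :: real assume z: "0 < z"
    note ok = V_ok[OF z] Laplace_ok_\<psi>c[OF z] gT_ok[OF z] Laplace_ok_zhat[OF z] Laplace_ok_yhat[OF z]
      Laplace_ok_cmult Laplace_ok_conv Laplace_ok_add
    show "Laplace_ok z (\<lambda>s. V s + of_real ((norm \<eta>)\<^sup>2) * conv \<psi>c V s)"
      "Laplace_ok z (\<lambda>s. a * zhat 0 s + conv \<psi>c gT s)"
      by (intro ok)+
    define P where "P = Psi z"
    define q where "q = (norm \<eta>)\<^sup>2"
    have P: "0 < P" "0 \<le> q" using Psi_pos[OF z] by (simp_all add: P_def q_def)
    define G where "G = Laplace gT z"
    have LV: "Laplace V z = a * of_real (inverse P / (z * (inverse P + q))) + of_real (1 / (inverse P + q)) * G"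
      unfolding V_def G_def P_def q_def
      by (simp only: Laplace_add Laplace_cmult Laplace_conv ok Laplace_zhat[OF z] Laplace_yhat[OF z])
    \<comment> \<open>Multiplication by 1 + q P is what the left-hand operator does in transforms;
      it takes the symbol of \<open>zhat \<eta>\<close> to 1 / z, the transform of the constant 1,
      and that of \<open>yhat \<eta>\<close> to P.\<close>
    have "Laplace (\<lambda>s. V s + of_real q * conv \<psi>c V s) z = (1 + of_real q * of_real P) * Laplace V z"
      by (simp only: Laplace_add Laplace_cmult Laplace_conv ok Laplace_\<psi>c[OF z] P_def) (simp add: distrib_right)
    also have "\<dots> = a * of_real ((1 + q * P) * (inverse P / (z * (inverse P + q)))) + of_real ((1 + q * P) / (inverse P + q)) * G"
      unfolding LV by (simp add: distrib_left mult_ac add_divide_distrib)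
    also have "(1 + q * P) * (inverse P / (z * (inverse P + q))) = 1 / z" (is "?A = _")
    proof -
      have "inverse P + q > 0" using P by (simp add: add_pos_nonneg)
      moreover have "(1 + q * P) * inverse P = inverse P + q" using P by (simp add: field_simps)
      moreover have "?A = ((1 + q * P) * inverse P) / (z * (inverse P + q))" by (rule times_divide_eq_right)
      ultimately show ?thesis using z by simp
    qed
    also have "(1 + q * P) / (inverse P + q) = P"
    proof -
      have "inverse P + q > 0" using P by (simp add: add_pos_nonneg)
      then show ?thesis using P by (simp add: field_simps)
    qed
    also have "a * of_real (1 / z) + of_real P * G = Laplace (\<lambda>s. a * zhat 0 s + conv \<psi>c gT s) z"
      unfolding G_def P_def by (simp only: Laplace_add Laplace_cmult Laplace_conv ok Laplace_\<psi>c[OF z] L_one[OF z])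
    finally show "Laplace (\<lambda>s. V s + of_real ((norm \<eta>)\<^sup>2) * conv \<psi>c V s) z = Laplace (\<lambda>s. a * zhat 0 s + conv \<psi>c gT s) z"
      by (simp add: q_def)
  qed
  then have ae: "AE s in lborel. 0 < s \<and> s < T \<longrightarrow>
     v s + of_real ((norm \<eta>)\<^sup>2) * Volterra \<psi> v s = a + Volterra \<psi> g s"
  proof eventually_elim
    case (elim s)
    show ?case
    proof
      assume s: "0 < s \<and> s < T"
      have "\<psi>c (s - r) * V r = (indicator {0<..<s} r * \<psi> (s - r)) *\<^sub>R v r" for r
        using s V0[of r] V_eq[of r] by (auto simp: \<psi>c_def indicator_def scaleR_conv_of_real)
      then have 1: "conv \<psi>c V s = Volterra \<psi> v s" by (simp add: conv_def Volterra_def)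
      have "\<psi>c (s - r) * gT r = (indicator {0<..<s} r * \<psi> (s - r)) *\<^sub>R g r" for r
        using s by (auto simp: \<psi>c_def gT_def indicator_def scaleR_conv_of_real)
      then have 2: "conv \<psi>c gT s = Volterra \<psi> g s" by (simp add: conv_def Volterra_def)
      show "v s + of_real ((norm \<eta>)\<^sup>2) * Volterra \<psi> v s = a + Volterra \<psi> g s"
        using elim s V_eq[of s] one[of s] unfolding 1 2 by simp
    qed
  qed
  \<comment> \<open>Both sides are continuous on [0,T], which restores the exceptional times and the
    end points.\<close>
  show ?thesis
    by (rule continuous_eq_if_AE_eq[OF _ _ T ae t])
      (intro continuous_on_add continuous_on_mult continuous_on_const v Volterra_continuous \<psi>_integrable g T; assumption)+
qed

end

section \<open>Integration over frequencies\<close>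

text \<open>The multiplication formula: by Fubini the frequency weight is transferred to the test
  function as its Fourier transform.\<close>

lemma integral_fourier:
  fixes \<Gamma> :: "real^'n \<Rightarrow> real"
  assumes \<Gamma>: "integrable lborel \<Gamma>" and f: "integrable lborel f"
  shows "(LINT \<eta>|lborel. \<Gamma> \<eta> *\<^sub>R fourier f \<eta>) = pairing f (\<lambda>x. LINT \<eta>|lborel. \<Gamma> \<eta> *\<^sub>R expi \<eta> x)"
proof -
  have [measurable]: "\<Gamma> \<in> borel_measurable borel" "f \<in> borel_measurable borel" using \<Gamma> f by auto
  have *: "integrable (lborel \<Otimes>\<^sub>M lborel) (\<lambda>(\<eta>, x). \<Gamma> \<eta> *\<^sub>R (complex_of_real (f x) * expi \<eta> x))"
  proof (rule lborel_pair.Fubini_integrable)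
    show "integrable lborel (\<lambda>\<eta>. LINT x|lborel. norm (case (\<eta>, x) of (\<eta>, x) \<Rightarrow> \<Gamma> \<eta> *\<^sub>R (complex_of_real (f x) * expi \<eta> x)))"
      using \<Gamma> by (simp add: norm_mult)
    show "AE \<eta> in lborel. integrable lborel (\<lambda>x. case (\<eta>, x) of (\<eta>, x) \<Rightarrow> \<Gamma> \<eta> *\<^sub>R (complex_of_real (f x) * expi \<eta> x))"
      using integrable_pairing[OF f, of "expi _" 1] by simp
  qed measurable
  have "(LINT \<eta>|lborel. \<Gamma> \<eta> *\<^sub>R fourier f \<eta>) = (LINT \<eta>|lborel. LINT x|lborel. \<Gamma> \<eta> *\<^sub>R (complex_of_real (f x) * expi \<eta> x))"
    by (simp add: pairing_def)
  also have "\<dots> = (LINT x|lborel. LINT \<eta>|lborel. \<Gamma> \<eta> *\<^sub>R (complex_of_real (f x) * expi \<eta> x))"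
    using lborel_pair.Fubini_integral[OF *] by simp
  also have "\<dots> = pairing f (\<lambda>x. LINT \<eta>|lborel. \<Gamma> \<eta> *\<^sub>R expi \<eta> x)"
    unfolding pairing_def by (simp flip: mult_scaleR_right)
  finally show ?thesis .
qed

lemma
  fixes \<Gamma> :: "real^'n \<Rightarrow> real"
  assumes \<Gamma>: "integrable lborel \<Gamma>" and w: "L1_curve T w" and t: "t \<in> {0..T}"
    and \<psi>: "\<And>t. 0 < t \<Longrightarrow> set_integrable lborel {0<..t} \<psi>"
  shows integral_Volterra_fourier: "(LINT \<eta>|lborel. \<Gamma> \<eta> *\<^sub>R Volterra \<psi> (\<lambda>s. fourier (w s) \<eta>) t)
      = Volterra \<psi> (\<lambda>s. LINT \<eta>|lborel. \<Gamma> \<eta> *\<^sub>R fourier (w s) \<eta>) t"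
    and integrable_Volterra_fourier: "integrable lborel (\<lambda>\<eta>. \<Gamma> \<eta> *\<^sub>R Volterra \<psi> (\<lambda>s. fourier (w s) \<eta>) t)"
proof -
  have [measurable]: "\<Gamma> \<in> borel_measurable borel" using \<Gamma> by auto
  have T: "0 \<le> T" using t by auto
  define k where "k s = indicator {0<..<t} s * \<psi> (t - s)" for s
  have k: "integrable lborel k" unfolding k_def[abs_def] by (rule kernel_integrable[OF \<psi>])
  then have [measurable]: "k \<in> borel_measurable borel" by auto
  \<comment> \<open>Clamping time to [0,T] makes the transform bounded and jointly continuous on the
    whole product space; the kernel vanishes off (0,t), so the integrand stays the same.\<close>
  define cl where "cl s = max 0 (min T s)" for s
  have cl: "cl s \<in> {0..T}" for s using T by (auto simp: cl_def)
  obtain C where C: "\<And>s. s \<in> {0..T} \<Longrightarrow> (LINT x|lborel. \<bar>w s x\<bar>) \<le> C"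
    using L1_curve_bounded[OF w] by blast
  define H where "H s \<eta> = fourier (w (cl s)) \<eta>" for s \<eta>
  have HC: "norm (H s \<eta>) \<le> C" for s \<eta>
    unfolding H_def using norm_fourier_le[OF L1_curve_integrable[OF w cl]] C[OF cl] order_trans by blast
  have "continuous_on UNIV (\<lambda>z. (\<lambda>(s, \<eta>). fourier (w s) \<eta>) (cl (fst z), snd z))"
    by (rule continuous_on_compose2[OF continuous_on_fourier_L1_curve[OF w]])
       (use cl in \<open>auto intro!: continuous_intros simp: cl_def\<close>)
  then have "(\<lambda>z. H (fst z) (snd z)) \<in> borel_measurable borel"
    unfolding H_def by (intro borel_measurable_continuous_onI) simp
  then have [measurable]: "(\<lambda>z. H (fst z) (snd z)) \<in> borel_measurable (lborel \<Otimes>\<^sub>M lborel)"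
    by (simp add: lborel_prod)
  have swap[measurable]: "(\<lambda>z. H (snd z) (fst z)) \<in> borel_measurable (lborel \<Otimes>\<^sub>M lborel)"
    using measurable_compose[OF measurable_pair_swap' \<open>(\<lambda>z. H (fst z) (snd z)) \<in> borel_measurable (lborel \<Otimes>\<^sub>M lborel)\<close>]
    by (simp add: case_prod_beta')
  have eq: "k s *\<^sub>R fourier (w s) \<eta> = k s *\<^sub>R H s \<eta>" for s \<eta>
    using t by (auto simp: k_def H_def cl_def indicator_def min_def max_def)
  have *: "integrable (lborel \<Otimes>\<^sub>M lborel) (\<lambda>(\<eta>, s). \<Gamma> \<eta> *\<^sub>R (k s *\<^sub>R H s \<eta>))"
  proof (rule lborel_pair.Fubini_integrable)
    show meas: "(\<lambda>(\<eta>, s). \<Gamma> \<eta> *\<^sub>R (k s *\<^sub>R H s \<eta>)) \<in> borel_measurable (lborel \<Otimes>\<^sub>M lborel)"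
      unfolding case_prod_beta' by measurable
    have mH: "(\<lambda>s. H s \<eta>) \<in> borel_measurable lborel" for \<eta>
      using measurable_compose[OF measurable_Pair1' swap, of \<eta>] by simp
    have i: "integrable lborel (\<lambda>s. k s *\<^sub>R H s \<eta>)" for \<eta>
    proof (rule Bochner_Integration.integrable_bound[OF integrable_mult_right[OF k, of C]])
      show "(\<lambda>s. k s *\<^sub>R H s \<eta>) \<in> borel_measurable lborel" using mH[of \<eta>] by measurable
      show "AE s in lborel. norm (k s *\<^sub>R H s \<eta>) \<le> norm (C * k s)"
        using HC by (auto simp: abs_mult mult.commute[of "\<bar>C\<bar>"] intro!: mult_left_mono order_trans[OF HC])
    qed
    show "AE \<eta> in lborel. integrable lborel (\<lambda>s. case (\<eta>, s) of (\<eta>, s) \<Rightarrow> \<Gamma> \<eta> *\<^sub>R (k s *\<^sub>R H s \<eta>))"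
      unfolding prod.case by (intro AE_I2 integrable_scaleR_right i)
    show "integrable lborel (\<lambda>\<eta>. LINT s|lborel. norm (case (\<eta>, s) of (\<eta>, s) \<Rightarrow> \<Gamma> \<eta> *\<^sub>R (k s *\<^sub>R H s \<eta>)))"
    proof (rule Bochner_Integration.integrable_bound)
      show "integrable lborel (\<lambda>\<eta>. \<bar>\<Gamma> \<eta>\<bar> * (C * (LINT s|lborel. \<bar>k s\<bar>)))" using \<Gamma> by simp
      show "(\<lambda>\<eta>. LINT s|lborel. norm (case (\<eta>, s) of (\<eta>, s) \<Rightarrow> \<Gamma> \<eta> *\<^sub>R (k s *\<^sub>R H s \<eta>))) \<in> borel_measurable lborel"
        using meas by (intro lborel.borel_measurable_lebesgue_integral) measurable
      show "AE \<eta> in lborel. norm (LINT s|lborel. norm (case (\<eta>, s) of (\<eta>, s) \<Rightarrow> \<Gamma> \<eta> *\<^sub>R (k s *\<^sub>R H s \<eta>)))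
         \<le> norm (\<bar>\<Gamma> \<eta>\<bar> * (C * (LINT s|lborel. \<bar>k s\<bar>)))"
      proof (intro AE_I2)
        fix \<eta>
        have "(LINT s|lborel. \<bar>k s\<bar> * norm (H s \<eta>)) \<le> (LINT s|lborel. C * \<bar>k s\<bar>)"
        proof (rule integral_mono)
          show "integrable lborel (\<lambda>s. \<bar>k s\<bar> * norm (H s \<eta>))" using integrable_norm[OF i[of \<eta>]] by simp
          show "integrable lborel (\<lambda>s. C * \<bar>k s\<bar>)" using k by simp
          show "\<bar>k s\<bar> * norm (H s \<eta>) \<le> C * \<bar>k s\<bar>" for s
            using mult_left_mono[OF HC[of s \<eta>], of "\<bar>k s\<bar>"] by (simp add: mult.commute)
        qed
        then have "\<bar>\<Gamma> \<eta>\<bar> * (LINT s|lborel. \<bar>k s\<bar> * norm (H s \<eta>)) \<le> \<bar>\<Gamma> \<eta>\<bar> * (C * (LINT s|lborel. \<bar>k s\<bar>))"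
          by (intro mult_left_mono) simp_all
        moreover have "(LINT s|lborel. norm (case (\<eta>, s) of (\<eta>, s) \<Rightarrow> \<Gamma> \<eta> *\<^sub>R (k s *\<^sub>R H s \<eta>)))
            = \<bar>\<Gamma> \<eta>\<bar> * (LINT s|lborel. \<bar>k s\<bar> * norm (H s \<eta>))"
          unfolding integral_mult_right_zero[symmetric]
          by (intro Bochner_Integration.integral_cong) (simp_all add: mult.assoc abs_mult)
        moreover have "0 \<le> \<bar>\<Gamma> \<eta>\<bar> * (LINT s|lborel. \<bar>k s\<bar> * norm (H s \<eta>))"
          by (intro mult_nonneg_nonneg integral_nonneg_AE) auto
        ultimately show "norm (LINT s|lborel. norm (case (\<eta>, s) of (\<eta>, s) \<Rightarrow> \<Gamma> \<eta> *\<^sub>R (k s *\<^sub>R H s \<eta>)))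
         \<le> norm (\<bar>\<Gamma> \<eta>\<bar> * (C * (LINT s|lborel. \<bar>k s\<bar>)))" by simp
      qed
    qed
  qed
  have inner: "(LINT s|lborel. \<Gamma> \<eta> *\<^sub>R (k s *\<^sub>R H s \<eta>)) = \<Gamma> \<eta> *\<^sub>R Volterra \<psi> (\<lambda>s. fourier (w s) \<eta>) t" for \<eta>
    unfolding Volterra_def k_def[symmetric] eq by (rule integral_scaleR_right)
  show "integrable lborel (\<lambda>\<eta>. \<Gamma> \<eta> *\<^sub>R Volterra \<psi> (\<lambda>s. fourier (w s) \<eta>) t)"
    using lborel_pair.integrable_fst'[OF *] unfolding prod.case inner .
  have "(LINT \<eta>|lborel. \<Gamma> \<eta> *\<^sub>R Volterra \<psi> (\<lambda>s. fourier (w s) \<eta>) t) = (LINT s|lborel. LINT \<eta>|lborel. \<Gamma> \<eta> *\<^sub>R (k s *\<^sub>R H s \<eta>))"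
    unfolding inner[symmetric] by (rule lborel_pair.Fubini_integral[OF *, symmetric])
  also have "\<dots> = (LINT s|lborel. k s *\<^sub>R (LINT \<eta>|lborel. \<Gamma> \<eta> *\<^sub>R fourier (w s) \<eta>))"
    unfolding eq[symmetric] scaleR_left_commute[of "\<Gamma> _"] integral_scaleR_right ..
  finally show "(LINT \<eta>|lborel. \<Gamma> \<eta> *\<^sub>R Volterra \<psi> (\<lambda>s. fourier (w s) \<eta>) t)
      = Volterra \<psi> (\<lambda>s. LINT \<eta>|lborel. \<Gamma> \<eta> *\<^sub>R fourier (w s) \<eta>) t"
    by (simp add: Volterra_def k_def)
qed

section \<open>The tested mild equation\<close>

lemma continuous_on_pairing_L1_curve_bounded:
  assumes w: "L1_curve T w" and [measurable]: "\<phi> \<in> borel_measurable borel" and C: "\<And>x. norm (\<phi> x) \<le> C"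
  shows "continuous_on {0..T} (\<lambda>t. pairing (w t) \<phi>)"
proof -
  define D where "D = max 1 C"
  have D: "0 < D" "\<And>x. norm (\<phi> x) \<le> D" using C by (auto simp: D_def le_max_iff_disj)
  have "continuous_on {0..T} (\<lambda>t. of_real D * pairing (w t) (\<lambda>x. \<phi> x / of_real D))"
    using D by (intro continuous_on_mult continuous_on_const continuous_on_pairing_L1_curve[OF w])
      (auto simp: norm_divide)
  moreover have "of_real D * pairing (w t) (\<lambda>x. \<phi> x / of_real D) = pairing (w t) \<phi>" for t
    using D(1) unfolding pairing_def by (subst integral_mult_right_zero[symmetric]) simp
  ultimately show ?thesis by simp
qed

lemma powr_tangent:
  fixes x a p :: real
  assumes p: "1 < p" and a: "0 < a" and x: "0 \<le> x"
  shows "a powr p + p * a powr (p - 1) * (x - a) \<le> x powr p"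
proof (cases "x = 0")
  case True
  have "a powr (p - 1) * a = a powr p" using a by (simp add: powr_diff)
  then have "a powr p + p * a powr (p - 1) * (x - a) = (1 - p) * a powr p"
    using True by (simp add: algebra_simps)
  also have "\<dots> \<le> 0" using p by (intro mult_nonpos_nonneg) auto
  finally show ?thesis using True by simp
next
  case False
  have "x powr p - a powr p \<ge> p * a powr (p - 1) * (x - a)"
  proof (rule convex_on_imp_above_tangent[OF powr_convex])
    show "((\<lambda>x. x powr p) has_real_derivative p * a powr (p - 1)) (at a within {0<..})"
      by (rule has_field_derivative_at_within[OF has_real_derivative_powr[OF a]])
  qed (use p a x False in \<open>auto simp: interior_open\<close>)
  then show ?thesis by simp
qed

text \<open>The tangent inequality for x^p at the mean is integrated against the weight. The
  positive part matches the nonlinearity of the mild equation and is invisible where f >= 0.\<close>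

lemma weighted_Jensen_powr:
  fixes f \<xi> :: "'a \<Rightarrow> real"
  assumes p: "1 < p" and f: "integrable M (\<lambda>x. f x * \<xi> x)" "AE x in M. 0 \<le> f x"
    and \<xi>: "integrable M \<xi>" "(LINT x|M. \<xi> x) = 1" "\<And>x. 0 \<le> \<xi> x"
    and fp: "integrable M (\<lambda>x. max 0 (f x) powr p * \<xi> x)"
  shows "(LINT x|M. f x * \<xi> x) powr p \<le> (LINT x|M. max 0 (f x) powr p * \<xi> x)"
proof -
  define a where "a = (LINT x|M. f x * \<xi> x)"
  have nn: "0 \<le> a" unfolding a_def using f(2) \<xi>(3) by (intro integral_nonneg_AE) (auto elim!: eventually_mono)
  show ?thesis
  proof (cases "a = 0")
    case True
    have "0 \<le> (LINT x|M. max 0 (f x) powr p * \<xi> x)" using \<xi>(3) by (intro integral_nonneg_AE) auto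
    then show ?thesis using True by (simp add: a_def)
  next
    case False
    then have a: "0 < a" using nn by simp
    let ?q = "p * a powr (p - 1)"
    have "a powr p = (a powr p - ?q * a) * (LINT x|M. \<xi> x) + ?q * (LINT x|M. f x * \<xi> x)"
      by (simp add: \<xi>(2) a_def[symmetric])
    also have "\<dots> = (LINT x|M. (a powr p - ?q * a) * \<xi> x + ?q * (f x * \<xi> x))"
      using \<xi> f by simp
    also have "\<dots> \<le> (LINT x|M. max 0 (f x) powr p * \<xi> x)"
    proof (rule integral_mono_AE)
      show "AE x in M. (a powr p - ?q * a) * \<xi> x + ?q * (f x * \<xi> x) \<le> max 0 (f x) powr p * \<xi> x"
        using f(2)
      proof eventually_elim
        fix x assume "0 \<le> f x"
        from mult_right_mono[OF powr_tangent[OF p a this] \<xi>(3)[of x]] \<open>0 \<le> f x\<close>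
        show "(a powr p - ?q * a) * \<xi> x + ?q * (f x * \<xi> x) \<le> max 0 (f x) powr p * \<xi> x"
          by (simp add: algebra_simps)
      qed
    qed (use \<xi> f fp in auto)
    finally show ?thesis by (simp add: a_def)
  qed
qed

section \<open>The Gaussian weight and its symbol\<close>

lemma \<xi>_fun_measurable [measurable]: "\<xi>_fun R \<in> borel_measurable borel"
  unfolding \<xi>_fun_def[abs_def] by measurable

lemma \<xi>_fun_pos: "0 \<le> \<xi>_fun R x"
  by (simp add: \<xi>_fun_def)

lemma \<xi>_fun_bounded: "\<xi>_fun R (x :: real^'n) \<le> (4 * pi * R\<^sup>2) powr (- (real CARD('n) / 2))"
  by (simp add: \<xi>_fun_def mult_left_le)

lemma
  assumes R: "0 < R"
  shows integrable_\<xi>_fun: "integrable lborel (\<xi>_fun R :: real^'n \<Rightarrow> real)"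
    and integral_\<xi>_fun: "(LINT x|lborel. \<xi>_fun R (x :: real^'n)) = 1"
proof -
  let ?a = "1 / (4 * R\<^sup>2)"
  have a: "0 < ?a" using R by simp
  have e: "\<xi>_fun R x = (4 * pi * R\<^sup>2) powr (- (real CARD('n) / 2)) * exp (- ?a * (norm x)\<^sup>2)" for x :: "real^'n"
    by (simp add: \<xi>_fun_def)
  show "integrable lborel (\<xi>_fun R :: real^'n \<Rightarrow> real)"
    unfolding e[abs_def] by (intro integrable_mult_right integrable_gaussian_euclidean a)
  have "complex_of_real (LINT y|lborel. exp (- ?a * (norm (y :: real^'n))\<^sup>2)) = of_real ((pi / ?a) powr (real DIM(real^'n) / 2))"
    using Fourier_gaussian_euclidean[OF a, of "0 :: real^'n"] by (simp del: of_real_exp)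
  then have "(LINT y|lborel. exp (- ?a * (norm (y :: real^'n))\<^sup>2)) = (4 * pi * R\<^sup>2) powr (real CARD('n) / 2)"
    unfolding of_real_eq_iff by (simp add: mult_ac)
  then show "(LINT x|lborel. \<xi>_fun R (x :: real^'n)) = 1"
    unfolding e using R by (simp add: powr_minus)
qed

text \<open>The Fourier symbol of the heat kernel at time R^2, with the factor of the inverse
  transform included; the kernel itself is \<open>\<xi>_fun R\<close>.\<close>

definition heat_symbol :: "real \<Rightarrow> real^'n \<Rightarrow> real" where
  "heat_symbol R \<eta> = (2 * pi) powr (- real CARD('n)) * exp (- R\<^sup>2 * (norm \<eta>)\<^sup>2)"

lemma
  assumes R: "0 < R"
  shows integrable_heat_symbol: "integrable lborel (heat_symbol R :: real^'n \<Rightarrow> real)"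
    and integrable_norm2_heat_symbol: "integrable lborel (\<lambda>\<eta> :: real^'n. heat_symbol R \<eta> * (norm \<eta>)\<^sup>2)"
    and Fourier_heat_symbol: "(LINT \<eta>|lborel. heat_symbol R \<eta> *\<^sub>R expi \<eta> (x :: real^'n)) = of_real (\<xi>_fun R x)"
    and Fourier_norm2_heat_symbol_le:
      "Re (LINT \<eta>|lborel. (heat_symbol R \<eta> * (norm \<eta>)\<^sup>2) *\<^sub>R expi \<eta> x) \<le> real CARD('n) / (2 * R\<^sup>2) * \<xi>_fun R x"
proof -
  let ?n = "real CARD('n)"
  have a: "0 < R\<^sup>2" using R by simp
  have h: "heat_symbol R \<eta> = (2 * pi) powr (- ?n) * exp (- R\<^sup>2 * (norm \<eta>)\<^sup>2)" for \<eta> :: "real^'n"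
    by (simp add: heat_symbol_def)
  show "integrable lborel (heat_symbol R :: real^'n \<Rightarrow> real)"
    unfolding h[abs_def] by (intro integrable_mult_right integrable_gaussian_euclidean a)
  have "(\<lambda>\<eta> :: real^'n. heat_symbol R \<eta> * (norm \<eta>)\<^sup>2) = (\<lambda>\<eta>. (2 * pi) powr (- ?n) * ((norm \<eta>)\<^sup>2 * exp (- R\<^sup>2 * (norm \<eta>)\<^sup>2)))"
    by (simp add: h mult_ac)
  then show "integrable lborel (\<lambda>\<eta> :: real^'n. heat_symbol R \<eta> * (norm \<eta>)\<^sup>2)"
    by (simp only:) (intro integrable_mult_right integrable_norm2_gaussian a)
  have const: "(2 * pi) powr (- ?n) * ((pi / R\<^sup>2) powr (?n / 2) * exp (- (norm x)\<^sup>2 / (4 * R\<^sup>2))) = \<xi>_fun R x"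
  proof -
    have "(2 * pi) powr (- ?n) = ((2 * pi)\<^sup>2) powr (- (?n / 2))"
    proof -
      have "((2 * pi)\<^sup>2) powr (- (?n / 2)) = ((2 * pi) powr 2) powr (- (?n / 2))" by (subst powr_numeral) simp_all
      also have "\<dots> = (2 * pi) powr (- ?n)" unfolding powr_powr by simp
      finally show ?thesis by (rule sym)
    qed
    moreover have "(pi / R\<^sup>2) powr (?n / 2) = (R\<^sup>2 / pi) powr (- (?n / 2))"
      using R by (simp add: powr_minus flip: inverse_powr)
    moreover have "((2 * pi)\<^sup>2) powr (- (?n / 2)) * (R\<^sup>2 / pi) powr (- (?n / 2)) = ((2 * pi)\<^sup>2 * (R\<^sup>2 / pi)) powr (- (?n / 2))"
      by (rule powr_mult[symmetric])
    moreover have "(2 * pi)\<^sup>2 * (R\<^sup>2 / pi) = 4 * pi * R\<^sup>2" by (simp add: power2_eq_square)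
    ultimately show ?thesis by (simp add: \<xi>_fun_def)
  qed
  have "(LINT \<eta>|lborel. heat_symbol R \<eta> *\<^sub>R expi \<eta> x)
    = of_real ((2 * pi) powr (- ?n)) * (LINT \<eta>|lborel. of_real (exp (- R\<^sup>2 * (norm \<eta>)\<^sup>2)) * exp (- (\<i> * of_real (x \<bullet> \<eta>))))"
    unfolding integral_mult_right_zero[symmetric] by (simp add: h expi_def scaleR_conv_of_real mult_ac)
  also have "\<dots> = of_real (\<xi>_fun R x)"
    unfolding Fourier_gaussian_euclidean[OF a] const[symmetric] by simp
  finally show "(LINT \<eta>|lborel. heat_symbol R \<eta> *\<^sub>R expi \<eta> x) = of_real (\<xi>_fun R x)" .
  have "(LINT \<eta>|lborel. (heat_symbol R \<eta> * (norm \<eta>)\<^sup>2) *\<^sub>R expi \<eta> x)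
    = of_real ((2 * pi) powr (- ?n)) * (LINT \<eta>|lborel. of_real ((norm \<eta>)\<^sup>2 * exp (- R\<^sup>2 * (norm \<eta>)\<^sup>2)) * exp (- (\<i> * of_real (x \<bullet> \<eta>))))"
    unfolding integral_mult_right_zero[symmetric] by (simp add: h expi_def scaleR_conv_of_real mult_ac)
  then have "Re (LINT \<eta>|lborel. (heat_symbol R \<eta> * (norm \<eta>)\<^sup>2) *\<^sub>R expi \<eta> x)
    = (2 * pi) powr (- ?n) * Re (LINT \<eta>|lborel. of_real ((norm \<eta>)\<^sup>2 * exp (- R\<^sup>2 * (norm \<eta>)\<^sup>2)) * exp (- (\<i> * of_real (x \<bullet> \<eta>))))"
    by simp
  also have "\<dots> \<le> (2 * pi) powr (- ?n) * (?n / (2 * R\<^sup>2) * ((pi / R\<^sup>2) powr (?n / 2) * exp (- (norm x)\<^sup>2 / (4 * R\<^sup>2))))"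
    using Fourier_norm2_gaussian_le[OF a, of x] by (intro mult_left_mono) simp_all
  also have "\<dots> = ?n / (2 * R\<^sup>2) * \<xi>_fun R x" unfolding const[symmetric] by (simp only: mult_ac)
  finally show "Re (LINT \<eta>|lborel. (heat_symbol R \<eta> * (norm \<eta>)\<^sup>2) *\<^sub>R expi \<eta> x) \<le> ?n / (2 * R\<^sup>2) * \<xi>_fun R x" .
qed

context resolvents
begin

lemma mild_solution_curves:
  assumes mild: "mild_solution Z Y p u0 T u" and T: "0 < T" and p: "1 < p"
  shows "L1_curve T u" "L1_curve T (\<lambda>s x. max 0 (u s x) powr p)"
proof -
  show u: "L1_curve T u" using mild by (simp add: mild_solution_def L1_curve_def)
  obtain M where "AE t in lebesgue_on {0<..<T}. Linf_norm (u t) \<le> ennreal M"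
    using mild by (auto simp: mild_solution_def)
  then have M: "AE t in lebesgue_on {0<..<T}. Linf_norm (u t) \<le> ennreal (max 0 M)"
    by (rule eventually_mono) (auto simp: max_def ennreal_neg split: if_splits)
  show "L1_curve T (\<lambda>s x. max 0 (u s x) powr p)"
    by (rule L1_curve_powr_pos_part[OF u p L1_curve_AE_bound[OF u T M]]) simp_all
qed

text \<open>The transform of the integrand factorizes off the exceptional times of \<open>Y\<close>,
  and s -> t - s preserves null sets. Clamping the source transform and using \<open>yhat\<close>
  gives the Borel representative required by \<open>Bochner_integral_into_pairing\<close>.\<close>

lemma fourier_Duhamel_term:
  fixes N :: "real \<Rightarrow> real^'n \<Rightarrow> real"
  assumes N: "L1_curve T N" and t: "0 < t" "t < T"
    and h: "has_Bochner_integral_into L1_norm {0<..<t} (\<lambda>s. measure_conv (Y (t - s)) (N s)) h"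
  shows "fourier h \<eta> = (LINT s|lborel. indicator {0<..<t} s *\<^sub>R (yhat \<eta> (t - s) * fourier (N s) \<eta>))"
proof -
  have NF: "continuous_on {0..T} (\<lambda>s. fourier (N s) \<eta>)"
    by (rule continuous_on_pairing_L1_curve[OF N]) simp_all
  have cl[measurable]: "(\<lambda>s. fourier (N (max 0 (min T s))) \<eta>) \<in> borel_measurable borel"
    using continuous_on_clamp[OF NF] t by (intro borel_measurable_continuous_onI) auto
  let ?g = "\<lambda>s. yhat \<eta> (t - s) * fourier (N (max 0 (min T s))) \<eta>"
  have "AE s in lborel. (0 < t - s \<longrightarrow> finite_measure (Y (t - s)) \<and> sets (Y (t - s)) = sets borel)
      \<and> (0 < t - s \<longrightarrow> Fourier_measure (Y (t - s)) \<eta> = yhat \<eta> (t - s))"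
    using AE_lborel_reflect[OF AE_Y_finite] AE_lborel_reflect[OF AE_yhat] by (rule AE_conjI)
  then have "AE s in lborel. s \<in> {0<..<t} \<longrightarrow> fourier (measure_conv (Y (t - s)) (N s)) \<eta> = ?g s"
  proof eventually_elim
    case (elim s)
    show ?case
    proof
      assume s: "s \<in> {0<..<t}"
      then have "integrable lborel (N s)" using t by (intro L1_curve_integrable[OF N]) auto
      then show "fourier (measure_conv (Y (t - s)) (N s)) \<eta> = ?g s"
        using elim s t by (subst fourier_measure_conv) auto
    qed
  qed
  then have "AE s in lebesgue. s \<in> {0<..<t} \<longrightarrow> fourier (measure_conv (Y (t - s)) (N s)) \<eta> = ?g s"
    by (rule AE_completion)
  then have ae: "AE s in lebesgue_on {0<..<t}. fourier (measure_conv (Y (t - s)) (N s)) \<eta> = ?g s"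
    by (subst AE_restrict_space_iff) auto
  have "fourier h \<eta> = (LINT s|lborel. indicator {0<..<t} s *\<^sub>R ?g s)"
    by (rule Bochner_integral_into_pairing(2)[OF _ _ _ _ h _ ae, symmetric]) (use t in auto)
  also have "\<dots> = (LINT s|lborel. indicator {0<..<t} s *\<^sub>R (yhat \<eta> (t - s) * fourier (N s) \<eta>))"
    using t by (intro Bochner_Integration.integral_cong) (auto simp: indicator_def min_def max_def)
  finally show ?thesis .
qed

lemma fourier_mild_equation:
  assumes mild: "mild_solution Z Y p u0 T u" and T: "0 < T" and p: "1 < p"
    and u0: "integrable lborel u0" and t: "t \<in> {0..T}"
  shows "fourier (u t) \<eta> + of_real ((norm \<eta>)\<^sup>2) * Volterra \<psi> (\<lambda>s. fourier (u s) \<eta>) t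
    = fourier u0 \<eta> + Volterra \<psi> (\<lambda>s. fourier (\<lambda>x. max 0 (u s x) powr p) \<eta>) t"
proof (rule scalar_equation[OF _ _ T _ t])
  note curves = mild_solution_curves[OF mild T p]
  show "continuous_on {0..T} (\<lambda>s. fourier (u s) \<eta>)" "continuous_on {0..T} (\<lambda>s. fourier (\<lambda>x. max 0 (u s x) powr p) \<eta>)"
    by (auto intro!: continuous_on_pairing_L1_curve curves)
  \<comment> \<open>The open interval matters: at time 0 the operator \<open>S_op\<close> is the
    identity while \<open>zhat\<close> is set to 0, so the factorized form fails there unless the
    transform of \<open>u0\<close> vanishes.\<close>
  fix t assume t: "0 < t" "t < T"
  have "mild_equation_at L1_norm Z Y p u0 u t" using mild t by (auto simp: mild_solution_def)
  then obtain h where S: "integrable lborel (S_op Z t u0)" and ut: "integrable lborel (u t)"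
    and h: "has_Bochner_integral_into L1_norm {0<..<t} (\<lambda>s. P_op Y (t - s) (\<lambda>x. max 0 (u s x) powr p)) h"
    and eq: "L1_norm (\<lambda>x. u t x - (S_op Z t u0 x + h x)) = 0"
    by (auto simp: mild_equation_at_def L1_norm_finite_iff)
  have hi: "integrable lborel h" using h by (auto simp: has_Bochner_integral_into_def L1_norm_finite_iff)
  have "AE x in lborel. u t x = S_op Z t u0 x + h x"
  proof -
    have m: "(\<lambda>x. u t x - (S_op Z t u0 x + h x)) \<in> borel_measurable lborel"
      using S ut hi by auto
    then have "AE x in lborel. ennreal \<bar>u t x - (S_op Z t u0 x + h x)\<bar> = 0"
      using eq by (subst nn_integral_0_iff_AE[symmetric]) (auto simp: L1_norm_def)
    then show ?thesis by eventually_elim simp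
  qed
  then have "fourier (u t) \<eta> = (LINT x|lborel. complex_of_real (S_op Z t u0 x) * expi \<eta> x + of_real (h x) * expi \<eta> x)"
    unfolding pairing_def using S ut hi
    by (intro integral_cong_AE) (auto elim!: eventually_mono simp: distrib_right dest!: borel_measurable_integrable)
  also have "\<dots> = fourier (S_op Z t u0) \<eta> + fourier h \<eta>"
    unfolding pairing_def using integrable_pairing[OF S, of "expi \<eta>" 1] integrable_pairing[OF hi, of "expi \<eta>" 1] by simp
  also have "fourier (S_op Z t u0) \<eta> = fourier u0 \<eta> * zhat \<eta> t"
    using t u0 Z_prob[OF t(1)] by (simp add: S_op_def zhat_def fourier_measure_conv prob_space.finite_measure)
  also have "fourier h \<eta> = (LINT s|lborel. indicator {0<..<t} s *\<^sub>R (yhat \<eta> (t - s) * fourier (\<lambda>x. max 0 (u s x) powr p) \<eta>))"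
    by (rule fourier_Duhamel_term[OF curves(2) t h[unfolded P_op_def]])
  finally show "fourier (u t) \<eta> = fourier u0 \<eta> * zhat \<eta> t
    + (LINT s|lborel. indicator {0<..<t} s *\<^sub>R (yhat \<eta> (t - s) * fourier (\<lambda>x. max 0 (u s x) powr p) \<eta>))" .
qed

text \<open>The frequency equation is integrated against \<open>heat_symbol R\<close>; the factor
  |\<eta>|^2 goes into \<delta>, which represents minus the Laplacian of the weight without any
  differentiation.\<close>

lemma tested_equation:
  assumes mild: "mild_solution Z Y p u0 T u" and T: "0 < T" and p: "1 < p" and R: "0 < R"
    and u0: "integrable lborel u0" and t: "t \<in> {0..T}"
  defines "\<phi> \<equiv> \<lambda>x. complex_of_real (\<xi>_fun R x)"
    and "\<delta> \<equiv> \<lambda>x. LINT \<eta>|lborel. (heat_symbol R \<eta> * (norm \<eta>)\<^sup>2) *\<^sub>R expi \<eta> x"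
  shows "pairing (u t) \<phi> + Volterra \<psi> (\<lambda>s. pairing (u s) \<delta>) t
    = pairing u0 \<phi> + Volterra \<psi> (\<lambda>s. pairing (\<lambda>x. max 0 (u s x) powr p) \<phi>) t"
proof -
  let ?N = "\<lambda>s x. max 0 (u s x) powr p"
  note curves = mild_solution_curves[OF mild T p]
  have h1: "integrable lborel (heat_symbol R :: real^'n \<Rightarrow> real)" by (rule integrable_heat_symbol[OF R])
  have h2: "integrable lborel (\<lambda>\<eta> :: real^'n. heat_symbol R \<eta> * (norm \<eta>)\<^sup>2)" by (rule integrable_norm2_heat_symbol[OF R])
  have A: "(LINT \<eta>|lborel. heat_symbol R \<eta> *\<^sub>R fourier f \<eta>) = pairing f \<phi>" if "integrable lborel f" for f :: "real^'n \<Rightarrow> real"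
    unfolding integral_fourier[OF h1 that] Fourier_heat_symbol[OF R] \<phi>_def ..
  have B: "(LINT \<eta>|lborel. (heat_symbol R \<eta> * (norm \<eta>)\<^sup>2) *\<^sub>R fourier f \<eta>) = pairing f \<delta>" if "integrable lborel f" for f :: "real^'n \<Rightarrow> real"
    unfolding integral_fourier[OF h2 that] \<delta>_def ..
  have I: "integrable lborel (\<lambda>\<eta>. heat_symbol R \<eta> *\<^sub>R fourier f \<eta>)" if f: "integrable lborel f" for f :: "real^'n \<Rightarrow> real"
  proof (rule Bochner_Integration.integrable_bound)
    show "integrable lborel (\<lambda>\<eta> :: real^'n. heat_symbol R \<eta> * (LINT x|lborel. \<bar>f x\<bar>))"
      using h1 by simp
    have "continuous_on UNIV (fourier f)" using isCont_fourier[OF f] by (simp add: continuous_on_eq_continuous_at)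
    then have [measurable]: "fourier f \<in> borel_measurable borel" by (rule borel_measurable_continuous_onI)
    have [measurable]: "(heat_symbol R :: real^'n \<Rightarrow> real) \<in> borel_measurable borel" using h1 by auto
    show "(\<lambda>\<eta>. heat_symbol R \<eta> *\<^sub>R fourier f \<eta>) \<in> borel_measurable lborel" by measurable
    show "AE \<eta> in lborel. norm (heat_symbol R \<eta> *\<^sub>R fourier f \<eta>) \<le> norm (heat_symbol R \<eta> * (LINT x|lborel. \<bar>f x\<bar>))"
      using norm_fourier_le[OF f] by (auto simp: abs_mult intro!: mult_left_mono)
  qed
  have Fu: "(LINT \<eta>|lborel. (heat_symbol R \<eta> * (norm \<eta>)\<^sup>2) *\<^sub>R Volterra \<psi> (\<lambda>s. fourier (u s) \<eta>) t)
      = Volterra \<psi> (\<lambda>s. LINT \<eta>|lborel. (heat_symbol R \<eta> * (norm \<eta>)\<^sup>2) *\<^sub>R fourier (u s) \<eta>) t"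
    by (rule integral_Volterra_fourier[OF h2 curves(1) t \<psi>_integrable])
  have FN: "(LINT \<eta>|lborel. heat_symbol R \<eta> *\<^sub>R Volterra \<psi> (\<lambda>s. fourier (?N s) \<eta>) t)
      = Volterra \<psi> (\<lambda>s. LINT \<eta>|lborel. heat_symbol R \<eta> *\<^sub>R fourier (?N s) \<eta>) t"
    by (rule integral_Volterra_fourier[OF h1 curves(2) t \<psi>_integrable])
  have V: "Volterra \<psi> g t = Volterra \<psi> g' t" if "\<And>s. s \<in> {0..T} \<Longrightarrow> g s = g' s" for g g' :: "real \<Rightarrow> complex"
    unfolding Volterra_def using that t by (intro Bochner_Integration.integral_cong) (auto simp: indicator_def)
  have "pairing (u t) \<phi> + Volterra \<psi> (\<lambda>s. pairing (u s) \<delta>) t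
    = (LINT \<eta>|lborel. heat_symbol R \<eta> *\<^sub>R fourier (u t) \<eta>)
      + Volterra \<psi> (\<lambda>s. LINT \<eta>|lborel. (heat_symbol R \<eta> * (norm \<eta>)\<^sup>2) *\<^sub>R fourier (u s) \<eta>) t"
    using L1_curve_integrable[OF curves(1)] t by (subst V) (simp_all add: A B)
  also have "\<dots> = (LINT \<eta>|lborel. heat_symbol R \<eta> *\<^sub>R fourier (u t) \<eta>
      + (heat_symbol R \<eta> * (norm \<eta>)\<^sup>2) *\<^sub>R Volterra \<psi> (\<lambda>s. fourier (u s) \<eta>) t)"
    unfolding Fu[symmetric]
    by (intro Bochner_Integration.integral_add[symmetric] I L1_curve_integrable[OF curves(1) t]
      integrable_Volterra_fourier[OF h2 curves(1) t \<psi>_integrable])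
  also have "\<dots> = (LINT \<eta>|lborel. heat_symbol R \<eta> *\<^sub>R fourier u0 \<eta>
      + heat_symbol R \<eta> *\<^sub>R Volterra \<psi> (\<lambda>s. fourier (?N s) \<eta>) t)"
  proof (intro Bochner_Integration.integral_cong refl)
    fix \<eta> :: "real^'n"
    have "heat_symbol R \<eta> *\<^sub>R fourier (u t) \<eta> + (heat_symbol R \<eta> * (norm \<eta>)\<^sup>2) *\<^sub>R Volterra \<psi> (\<lambda>s. fourier (u s) \<eta>) t
      = heat_symbol R \<eta> *\<^sub>R (fourier (u t) \<eta> + of_real ((norm \<eta>)\<^sup>2) * Volterra \<psi> (\<lambda>s. fourier (u s) \<eta>) t)"
      by (simp add: scaleR_conv_of_real distrib_left)
    also have "\<dots> = heat_symbol R \<eta> *\<^sub>R (fourier u0 \<eta> + Volterra \<psi> (\<lambda>s. fourier (?N s) \<eta>) t)"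
      unfolding fourier_mild_equation[OF mild T p u0 t] ..
    finally show "heat_symbol R \<eta> *\<^sub>R fourier (u t) \<eta> + (heat_symbol R \<eta> * (norm \<eta>)\<^sup>2) *\<^sub>R Volterra \<psi> (\<lambda>s. fourier (u s) \<eta>) t
      = heat_symbol R \<eta> *\<^sub>R fourier u0 \<eta> + heat_symbol R \<eta> *\<^sub>R Volterra \<psi> (\<lambda>s. fourier (?N s) \<eta>) t"
      by (simp add: scaleR_right_distrib)
  qed
  also have "\<dots> = (LINT \<eta>|lborel. heat_symbol R \<eta> *\<^sub>R fourier u0 \<eta>)
      + Volterra \<psi> (\<lambda>s. LINT \<eta>|lborel. heat_symbol R \<eta> *\<^sub>R fourier (?N s) \<eta>) t"
    unfolding FN[symmetric]
    by (intro Bochner_Integration.integral_add I u0 integrable_Volterra_fourier[OF h1 curves(2) t \<psi>_integrable])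
  also have "\<dots> = pairing u0 \<phi> + Volterra \<psi> (\<lambda>s. pairing (?N s) \<phi>) t"
    using L1_curve_integrable[OF curves(2)] u0 by (subst V) (simp_all add: A)
  finally show ?thesis .
qed

end

lemma Re_pairing_of_real: "Re (pairing f (\<lambda>x. complex_of_real (\<xi> x))) = (LINT x|lborel. f x * \<xi> x)"
  unfolding pairing_def of_real_mult[symmetric] integral_complex_of_real by simp

lemma Re_Volterra:
  fixes g :: "real \<Rightarrow> complex"
  assumes "integrable lborel (\<lambda>s. (indicator {0<..<t} s * \<psi> (t - s)) *\<^sub>R g s)"
  shows "Re (Volterra \<psi> g t) = Volterra \<psi> (\<lambda>s. Re (g s)) t"
  using integral_Re[OF assms] by (simp add: Volterra_def)

context resolvents
begin

text \<open>Real part of the tested equation, with Jensen for the source and the bound on minus the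
  Laplacian of the weight for the diffusion. Both comparisons are pointwise in time and use u >= 0
  for the diffusion and for Jensen; \<psi> >= 0 carries them through the Volterra integral.\<close>

lemma tested_inequality:
  assumes mild: "mild_solution Z Y p u0 T u" and T: "0 < T" and p: "1 < p" and R: "0 < R"
    and u0: "integrable lborel u0" and nonneg: "\<And>t. t \<in> {0..T} \<Longrightarrow> AE x in lborel. 0 \<le> u t x"
  defines "F \<equiv> \<lambda>t. LINT x|lborel. u t x * \<xi>_fun R x"
  shows "continuous_on {0..T} F"
    and "\<And>t. t \<in> {0..T} \<Longrightarrow> F_init u0 R
      + Volterra \<psi> (\<lambda>s. F s powr p - real CARD('n) / (2 * R\<^sup>2) * F s) t \<le> F t"
proof -
  let ?lam = "real CARD('n) / (2 * R\<^sup>2)"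
  let ?N = "\<lambda>s x. max 0 (u s x) powr p"
  define \<phi> where "\<phi> x = complex_of_real (\<xi>_fun R x)" for x :: "real^'n"
  define \<delta> where "\<delta> x = (LINT \<eta>|lborel. (heat_symbol R \<eta> * (norm \<eta>)\<^sup>2) *\<^sub>R expi \<eta> x)" for x :: "real^'n"
  note curves = mild_solution_curves[OF mild T p]
  have h2: "integrable lborel (\<lambda>\<eta> :: real^'n. heat_symbol R \<eta> * (norm \<eta>)\<^sup>2)" by (rule integrable_norm2_heat_symbol[OF R])
  have \<phi>_m[measurable]: "\<phi> \<in> borel_measurable borel" unfolding \<phi>_def[abs_def] by measurable
  define B where "B = (4 * pi * R\<^sup>2) powr (- (real CARD('n) / 2))"
  have \<phi>_b: "norm (\<phi> x) \<le> B" for x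
    using \<xi>_fun_bounded[of R x] \<xi>_fun_pos[of R x] by (simp add: \<phi>_def B_def)
  have \<delta>_m[measurable]: "\<delta> \<in> borel_measurable borel"
  proof -
    have [measurable]: "(\<lambda>\<eta> :: real^'n. heat_symbol R \<eta> * (norm \<eta>)\<^sup>2) \<in> borel_measurable borel" using h2 by auto
    show ?thesis unfolding \<delta>_def[abs_def] by measurable
  qed
  have \<delta>_b: "norm (\<delta> x) \<le> (LINT \<eta>|lborel. norm (heat_symbol R (\<eta> :: real^'n) * (norm \<eta>)\<^sup>2))" for x
    unfolding \<delta>_def by (rule order_trans[OF integral_norm_bound]) simp
  have Fphi: "F t = Re (pairing (u t) \<phi>)" for t
    unfolding F_def \<phi>_def[abs_def] Re_pairing_of_real ..
  have cont_u\<phi>: "continuous_on {0..T} (\<lambda>s. pairing (u s) \<phi>)"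
    and cont_u\<delta>: "continuous_on {0..T} (\<lambda>s. pairing (u s) \<delta>)"
    and cont_N\<phi>: "continuous_on {0..T} (\<lambda>s. pairing (?N s) \<phi>)"
    by (rule continuous_on_pairing_L1_curve_bounded[OF curves(1) \<phi>_m \<phi>_b]
        continuous_on_pairing_L1_curve_bounded[OF curves(1) \<delta>_m \<delta>_b]
        continuous_on_pairing_L1_curve_bounded[OF curves(2) \<phi>_m \<phi>_b])+
  show F_cont: "continuous_on {0..T} F"
    unfolding Fphi[abs_def] by (intro continuous_on_Re cont_u\<phi>)
  have int\<xi>: "integrable lborel (\<lambda>x. f x * \<xi>_fun R x)" if "integrable lborel f" for f :: "real^'n \<Rightarrow> real"
    using integrable_pairing[OF that \<phi>_m \<phi>_b]
    unfolding \<phi>_def of_real_mult[symmetric] complex_of_real_integrable_eq .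
  fix t assume t: "t \<in> {0..T}"
  let ?f = "\<lambda>s. LINT x|lborel. ?N s x * \<xi>_fun R x"
  let ?G = "\<lambda>s. Re (pairing (u s) \<delta>)"
  have f_eq: "?f s = Re (pairing (?N s) \<phi>)" for s
    unfolding \<phi>_def[abs_def] Re_pairing_of_real ..
  have cont_f: "continuous_on {0..T} ?f" unfolding f_eq by (intro continuous_on_Re cont_N\<phi>)
  have cont_G: "continuous_on {0..T} ?G" by (intro continuous_on_Re cont_u\<delta>)
  have F_nonneg: "0 \<le> F s" if "s \<in> {0..T}" for s
    unfolding F_def using nonneg[OF that] \<xi>_fun_pos
    by (intro integral_nonneg_AE) (auto elim!: eventually_mono intro!: mult_nonneg_nonneg)
  have jensen: "F s powr p \<le> ?f s" if s: "s \<in> {0..T}" for s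
    unfolding F_def
    by (rule weighted_Jensen_powr[OF p int\<xi> nonneg[OF s] integrable_\<xi>_fun[OF R] integral_\<xi>_fun[OF R] \<xi>_fun_pos int\<xi>])
      (rule L1_curve_integrable[OF curves(1) s] L1_curve_integrable[OF curves(2) s])+
  have G_le: "?G s \<le> ?lam * F s" if s: "s \<in> {0..T}" for s
  proof -
    note us = L1_curve_integrable[OF curves(1) s]
    have us\<delta>: "integrable lborel (\<lambda>x. complex_of_real (u s x) * \<delta> x)"
      by (rule integrable_pairing[OF us \<delta>_m \<delta>_b])
    have "?G s = (LINT x|lborel. u s x * Re (\<delta> x))"
      unfolding pairing_def integral_Re[OF us\<delta>, symmetric] by simp
    also have "\<dots> \<le> (LINT x|lborel. ?lam * (u s x * \<xi>_fun R x))"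
    proof (rule integral_mono_AE)
      show "integrable lborel (\<lambda>x. u s x * Re (\<delta> x))" using integrable_Re[OF us\<delta>] by simp
      show "integrable lborel (\<lambda>x. ?lam * (u s x * \<xi>_fun R x))" using int\<xi>[OF us] by simp
      show "AE x in lborel. u s x * Re (\<delta> x) \<le> ?lam * (u s x * \<xi>_fun R x)"
        using nonneg[OF s]
      proof eventually_elim
        fix x assume "0 \<le> u s x"
        from mult_left_mono[OF Fourier_norm2_heat_symbol_le[OF R, of x] this]
        show "u s x * Re (\<delta> x) \<le> ?lam * (u s x * \<xi>_fun R x)" by (simp add: \<delta>_def mult_ac)
      qed
    qed
    finally show ?thesis by (simp add: F_def)
  qed
  have eqn: "F t + Volterra \<psi> ?G t = F_init u0 R + Volterra \<psi> ?f t"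
  proof -
    have "pairing (u t) \<phi> + Volterra \<psi> (\<lambda>s. pairing (u s) \<delta>) t
      = pairing u0 \<phi> + Volterra \<psi> (\<lambda>s. pairing (?N s) \<phi>) t"
      using tested_equation[OF mild T p R u0 t] by (simp add: \<phi>_def[abs_def] \<delta>_def[abs_def])
    then have "Re (pairing (u t) \<phi>) + Re (Volterra \<psi> (\<lambda>s. pairing (u s) \<delta>) t)
      = Re (pairing u0 \<phi>) + Re (Volterra \<psi> (\<lambda>s. pairing (?N s) \<phi>) t)"
      by (metis plus_complex.sel(1))
    moreover have "Re (pairing u0 \<phi>) = F_init u0 R"
      unfolding \<phi>_def[abs_def] Re_pairing_of_real F_init_def ..
    ultimately show ?thesis
      using Re_Volterra[OF Volterra_integrable[OF \<psi>_integrable cont_u\<delta> t]]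
        Re_Volterra[OF Volterra_integrable[OF \<psi>_integrable cont_N\<phi> t]]
      by (simp add: Fphi f_eq)
  qed
  have "Volterra \<psi> (\<lambda>s. F s powr p - ?lam * F s) t \<le> Volterra \<psi> (\<lambda>s. ?f s - ?G s) t"
    unfolding Volterra_def
  proof (rule integral_mono)
    have "continuous_on {0..T} (\<lambda>s. F s powr p - ?lam * F s)"
      using p by (intro continuous_on_diff continuous_on_powr' continuous_on_mult continuous_on_const F_cont) (use F_nonneg in auto)
    from Volterra_integrable[OF \<psi>_integrable this t]
    show "integrable lborel (\<lambda>s. (indicator {0<..<t} s * \<psi> (t - s)) *\<^sub>R (F s powr p - ?lam * F s))"
      by simp
    show "integrable lborel (\<lambda>s. (indicator {0<..<t} s * \<psi> (t - s)) *\<^sub>R (?f s - ?G s))"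
      using Volterra_integrable[OF \<psi>_integrable continuous_on_diff[OF cont_f cont_G] t] by simp
    show "(indicator {0<..<t} s * \<psi> (t - s)) *\<^sub>R (F s powr p - ?lam * F s)
        \<le> (indicator {0<..<t} s * \<psi> (t - s)) *\<^sub>R (?f s - ?G s)" for s
    proof (cases "s \<in> {0<..<t}")
      case True
      then have "s \<in> {0..T}" using t by auto
      from jensen[OF this] G_le[OF this] show ?thesis
        using True \<psi>_nonneg[of "t - s"] by (auto intro!: mult_left_mono)
    qed simp
  qed
  also have "\<dots> = Volterra \<psi> ?f t - Volterra \<psi> ?G t"
    unfolding Volterra_def scaleR_right_diff_distrib
    by (intro Bochner_Integration.integral_diff Volterra_integrable[OF \<psi>_integrable cont_f t] Volterra_integrable[OF \<psi>_integrable cont_G t])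
  finally show "F_init u0 R + Volterra \<psi> (\<lambda>s. F s powr p - ?lam * F s) t \<le> F t"
    using eqn by linarith
qed

end

section \<open>The existence time: from the scalar inequality to the bound\<close>

theorem theorem4p3:
  fixes \<alpha>1 \<alpha>2 c p \<beta> c\<beta> R :: real
    and \<psi> :: "real \<Rightarrow> real"
    and Z Y :: "real \<Rightarrow> (real^'n) measure"
    and u0 :: "real^'n \<Rightarrow> real"
    and u :: "real \<Rightarrow> real^'n \<Rightarrow> real"
    and Tmax :: ereal
  assumes "0 < \<alpha>1" "\<alpha>1 < 1" "0 < \<alpha>2" "\<alpha>2 < 1" "0 < c" "1 < p"
    and "Bernstein_function (\<lambda>s. inverse (\<Psi> \<alpha>1 \<alpha>2 c s))"
    and "inverse_Laplace_of_\<Psi> \<alpha>1 \<alpha>2 c \<psi>"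
    and "Z_family \<alpha>1 \<alpha>2 c Z"
    and "Y_family \<alpha>1 \<alpha>2 c Y"
    and "AE x in lborel. 0 \<le> u0 x" "L1_norm u0 < \<infinity>" "Linf_norm u0 < \<infinity>"
    and "maximal_mild_solution Z Y p u0 Tmax u"
    and "\<And>t. 0 \<le> t \<Longrightarrow> ereal t < Tmax \<Longrightarrow> AE x in lborel. 0 \<le> u t x"
    and "max \<alpha>1 \<alpha>2 < \<beta>"
    and "0 < c\<beta>" "c\<beta> \<le> 1"
    and "\<And>s t. 0 < s \<Longrightarrow> s \<le> t \<Longrightarrow> K \<psi> s \<ge> c\<beta> * (s / t) powr \<beta> * K \<psi> t"
    and "0 < R"
    and "F_init u0 R powr (p - 1) \<ge> real CARD('n) / R\<^sup>2"
  shows "Tmax < \<infinity> \<and>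
         K \<psi> (real_of_ereal Tmax) * F_init u0 R powr (p - 1)
           \<le> 2 powr (1 + \<beta> * p / (p - 1)) / c\<beta> \<and>
         Tmax \<le> ereal (K_inv \<psi> (2 powr (1 + \<beta> * p / (p - 1)) / c\<beta> * F_init u0 R powr (1 - p)))"
proof -
  interpret resolvents \<alpha>1 \<alpha>2 c \<psi> Z Y
    by unfold_locales (use assms in auto)
  let ?F0 = "F_init u0 R" and ?C = "2 powr (1 + \<beta> * p / (p - 1)) / c\<beta>"
  have p: "1 < p" and R: "0 < R" and \<beta>: "0 < \<beta>" and c\<beta>: "0 < c\<beta>" using assms by auto
  have u0: "integrable lborel u0" using assms(12) by (simp add: L1_norm_finite_iff)
  have Tmax: "0 < Tmax" and mild: "\<And>T. 0 < T \<Longrightarrow> ereal T < Tmax \<Longrightarrow> mild_solution Z Y p u0 T u"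
    using assms(14) by (auto simp: maximal_mild_solution_def)
  have K_low: "c\<beta> * (s / t) powr \<beta> * K \<psi> t \<le> K \<psi> s" if "0 < s" "s \<le> t" for s t
    using assms(19) that by blast
  have F0: "0 < ?F0"
  proof -
    have "0 \<le> ?F0"
      unfolding F_init_def using assms(11) \<xi>_fun_pos
      by (intro integral_nonneg_AE) (auto elim!: eventually_mono intro!: mult_nonneg_nonneg)
    moreover have "0 < real CARD('n) / R\<^sup>2" using R by simp
    \<comment> \<open>A vanishing mean is excluded by the size condition, because 0 powr (p - 1) is
      0.\<close>
    then have "?F0 \<noteq> 0" using assms(21) by auto
    ultimately show ?thesis by simp
  qed
  have bound: "K \<psi> T * ?F0 powr (p - 1) \<le> ?C" if T: "0 < T" "ereal T < Tmax" for T
  proof -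
    have nn: "AE x in lborel. 0 \<le> u t x" if "t \<in> {0..T}" for t
    proof (rule assms(15))
      show "ereal t < Tmax" using that le_less_trans[OF _ T(2), of "ereal t"] by simp
    qed (use that in auto)
    note test = tested_inequality[OF mild[OF T] T(1) p R u0 nn]
    show ?thesis
    proof (rule Volterra_blowup_bound[OF \<psi>_nonneg \<psi>_integrable test(1) p F0 _ test(2) T(1) \<beta> c\<beta>])
      show "2 * (real CARD('n) / (2 * R\<^sup>2)) \<le> ?F0 powr (p - 1)" using assms(21) by simp
    qed (use K_low in auto)
  qed
  have K_pos: "0 < K \<psi> s" if "0 < s" for s
  proof -
    \<comment> \<open>Unboundedness gives one time with positive \<open>K\<close>; the lower bound
      with exponent \<beta> carries positivity down to every smaller time.\<close>
    obtain t where t: "0 < t" "0 < K \<psi> t" using K_unbounded[of 0] by auto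
    have "0 < K \<psi> (max s t)"
      using K_mono[OF \<psi>_nonneg \<psi>_integrable, of "max s t" t] t by auto
    moreover have "0 < c\<beta> * (s / max s t) powr \<beta>" using c\<beta> that by auto
    ultimately show ?thesis using K_low[of s "max s t"] that by (metis less_le_trans max.cobounded1 mult_pos_pos)
  qed
  have K_cont: "continuous_on {0..} (K \<psi>)" by (rule K_continuous[OF \<psi>_integrable])
  have K_less: "K \<psi> a < K \<psi> b" if "0 \<le> a" "a < b" for a b using K_strict_increasing[OF K_pos that] .
  have finite: "Tmax < \<infinity>"
  proof (rule ccontr)
    assume "\<not> Tmax < \<infinity>"
    then have "Tmax = \<infinity>" by simp
    \<comment> \<open>For an infinite existence time the bound would hold at every T, so a T with
      \<open>K\<close> above the threshold is contradictory.\<close>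
    obtain T where "0 < T" "?C / ?F0 powr (p - 1) < K \<psi> T" using K_unbounded by blast
    moreover have "0 < ?F0 powr (p - 1)" using F0 by simp
    ultimately have "?C < K \<psi> T * ?F0 powr (p - 1)" by (simp only: pos_divide_less_eq)
    then show False using bound[of T] \<open>Tmax = \<infinity>\<close> \<open>0 < T\<close> by simp
  qed
  define \<tau> where "\<tau> = real_of_ereal Tmax"
  have \<tau>: "Tmax = ereal \<tau>" "0 < \<tau>"
    using finite Tmax by (cases Tmax; simp add: \<tau>_def)+
  have bound_\<tau>: "K \<psi> \<tau> * ?F0 powr (p - 1) \<le> ?C"
  proof -
    \<comment> \<open>The bound is known for T < \<tau> only and reaches \<tau> by left
      continuity.\<close>
    have "((\<lambda>t. K \<psi> t * ?F0 powr (p - 1)) \<longlongrightarrow> K \<psi> \<tau> * ?F0 powr (p - 1)) (at_left \<tau>)"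
    proof (intro tendsto_intros)
      have "isCont (K \<psi>) \<tau>" using K_cont \<tau>(2) by (auto intro: continuous_on_interior simp: interior_real_atLeast)
      then show "(K \<psi> \<longlongrightarrow> K \<psi> \<tau>) (at_left \<tau>)"
        by (simp add: isCont_def filterlim_at_split)
    qed
    moreover have "eventually (\<lambda>t. K \<psi> t * ?F0 powr (p - 1) \<le> ?C) (at_left \<tau>)"
      using eventually_at_left_real[OF \<tau>(2)] by eventually_elim (use \<tau>(1) bound in auto)
    ultimately show ?thesis by (intro tendsto_upperbound) auto
  qed
  have "\<tau> \<le> K_inv \<psi> (?C * ?F0 powr (1 - p))"
  proof -
    let ?y = "?C * ?F0 powr (1 - p)"
    have inj: "inj_on (K \<psi>) {0..}"
      by (rule linorder_inj_onI') (use K_less in force)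
    have y: "K \<psi> \<tau> \<le> ?y"
    proof -
      have "?F0 powr (p - 1) * ?F0 powr (1 - p) = 1" using F0 by (simp flip: powr_add)
      then have "K \<psi> \<tau> = K \<psi> \<tau> * ?F0 powr (p - 1) * ?F0 powr (1 - p)" by (simp add: mult.assoc)
      also have "\<dots> \<le> ?y" using bound_\<tau> by (rule mult_right_mono) simp
      finally show ?thesis .
    qed
    \<comment> \<open>The value of \<open>the_inv_into\<close> is meaningful only on the range of
      \<open>K\<close>; unboundedness and the intermediate value theorem, started at \<tau>, place
      ?y in it and give a preimage beyond \<tau>.\<close>
    obtain b where b: "0 < b" "?y < K \<psi> b" using K_unbounded by blast
    have "\<tau> \<le> b" using K_less[of b \<tau>] b y by (cases "\<tau> \<le> b") auto
    then obtain x where x: "\<tau> \<le> x" "x \<le> b" "K \<psi> x = ?y"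
      using IVT'[of "K \<psi>" \<tau> ?y b] y b \<tau>(2) continuous_on_subset[OF K_cont, of "{\<tau>..b}"] by auto
    have "K_inv \<psi> ?y = x"
      unfolding K_inv_def x(3)[symmetric] using x \<tau>(2) by (intro the_inv_into_f_f[OF inj]) auto
    then show ?thesis using x by simp
  qed
  with finite bound_\<tau> show ?thesis by (simp add: \<tau>(1) \<tau>_def[symmetric])
qed

end
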